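(* Let $d\ge 1$, let $\psi:\mathbb{R}^d\to\mathbb{R}$ be a kernel, and let $W$ be the standard Brownian sheet on $[0,1]^d$. For $h=(h_1,\dots,h_d)\in(0,1/2]^d$ and $t\in A_h$ put $$\hat\Psi(t,h)=\frac{1}{(\prod_{i=1}^d h_i)^{1/2}\|\psi\|}\int_{[0,1]^d}\psi_{t,h}(x)\,dW(x),$$ and define $$T(W,\psi)=\sup_{h\in(0,1/2]^d}\ \sup_{t\in A_h}\ \frac{|\hat\Psi(t,h)|-\Gamma(2^dh_1\cdots h_d)}{D(2^dh_1\cdots h_d)}.$$ Then, almost surely, $T(W,\psi)<\infty$; i.e., $T(W,\psi)$ is a tight random variable.
   Context: Kernel: a measurable function $\psi:\mathbb{R}^d\to\mathbb{R}$ such that (i) $\psi=0$ outside $[-1,1]^d$; (ii) $\psi\in L_2(\mathbb{R}^d)$; (iii) $\psi$ (restricted to $[-1,1]^d$) has bounded Hardy–Krause variation, as defined below; (iv) $\int_{\mathbb{R}^d}\psi(x)\,dx>0$. Here $\|\psi\|^2=\int_{\mathbb{R}^d}\psi^2(x)\,dx$. Notation: for $h\in(0,1/2]^d$, $A_h=\{t\in\mathbb{R}^d: h_i\le t_i\le 1-h_i,\ i=1,\dots,d\}$; for $t\in A_h$, $\psi_{t,h}(x)=\psi\big(\frac{x_1-t_1}{h_1},\dots,\frac{x_d-t_d}{h_d}\big)$, $x\in[0,1]^d$. For $r\in(0,1]$, $\Gamma(r)=(2\log(1/r))^{1/2}$ and $D(r)=(\log(e/r))^{-1/2}\log\log(e^e/r)$.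 The standard Brownian sheet $W$ on $[0,1]^d$ is the mean-zero Gaussian process with $\mathrm{Cov}(W(t),W(s))=\prod_{i=1}^d\min(t_i,s_i)$. The integral $\int g\,dW$, $g\in L_2([0,1]^d)$, is the Wiener integral, so that $\int g\,dW\sim N(0,\|g\|^2)$ and $\mathrm{Cov}(\int g_1dW,\int g_2dW)=\int g_1g_2$. The Gaussian process $(t,h)\mapsto\int\psi_{t,h}\,dW$ is taken in a version with continuous sample paths. Hardy–Krause variation: for $f:[-1,1]^d\to\mathbb{R}$ and a box $A=[a,b]\subseteq[-1,1]^d$ with $a<b$ coordinatewise, let $\Delta^{(d)}(f;A)=\sum_{j_1=0}^1\cdots\sum_{j_d=0}^1(-1)^{j_1+\cdots+j_d}f(b_1+j_1(a_1-b_1),\dots,b_d+j_d(a_d-b_d))$. The Vitali variation is $V^{(d)}(f;[-1,1]^d)=\sup_{\mathsf P}\sum_{A\in\mathsf P}|\Delta^{(d)}(f;A)|$, the supremum being over all partitions $\mathsf P$ of $[-1,1]^d$ into axis-parallel boxes generated by $d$ one-dimensional partitions of $[-1,1]$. For $1\le s\le d$ and $1\le i_1<\dots<i_s\le d$, let $V^{(s)}(f;i_1,\dots,i_s;[-1,1]^d)$ be the $s$-dimensional Vitali variation of the restriction of $f$ to the face $\{x\in[-1,1]^d: x_j=1\text{ for all }j\ne i_1,\dots,i_s\}$. Then $TV(f)=\sum_{s=1}^d\ \sum_{1\le i_1<\dots<i_s\le d}V^{(s)}(f;i_1,\dots,i_s;[-1,1]^d)$, and $f$ has bounded HK-variation if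 $TV(f)<\infty$. *)

theory Defs
  imports "HOL-Probability.Probability"
begin

text \<open>A one-dimensional partition of the interval from -1 to 1 is given by its finite set of
  division points; its cells are the pairs of consecutive division points.\<close>

definition division_points :: "real set \<Rightarrow> bool" where
  "division_points P \<longleftrightarrow> finite P \<and> P \<subseteq> {-1..1} \<and> -1 \<in> P \<and> 1 \<in> P"

definition cells :: "real set \<Rightarrow> (real \<times> real) set" where
  "cells P = {(u, v). u \<in> P \<and> v \<in> P \<and> u < v \<and> P \<inter> {u<..<v} = {}}"

text \<open>For a set \<open>I\<close> of coordinates, the boxes (lower corner, upper corner) generated by the
  partitions \<open>P i\<close>, \<open>i \<in> I\<close>, inside the face on which all coordinates outside \<open>I\<close> equal 1.
  The family \<open>P\<close> is irrelevant outside \<open>I\<close>.\<close>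

definition face_grid :: "'d set \<Rightarrow> ('d \<Rightarrow> real set) \<Rightarrow> ((real ^ 'd::finite) \<times> (real ^ 'd)) set" where
  "face_grid I P = {(a, b). (\<forall>i\<in>I. (a $ i, b $ i) \<in> cells (P i)) \<and> (\<forall>i. i \<notin> I \<longrightarrow> a $ i = 1 \<and> b $ i = 1)}"

text \<open>A choice of \<open>j \<in> {0,1}\<close> for every coordinate in \<open>I\<close> is encoded as the set
  \<open>J\<close> of coordinates with \<open>j = 1\<close>, at which the lower corner is used.\<close>

definition face_increment :: "'d set \<Rightarrow> (real ^ 'd::finite \<Rightarrow> real) \<Rightarrow> real ^ 'd \<Rightarrow> real ^ 'd \<Rightarrow> real" where
  "face_increment I f a b = (\<Sum>J\<in>Pow I. (-1) ^ card J * f (\<chi> i. if i \<in> J then a $ i else b $ i))"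

definition vitali_variation :: "'d set \<Rightarrow> (real ^ 'd::finite \<Rightarrow> real) \<Rightarrow> ennreal" where
  "vitali_variation I f =
     (SUP P\<in>{P. \<forall>i\<in>I. division_points (P i)}.
        \<Sum>(a, b)\<in>face_grid I P. ennreal \<bar>face_increment I f a b\<bar>)"

definition HK_variation :: "(real ^ 'd::finite \<Rightarrow> real) \<Rightarrow> ennreal" where
  "HK_variation f = (\<Sum>I\<in>{I. I \<noteq> {}}. vitali_variation I f)"

text \<open>By the following lemma the sum in \<open>vitali_variation\<close> is a genuine finite sum.\<close>

lemma finite_face_grid:
  fixes P :: "'d::finite \<Rightarrow> real set"
  assumes "\<forall>i\<in>I. division_points (P i)"
  shows "finite (face_grid I P)"
proof -
  define Q where "Q i = (if i \<in> I then P i else {1})" for i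
  define V where "V = vec_lambda ` (PiE UNIV Q)"
  have "finite (Q i)" for i
    using assms by (auto simp: Q_def division_points_def)
  then have V: "finite V"
    unfolding V_def by (intro finite_imageI finite_PiE) auto
  have *: "x \<in> V" if "\<And>i. x $ i \<in> Q i" for x :: "real ^ 'd"
    unfolding V_def using that by (intro image_eqI[of _ _ "vec_nth x"]) (auto simp: PiE_UNIV_domain)
  have "face_grid I P \<subseteq> V \<times> V"
  proof safe
    fix a b assume ab: "(a, b) \<in> face_grid I P"
    show "a \<in> V" "b \<in> V"
      by (rule *; use ab in \<open>force simp: face_grid_def cells_def Q_def\<close>)+
  qed
  then show ?thesis
    using V by (meson finite_SigmaI finite_subset)
qed

definition is_kernel :: "(real ^ 'd::finite \<Rightarrow> real) \<Rightarrow> bool" where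
  "is_kernel \<psi> \<longleftrightarrow>
     \<psi> \<in> borel_measurable lebesgue \<and>
     (\<forall>x. x \<notin> cbox (-1) 1 \<longrightarrow> \<psi> x = 0) \<and>
     integrable lebesgue (\<lambda>x. (\<psi> x)\<^sup>2) \<and>
     HK_variation \<psi> < \<infinity> \<and>
     (LINT x|lebesgue. \<psi> x) > 0"

definition L2norm :: "(real ^ 'd::finite \<Rightarrow> real) \<Rightarrow> real" where
  "L2norm \<psi> = sqrt (LINT x|lebesgue. (\<psi> x)\<^sup>2)"

definition scales :: "(real ^ 'd::finite) set" where
  "scales = {h. \<forall>i. 0 < h $ i \<and> h $ i \<le> 1 / 2}"

definition centers :: "real ^ 'd::finite \<Rightarrow> (real ^ 'd) set" where
  "centers h = {t. \<forall>i. h $ i \<le> t $ i \<and> t $ i \<le> 1 - h $ i}"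

definition rescaled :: "(real ^ 'd::finite \<Rightarrow> real) \<Rightarrow> real ^ 'd \<Rightarrow> real ^ 'd \<Rightarrow> real ^ 'd \<Rightarrow> real" where
  "rescaled \<psi> t h x = \<psi> (\<chi> i. (x $ i - t $ i) / h $ i)"

text \<open>Normal distributions include the degenerate ones.\<close>

definition gaussian_rv :: "'w measure \<Rightarrow> ('w \<Rightarrow> real) \<Rightarrow> bool" where
  "gaussian_rv M X \<longleftrightarrow>
     X \<in> borel_measurable M \<and>
     (\<exists>\<mu>. (AE \<omega> in M. X \<omega> = \<mu>) \<or>
          (\<exists>\<sigma>>0. distributed M lborel X (\<lambda>x. ennreal (normal_density \<mu> \<sigma> x))))"

definition gaussian_process :: "'w measure \<Rightarrow> 'i set \<Rightarrow> ('i \<Rightarrow> 'w \<Rightarrow> real) \<Rightarrow> bool" where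
  "gaussian_process M T X \<longleftrightarrow>
     (\<forall>S c. finite S \<and> S \<subseteq> T \<longrightarrow> gaussian_rv M (\<lambda>\<omega>. \<Sum>s\<in>S. c s * X s \<omega>))"

definition covariance :: "'w measure \<Rightarrow> ('w \<Rightarrow> real) \<Rightarrow> ('w \<Rightarrow> real) \<Rightarrow> real" where
  "covariance M X Y =
     (LINT \<omega>|M. (X \<omega> - (LINT \<omega>'|M. X \<omega>')) * (Y \<omega> - (LINT \<omega>'|M. Y \<omega>')))"

definition brownian_sheet :: "'w measure \<Rightarrow> (real ^ 'd::finite \<Rightarrow> 'w \<Rightarrow> real) \<Rightarrow> bool" where
  "brownian_sheet M W \<longleftrightarrow>
     gaussian_process M (cbox 0 1) W \<and>
     (\<forall>t\<in>cbox 0 1. (LINT \<omega>|M. W t \<omega>) = 0) \<and>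
     (\<forall>t\<in>cbox 0 1. \<forall>s\<in>cbox 0 1. covariance M (W t) (W s) = (\<Prod>i\<in>UNIV. min (t $ i) (s $ i)))"

text \<open>The Wiener integral on the unit cube: the integral of the indicator of \<open>[0,s]\<close> is
  \<open>W s\<close>, extended linearly to finite combinations of such indicators and then by
  \<open>L\<^sub>2\<close>-continuity. It is determined only almost surely, so it is rendered as
  a relation: \<open>X\<close> is a version of the integral of \<open>g\<close>. The \<open>L\<^sub>2\<close> distances are
  extended nonnegative integrals, so that no default values arise.\<close>

definition has_wiener_integral ::
  "'w measure \<Rightarrow> (real ^ 'd::finite \<Rightarrow> 'w \<Rightarrow> real) \<Rightarrow> (real ^ 'd \<Rightarrow> real) \<Rightarrow> ('w \<Rightarrow> real) \<Rightarrow> bool" where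
  "has_wiener_integral M W g X \<longleftrightarrow>
     g \<in> borel_measurable lebesgue \<and> X \<in> borel_measurable M \<and>
     (\<exists>(S :: nat \<Rightarrow> (real ^ 'd) set) (c :: nat \<Rightarrow> real ^ 'd \<Rightarrow> real).
        (\<forall>n. finite (S n) \<and> S n \<subseteq> cbox 0 1) \<and>
        (\<lambda>n. \<integral>\<^sup>+x\<in>cbox 0 1. ennreal ((g x - (\<Sum>s\<in>S n. c n s * indicator (cbox 0 s) x))\<^sup>2) \<partial>lebesgue)
          \<longlonglongrightarrow> 0 \<and>
        (\<lambda>n. \<integral>\<^sup>+\<omega>. ennreal ((X \<omega> - (\<Sum>s\<in>S n. c n s * W s \<omega>))\<^sup>2) \<partial>M) \<longlonglongrightarrow> 0)"

text \<open>\<open>Z t h\<close> is the integral of the kernel rescaled to center \<open>t\<close> and bandwidth \<open>h\<close>, in a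
  version whose sample paths are all jointly continuous.\<close>

definition continuous_kernel_integrals ::
  "'w measure \<Rightarrow> (real ^ 'd::finite \<Rightarrow> 'w \<Rightarrow> real) \<Rightarrow> (real ^ 'd \<Rightarrow> real)
     \<Rightarrow> (real ^ 'd \<Rightarrow> real ^ 'd \<Rightarrow> 'w \<Rightarrow> real) \<Rightarrow> bool" where
  "continuous_kernel_integrals M W \<psi> Z \<longleftrightarrow>
     (\<forall>h\<in>scales. \<forall>t\<in>centers h. has_wiener_integral M W (rescaled \<psi> t h) (Z t h)) \<and>
     (\<forall>\<omega>\<in>space M. continuous_on {(t, h). h \<in> scales \<and> t \<in> centers h} (\<lambda>(t, h). Z t h \<omega>))"

definition Gamma_scale :: "real \<Rightarrow> real" where
  "Gamma_scale r = sqrt (2 * ln (1 / r))"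

definition D_scale :: "real \<Rightarrow> real" where
  "D_scale r = ln (ln (exp (exp 1) / r)) / sqrt (ln (exp 1 / r))"

definition Psi_hat ::
  "(real ^ 'd::finite \<Rightarrow> real) \<Rightarrow> (real ^ 'd \<Rightarrow> real ^ 'd \<Rightarrow> 'w \<Rightarrow> real)
     \<Rightarrow> real ^ 'd \<Rightarrow> real ^ 'd \<Rightarrow> 'w \<Rightarrow> real" where
  "Psi_hat \<psi> Z t h \<omega> = Z t h \<omega> / (sqrt (\<Prod>i\<in>UNIV. h $ i) * L2norm \<psi>)"

definition T_stat ::
  "(real ^ 'd::finite \<Rightarrow> real) \<Rightarrow> (real ^ 'd \<Rightarrow> real ^ 'd \<Rightarrow> 'w \<Rightarrow> real) \<Rightarrow> 'w \<Rightarrow> ereal" where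
  "T_stat \<psi> Z \<omega> =
     (SUP h\<in>scales. SUP t\<in>centers h.
        ereal ((\<bar>Psi_hat \<psi> Z t h \<omega>\<bar> - Gamma_scale (2 ^ CARD('d) * (\<Prod>i\<in>UNIV. h $ i)))
               / D_scale (2 ^ CARD('d) * (\<Prod>i\<in>UNIV. h $ i))))"

definition tight_rv :: "'w measure \<Rightarrow> ('w \<Rightarrow> ereal) \<Rightarrow> bool" where
  "tight_rv M X \<longleftrightarrow>
     X \<in> borel_measurable M \<and>
     (\<forall>\<epsilon>>0. \<exists>K::real. measure M {\<omega> \<in> space M. \<bar>X \<omega>\<bar> > ereal K} < \<epsilon>)"

end

theory Submission
  imports Defs
begin

text \<open>
  A pair \<open>(t, h)\<close> is identified with the box with corners \<open>a = t - h\<close> and \<open>b = t + h\<close>, of volume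
  \<open>V\<close>. Bounded Hardy-Krause variation gives, for nested boxes, a squared \<open>L\<^sub>2\<close> distance of the
  rescaled kernels of the order of the volume of the difference. The boxes with widths between
  \<open>2 ^ (- \<kappa> i - 1)\<close> and \<open>2 ^ (- \<kappa> i)\<close> are approximated by outer boxes with corners on a grid of mesh
  \<open>2 ^ (- \<kappa> i - m)\<close> in direction \<open>i\<close>. With \<open>k = \<Sum>i. \<kappa> i\<close> and \<open>m\<close> of order \<open>log k\<close>, all these
  boxes form a net of \<open>2 ^ k\<close> elements up to a power of \<open>k\<close>. Since a standard normal variable exceeds
  \<open>Gamma_scale V + c\<close> with probability of order \<open>V * exp (- c * Gamma_scale V)\<close>, a multiple of
  \<open>log k / sqrt k\<close>, the order of \<open>D_scale V\<close>, suffices for \<open>c\<close> to beat the power of \<open>k\<close>. Refining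
  \<open>m\<close> further changes the integral by at most \<open>2 ^ (- (k + m) / 2) * (k + m)\<close> up to a random factor,
  and no sharp count is needed there: a union bound over all pairs of boxes on the grid of mesh
  \<open>2 ^ (- k - m)\<close> is enough. The Borel-Cantelli lemma makes all bounds hold simultaneously with random
  constants.
\<close>

section \<open>Gaussian tails of Wiener integrals\<close>

text \<open>The count of the net leaves no slack beyond powers of \<open>k\<close>: the tail yields
  just the \<open>2 ^ (- k)\<close> that cancels \<open>2 ^ k\<close>. Hence the tail of a Wiener
  integral is needed with the sharp constant in its exponent, and the mesh has to follow the shape
  of the box; the number of shapes \<open>\<kappa>\<close> with sum \<open>k\<close> is itself only
  polynomial in \<open>k\<close>. The depth \<open>m\<close> meets two opposite demands:
  \<open>2 ^ m\<close> must stay polynomial in \<open>k\<close>, yet rounding may change the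
  normalised integral only by \<open>O(1 / k)\<close>, which \<open>D_scale\<close> absorbs.
  Rounding goes outward because a larger volume has a smaller \<open>Gamma_scale\<close>, so the
  threshold never grows, and because the rounded box stays inside the unit cube. Bounded variation
  controls sums of absolute differences, whereas the variance needs squares. The kernel is bounded,
  so a squared difference is at most a constant times the absolute one; this is why the squared
  distance is linear in the displacement of the corners.\<close>

lemma nn_integral_normal_mgf:
  assumes \<sigma>: "0 < \<sigma>"
  shows "(\<integral>\<^sup>+x. ennreal (normal_density \<mu> \<sigma> x) * ennreal (exp (l * (x - \<mu>))) \<partial>lborel)
    = ennreal (exp (l\<^sup>2 * \<sigma>\<^sup>2 / 2))"
proof -
  have eq: "normal_density \<mu> \<sigma> x * exp (l * (x - \<mu>)) = exp (l\<^sup>2 * \<sigma>\<^sup>2 / 2) * normal_density (\<mu> + l * \<sigma>\<^sup>2) \<sigma> x" for x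
  proof -
    have "- (x - \<mu>)\<^sup>2 / (2 * \<sigma>\<^sup>2) + l * (x - \<mu>) = l\<^sup>2 * \<sigma>\<^sup>2 / 2 - (x - (\<mu> + l * \<sigma>\<^sup>2))\<^sup>2 / (2 * \<sigma>\<^sup>2)"
      using \<sigma> by (simp add: field_simps power2_eq_square)
    then have "exp (- (x - \<mu>)\<^sup>2 / (2 * \<sigma>\<^sup>2)) * exp (l * (x - \<mu>)) = exp (l\<^sup>2 * \<sigma>\<^sup>2 / 2) * exp (- (x - (\<mu> + l * \<sigma>\<^sup>2))\<^sup>2 / (2 * \<sigma>\<^sup>2))"
      by (simp flip: exp_add)
    then show ?thesis
      by (simp add: normal_density_def)
  qed
  have "(\<integral>\<^sup>+x. ennreal (normal_density \<mu> \<sigma> x) * ennreal (exp (l * (x - \<mu>))) \<partial>lborel)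
    = (\<integral>\<^sup>+x. ennreal (exp (l\<^sup>2 * \<sigma>\<^sup>2 / 2)) * ennreal (normal_density (\<mu> + l * \<sigma>\<^sup>2) \<sigma> x) \<partial>lborel)"
    by (intro nn_integral_cong) (simp add: eq flip: ennreal_mult')
  also have "\<dots> = ennreal (exp (l\<^sup>2 * \<sigma>\<^sup>2 / 2)) * ennreal (\<integral>x. normal_density (\<mu> + l * \<sigma>\<^sup>2) \<sigma> x \<partial>lborel)"
    using \<sigma> by (simp add: nn_integral_cmult nn_integral_eq_integral)
  finally show ?thesis
    using \<sigma> by simp
qed

lemma (in prob_space) gaussian_rv_square_integrable:
  assumes "gaussian_rv M X"
  shows "X \<in> borel_measurable M" "integrable M X" "integrable M (\<lambda>\<omega>. (X \<omega>)\<^sup>2)"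
proof -
  show X[measurable]: "X \<in> borel_measurable M"
    using assms by (simp add: gaussian_rv_def)
  obtain \<mu> where "(AE \<omega> in M. X \<omega> = \<mu>) \<or> (\<exists>\<sigma>>0. distributed M lborel X (\<lambda>x. ennreal (normal_density \<mu> \<sigma> x)))"
    using assms by (auto simp: gaussian_rv_def)
  then have "integrable M X \<and> integrable M (\<lambda>\<omega>. (X \<omega>)\<^sup>2)"
  proof
    assume ae: "AE \<omega> in M. X \<omega> = \<mu>"
    have "integrable M X \<longleftrightarrow> integrable M (\<lambda>_. \<mu>)"
      by (intro integrable_cong_AE) (use ae in auto)
    moreover have "integrable M (\<lambda>\<omega>. (X \<omega>)\<^sup>2) \<longleftrightarrow> integrable M (\<lambda>_. \<mu>\<^sup>2)"
      by (intro integrable_cong_AE) (use ae in auto)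
    ultimately show ?thesis by simp
  next
    assume "\<exists>\<sigma>>0. distributed M lborel X (\<lambda>x. ennreal (normal_density \<mu> \<sigma> x))"
    then obtain \<sigma> where \<sigma>: "\<sigma> > 0" and d: "distributed M lborel X (\<lambda>x. ennreal (normal_density \<mu> \<sigma> x))"
      by auto
    have 1: "integrable lborel (\<lambda>x. normal_density \<mu> \<sigma> x * x)"
      using \<sigma> by (rule integrable_normal_moment_nz_1)
    have 2: "integrable lborel (\<lambda>x. normal_density \<mu> \<sigma> x * x\<^sup>2)"
    proof -
      have "integrable lborel (\<lambda>x. normal_density \<mu> \<sigma> x * (x - \<mu>)^2 + (2 * \<mu> * (normal_density \<mu> \<sigma> x * x) - \<mu>\<^sup>2 * normal_density \<mu> \<sigma> x))"
        using \<sigma> 1 by (intro Bochner_Integration.integrable_add Bochner_Integration.integrable_diff integrable_mult_right integrable_normal_moment) auto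
      then show ?thesis
        by (rule Bochner_Integration.integrable_cong[THEN iffD1, rotated -1])
           (auto simp: power2_eq_square algebra_simps)
    qed
    show ?thesis
      using distributed_integrable[OF d, of "\<lambda>x. x"] distributed_integrable[OF d, of "\<lambda>x. x\<^sup>2"] 1 2
      by simp
  qed
  then show "integrable M X" "integrable M (\<lambda>\<omega>. (X \<omega>)\<^sup>2)"
    by auto
qed

lemma (in prob_space) gaussian_rv_tail:
  assumes g: "gaussian_rv M X" and mean: "expectation X = 0"
    and var: "expectation (\<lambda>\<omega>. (X \<omega>)\<^sup>2) \<le> v" and v: "0 < v" and u: "0 \<le> u"
  shows "prob {\<omega> \<in> space M. u \<le> \<bar>X \<omega>\<bar>} \<le> 2 * exp (- u\<^sup>2 / (2 * v))"
proof (cases "u = 0")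
  case True
  have "prob {\<omega> \<in> space M. u \<le> \<bar>X \<omega>\<bar>} \<le> 1" by simp
  then show ?thesis using True by (simp add: prob_space)
next
  case False
  with u have u: "0 < u" by simp
  note [measurable] = gaussian_rv_square_integrable(1)[OF g]
  obtain \<mu> where "(AE \<omega> in M. X \<omega> = \<mu>) \<or> (\<exists>\<sigma>>0. distributed M lborel X (\<lambda>x. ennreal (normal_density \<mu> \<sigma> x)))"
    using g by (auto simp: gaussian_rv_def)
  then show ?thesis
  proof
    assume ae: "AE \<omega> in M. X \<omega> = \<mu>"
    have "expectation X = expectation (\<lambda>_. \<mu>)"
      by (intro integral_cong_AE) (use ae in auto)
    then have "\<mu> = 0" using mean by (simp add: prob_space)
    then have "AE \<omega> in M. \<not> (u \<le> \<bar>X \<omega>\<bar>)" using ae u by auto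
    then have "prob {\<omega> \<in> space M. u \<le> \<bar>X \<omega>\<bar>} = 0"
      by (subst prob_eq_0) auto
    then show ?thesis by simp
  next
    assume "\<exists>\<sigma>>0. distributed M lborel X (\<lambda>x. ennreal (normal_density \<mu> \<sigma> x))"
    then obtain \<sigma> where \<sigma>: "\<sigma> > 0" and d: "distributed M lborel X (\<lambda>x. ennreal (normal_density \<mu> \<sigma> x))"
      by auto
    have \<mu>: "\<mu> = 0" using normal_distributed_expectation[OF \<sigma> d] mean by simp
    have sv: "\<sigma>\<^sup>2 \<le> v" using normal_distributed_variance[OF \<sigma> d] mean var by simp
    \<comment> \<open>This \<open>l\<close> minimises the Chernoff exponent
      \<open>l^2 * v / 2 - l * u\<close>.\<close>
    define l where "l = u / v"
    have l: "0 < l" using u v by (simp add: l_def)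
    have mgf: "(\<integral>\<^sup>+\<omega>. ennreal (exp (m * X \<omega>)) \<partial>M) = ennreal (exp (m\<^sup>2 * \<sigma>\<^sup>2 / 2))" for m
      using distributed_nn_integral[OF d, of "\<lambda>x. ennreal (exp (m * x))"] nn_integral_normal_mgf[OF \<sigma>, of \<mu> m]
      by (simp add: \<mu>)
    have le: "exp (- (l * u)) * exp (l\<^sup>2 * \<sigma>\<^sup>2 / 2) \<le> exp (- u\<^sup>2 / (2 * v))"
    proof -
      have "l\<^sup>2 * \<sigma>\<^sup>2 / 2 \<le> l\<^sup>2 * v / 2" using sv by (simp add: mult_left_mono)
      also have "\<dots> = - u\<^sup>2 / (2 * v) + l * u" using v by (simp add: l_def field_simps power2_eq_square)
      finally show ?thesis by (simp flip: exp_add)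
    qed
    have "emeasure M {\<omega> \<in> space M. u \<le> X \<omega>} \<le> ennreal (exp (- l * u)) * (\<integral>\<^sup>+\<omega>. ennreal (exp (l * X \<omega>)) * indicator (space M) \<omega> \<partial>M)"
      using l by (intro Chernoff_ineq_nn_integral_ge) auto
    also have "(\<integral>\<^sup>+\<omega>. ennreal (exp (l * X \<omega>)) * indicator (space M) \<omega> \<partial>M) = (\<integral>\<^sup>+\<omega>. ennreal (exp (l * X \<omega>)) \<partial>M)"
      by (intro nn_integral_cong) simp
    finally have 1: "prob {\<omega> \<in> space M. u \<le> X \<omega>} \<le> exp (- u\<^sup>2 / (2 * v))"
      using le by (simp add: mgf emeasure_eq_measure flip: ennreal_mult)
    have "emeasure M {\<omega> \<in> space M. X \<omega> \<le> - u} \<le> ennreal (exp (l * - u)) * (\<integral>\<^sup>+\<omega>. ennreal (exp (- l * X \<omega>)) * indicator (space M) \<omega> \<partial>M)"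
      using l by (intro Chernoff_ineq_nn_integral_le) auto
    also have "(\<integral>\<^sup>+\<omega>. ennreal (exp (- l * X \<omega>)) * indicator (space M) \<omega> \<partial>M) = (\<integral>\<^sup>+\<omega>. ennreal (exp (- l * X \<omega>)) \<partial>M)"
      by (intro nn_integral_cong) simp
    finally have 2: "prob {\<omega> \<in> space M. X \<omega> \<le> - u} \<le> exp (- u\<^sup>2 / (2 * v))"
      using le mgf[of "- l"] by (simp add: emeasure_eq_measure flip: ennreal_mult)
    have "prob {\<omega> \<in> space M. u \<le> \<bar>X \<omega>\<bar>} \<le> prob ({\<omega> \<in> space M. u \<le> X \<omega>} \<union> {\<omega> \<in> space M. X \<omega> \<le> - u})"
      by (intro finite_measure_mono) auto
    also have "\<dots> \<le> prob {\<omega> \<in> space M. u \<le> X \<omega>} + prob {\<omega> \<in> space M. X \<omega> \<le> - u}"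
      by (intro measure_Un_le) auto
    finally show ?thesis using 1 2 by simp
  qed
qed

section \<open>The isometry on step functions and its extension to Wiener integrals\<close>

lemma integral_indicator_product:
  fixes s t :: "real ^ 'd::finite"
  assumes "s \<in> cbox 0 1" "t \<in> cbox 0 1"
  shows "integrable lebesgue (\<lambda>x. indicator (cbox 0 s) x * indicator (cbox 0 t) x :: real)"
    and "(LINT x|lebesgue. indicator (cbox 0 s) x * indicator (cbox 0 t) x) = (\<Prod>i\<in>UNIV. min (s $ i) (t $ i))"
proof -
  define m where "m = (\<chi> i. min (s $ i) (t $ i))"
  have m: "(indicator (cbox 0 s) x * indicator (cbox 0 t) x :: real) = indicator (cbox 0 m) x" for x
    by (auto simp: indicator_def m_def mem_box_cart)
  have ne: "cbox 0 m \<noteq> {}"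
    using assms by (auto simp: interval_ne_empty_cart m_def mem_box_cart)
  show "integrable lebesgue (\<lambda>x. indicator (cbox 0 s) x * indicator (cbox 0 t) x :: real)"
    unfolding m using emeasure_lborel_cbox_finite[of 0 m] by (intro integrable_real_indicator) auto
  show "(LINT x|lebesgue. indicator (cbox 0 s) x * indicator (cbox 0 t) x) = (\<Prod>i\<in>UNIV. min (s $ i) (t $ i))"
    unfolding m using ne by (simp add: content_cbox_cart m_def)
qed

text \<open>The double sum on the right is also the second moment of the same combination of values
  of \<open>W\<close>, see \<open>brownian_sheet_combination\<close>. Both together are the Wiener
  isometry for step functions. Cutting off at the unit cube is harmless, as every
  \<open>cbox 0 s\<close> lies in it.\<close>

lemma nn_integral_step_function:
  fixes S :: "(real ^ 'd::finite) set"
  assumes S: "finite S" "S \<subseteq> cbox 0 1"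
  shows "(\<integral>\<^sup>+x\<in>cbox 0 1. ennreal ((\<Sum>s\<in>S. c s * indicator (cbox 0 s) x)\<^sup>2) \<partial>lebesgue)
     = ennreal (\<Sum>s\<in>S. \<Sum>t\<in>S. c s * c t * (\<Prod>i\<in>UNIV. min (s $ i) (t $ i)))"
proof -
  have eq: "(\<Sum>s\<in>S. c s * indicator (cbox 0 s) x)\<^sup>2 = (\<Sum>s\<in>S. \<Sum>t\<in>S. c s * c t * (indicator (cbox 0 s) x * indicator (cbox 0 t) x))" for x :: "real ^ 'd"
    by (simp add: power2_eq_square sum_product mult_ac)
  have int: "integrable lebesgue (\<lambda>x. c s * c t * (indicator (cbox 0 s) x * indicator (cbox 0 t) x))" if "s \<in> S" "t \<in> S" for s t
    using integral_indicator_product(1)[of s t] S that by (intro integrable_mult_right) auto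
  have "(\<integral>\<^sup>+x\<in>cbox 0 1. ennreal ((\<Sum>s\<in>S. c s * indicator (cbox 0 s) x)\<^sup>2) \<partial>lebesgue)
      = (\<integral>\<^sup>+x. ennreal ((\<Sum>s\<in>S. c s * indicator (cbox 0 s) x)\<^sup>2) \<partial>lebesgue)"
  proof (intro nn_integral_cong)
    fix x :: "real ^ 'd"
    show "ennreal ((\<Sum>s\<in>S. c s * indicator (cbox 0 s) x)\<^sup>2) * indicator (cbox 0 1) x = ennreal ((\<Sum>s\<in>S. c s * indicator (cbox 0 s) x)\<^sup>2)"
    proof (cases "x \<in> cbox 0 1")
      case False
      then have "\<forall>s\<in>S. x \<notin> cbox 0 s"
      proof (intro ballI notI)
        fix s assume "s \<in> S" "x \<in> cbox 0 s"
        then have "s \<in> cbox 0 1" "x \<in> cbox 0 s" using S(2) by auto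
        then have "x \<in> cbox 0 1" unfolding mem_box_cart by (metis order_trans)
        with False show False ..
      qed
      then show ?thesis by simp
    qed simp
  qed
  also have "\<dots> = ennreal (LINT x|lebesgue. (\<Sum>s\<in>S. c s * indicator (cbox 0 s) x)\<^sup>2)"
  proof (intro nn_integral_eq_integral)
    show "integrable lebesgue (\<lambda>x. (\<Sum>s\<in>S. c s * indicator (cbox 0 s) x)\<^sup>2)"
      unfolding eq by (intro Bochner_Integration.integrable_sum int)
  qed simp
  also have "(LINT x|lebesgue. (\<Sum>s\<in>S. c s * indicator (cbox 0 s) x)\<^sup>2) = (\<Sum>s\<in>S. \<Sum>t\<in>S. LINT x|lebesgue. c s * c t * (indicator (cbox 0 s) x * indicator (cbox 0 t) x))"
    unfolding eq
    by (subst Bochner_Integration.integral_sum, intro Bochner_Integration.integrable_sum int)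
       (assumption | rule sum.cong refl Bochner_Integration.integral_sum int)+
  also have "\<dots> = (\<Sum>s\<in>S. \<Sum>t\<in>S. c s * c t * (\<Prod>i\<in>UNIV. min (s $ i) (t $ i)))"
    using S by (intro sum.cong refl) (subst integral_mult_right_zero, subst integral_indicator_product(2), auto)
  finally show ?thesis .
qed

lemma (in prob_space) brownian_sheet_combination:
  fixes W :: "real ^ 'd::finite \<Rightarrow> 'a \<Rightarrow> real" and c :: "real ^ 'd \<Rightarrow> real"
  assumes W: "brownian_sheet M W" and S: "finite S" "S \<subseteq> cbox 0 1"
  defines "Y \<equiv> \<lambda>\<omega>. \<Sum>s\<in>S. c s * W s \<omega>"
  shows "gaussian_rv M Y" "expectation Y = 0"
    and "expectation (\<lambda>\<omega>. (Y \<omega>)\<^sup>2) = (\<Sum>s\<in>S. \<Sum>t\<in>S. c s * c t * (\<Prod>i\<in>UNIV. min (s $ i) (t $ i)))"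
proof -
  have G: "gaussian_process M (cbox 0 1) W"
    using W by (simp add: brownian_sheet_def)
  then show "gaussian_rv M Y"
    using S unfolding Y_def gaussian_process_def by blast
  have g: "gaussian_rv M (W s)" if "s \<in> cbox 0 1" for s
    using G[unfolded gaussian_process_def, rule_format, of "{s}" "\<lambda>_. 1"] that by simp
  note sq = gaussian_rv_square_integrable[OF g]
  have mean: "expectation (W s) = 0" if "s \<in> cbox 0 1" for s
    using W that by (simp add: brownian_sheet_def)
  have cov: "expectation (\<lambda>\<omega>. W s \<omega> * W t \<omega>) = (\<Prod>i\<in>UNIV. min (s $ i) (t $ i))" if "s \<in> cbox 0 1" "t \<in> cbox 0 1" for s t
    using W that mean by (simp add: brownian_sheet_def covariance_def)
  have prodint: "integrable M (\<lambda>\<omega>. W s \<omega> * W t \<omega>)" if "s \<in> cbox 0 1" "t \<in> cbox 0 1" for s t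
  proof (rule Bochner_Integration.integrable_bound)
    show "integrable M (\<lambda>\<omega>. (W s \<omega>)\<^sup>2 + (W t \<omega>)\<^sup>2)" using sq that by auto
    show "(\<lambda>\<omega>. W s \<omega> * W t \<omega>) \<in> borel_measurable M" using sq that by auto
    show "AE \<omega> in M. norm (W s \<omega> * W t \<omega>) \<le> norm ((W s \<omega>)\<^sup>2 + (W t \<omega>)\<^sup>2)"
    proof (rule AE_I2)
      fix \<omega>
      have "2 * (\<bar>W s \<omega>\<bar> * \<bar>W t \<omega>\<bar>) \<le> \<bar>W s \<omega>\<bar>\<^sup>2 + \<bar>W t \<omega>\<bar>\<^sup>2"
        using sum_squares_bound[of "\<bar>W s \<omega>\<bar>" "\<bar>W t \<omega>\<bar>"] by simp
      moreover have "0 \<le> \<bar>W s \<omega>\<bar> * \<bar>W t \<omega>\<bar>" by simp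
      ultimately show "norm (W s \<omega> * W t \<omega>) \<le> norm ((W s \<omega>)\<^sup>2 + (W t \<omega>)\<^sup>2)"
        unfolding real_norm_def abs_mult power2_abs by linarith
    qed
  qed
  have in_cube: "s \<in> cbox 0 1" if "s \<in> S" for s using S that by auto
  show "expectation Y = 0"
    unfolding Y_def using sq(2) in_cube mean
    by (subst Bochner_Integration.integral_sum) (auto simp: mean)
  have eq: "(Y \<omega>)\<^sup>2 = (\<Sum>s\<in>S. \<Sum>t\<in>S. c s * c t * (W s \<omega> * W t \<omega>))" for \<omega>
    by (simp add: Y_def power2_eq_square sum_product mult_ac)
  have int: "integrable M (\<lambda>\<omega>. c s * c t * (W s \<omega> * W t \<omega>))" if "s \<in> S" "t \<in> S" for s t
    using prodint[of s t] in_cube that by (intro integrable_mult_right) auto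
  have "expectation (\<lambda>\<omega>. (Y \<omega>)\<^sup>2) = (\<Sum>s\<in>S. \<Sum>t\<in>S. expectation (\<lambda>\<omega>. c s * c t * (W s \<omega> * W t \<omega>)))"
    unfolding eq
    by (subst Bochner_Integration.integral_sum, intro Bochner_Integration.integrable_sum int)
       (assumption | rule sum.cong refl Bochner_Integration.integral_sum int)+
  also have "\<dots> = (\<Sum>s\<in>S. \<Sum>t\<in>S. c s * c t * (\<Prod>i\<in>UNIV. min (s $ i) (t $ i)))"
    using in_cube by (intro sum.cong refl) (subst integral_mult_right_zero, subst cov, auto)
  finally show "expectation (\<lambda>\<omega>. (Y \<omega>)\<^sup>2) = (\<Sum>s\<in>S. \<Sum>t\<in>S. c s * c t * (\<Prod>i\<in>UNIV. min (s $ i) (t $ i)))" .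
qed

text \<open>Young's inequality with a weight: the factor of the main term tends to 1 as
  \<open>e\<close> tends to 0, so that the variance is not spoilt in the limit.\<close>

lemma power2_sum_weighted_le:
  fixes a b e :: real
  assumes "0 < e"
  shows "(a + b)\<^sup>2 \<le> (1 + e) * a\<^sup>2 + (1 + 1 / e) * b\<^sup>2"
proof -
  have "2 * a * b \<le> e * a\<^sup>2 + b\<^sup>2 / e"
    using sum_squares_bound[of "sqrt e * a" "b / sqrt e"] assms
    by (simp add: power_mult_distrib power_divide)
  then show ?thesis by (simp add: power2_sum algebra_simps)
qed


text \<open>That \<open>L\<^sub>2\<close> limits of Gaussian variables are Gaussian is bypassed: the
  tail bound of an approximating step integral carries over with an error \<open>e\<close>, and
  \<open>e\<close> then tends to 0. The constant in the exponent survives this limit.\<close>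

lemma (in prob_space) wiener_integral_tail:
  fixes W :: "real ^ 'd::finite \<Rightarrow> 'a \<Rightarrow> real"
  assumes W: "brownian_sheet M W" and X: "has_wiener_integral M W g X"
    and var: "(\<integral>\<^sup>+x\<in>cbox 0 1. ennreal ((g x)\<^sup>2) \<partial>lebesgue) \<le> ennreal v"
    and v: "0 < v" and u: "0 < u"
  shows "prob {\<omega> \<in> space M. u \<le> \<bar>X \<omega>\<bar>} \<le> 2 * exp (- u\<^sup>2 / (2 * v))"
proof -
  have g[measurable]: "g \<in> borel_measurable lebesgue" and Xm[measurable]: "X \<in> borel_measurable M"
    using X by (auto simp: has_wiener_integral_def)
  obtain S :: "nat \<Rightarrow> (real ^ 'd) set" and c :: "nat \<Rightarrow> real ^ 'd \<Rightarrow> real"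
    where S: "\<And>n. finite (S n)" "\<And>n. S n \<subseteq> cbox 0 1"
      and lim_g: "(\<lambda>n. \<integral>\<^sup>+x\<in>cbox 0 1. ennreal ((g x - (\<Sum>s\<in>S n. c n s * indicator (cbox 0 s) x))\<^sup>2) \<partial>lebesgue) \<longlonglongrightarrow> 0"
      and lim_X: "(\<lambda>n. \<integral>\<^sup>+\<omega>. ennreal ((X \<omega> - (\<Sum>s\<in>S n. c n s * W s \<omega>))\<^sup>2) \<partial>M) \<longlonglongrightarrow> 0"
    using X unfolding has_wiener_integral_def by blast
  define f where "f n x = (\<Sum>s\<in>S n. c n s * indicator (cbox 0 s) x)" for n x
  define Y where "Y n \<omega> = (\<Sum>s\<in>S n. c n s * W s \<omega>)" for n \<omega>
  have cube[measurable]: "cbox 0 1 \<in> sets (lebesgue :: (real ^ 'd) measure)" by simp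
  have f[measurable]: "f n \<in> borel_measurable lebesgue" for n
    unfolding f_def by (intro borel_measurable_sum borel_measurable_times borel_measurable_const borel_measurable_indicator) auto
  note Y = brownian_sheet_combination[OF W S, of "c n" n for n, folded Y_def]
  have Ym[measurable]: "Y n \<in> borel_measurable M" for n
    using gaussian_rv_square_integrable(1)[OF Y(1)] .
  have bound: "prob {\<omega> \<in> space M. u \<le> \<bar>X \<omega>\<bar>} \<le> 2 * exp (- (u - e)\<^sup>2 / (2 * ((1 + e) * v + e))) + e"
    if e: "0 < e" "e < u" for e
  proof -
    \<comment> \<open>With \<open>e1\<close> the error term of the weighted inequality becomes
      exactly \<open>e\<close>. The tolerance \<open>e ^ 3\<close> used below makes Chebyshev's
      inequality at distance \<open>e\<close> give the probability \<open>e\<close>.\<close>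
    define e1 where "e1 = e / (1 + 1 / e)"
    have e1: "0 < e1" "(1 + 1 / e) * e1 = e" using e by (auto simp: e1_def add_pos_pos divide_simps)
    have e3: "0 < e ^ 3" using e by simp
    have "eventually (\<lambda>n. (\<integral>\<^sup>+x\<in>cbox 0 1. ennreal ((g x - f n x)\<^sup>2) \<partial>lebesgue) < ennreal e1 \<and>
        (\<integral>\<^sup>+\<omega>. ennreal ((X \<omega> - Y n \<omega>)\<^sup>2) \<partial>M) < ennreal (e ^ 3)) sequentially"
      using order_tendstoD(2)[OF lim_g, of "ennreal e1"] order_tendstoD(2)[OF lim_X, of "ennreal (e ^ 3)"] e1(1) e3
      by (intro eventually_conj) (auto simp: f_def Y_def)
    then have "\<exists>n. (\<integral>\<^sup>+x\<in>cbox 0 1. ennreal ((g x - f n x)\<^sup>2) \<partial>lebesgue) < ennreal e1 \<and>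
        (\<integral>\<^sup>+\<omega>. ennreal ((X \<omega> - Y n \<omega>)\<^sup>2) \<partial>M) < ennreal (e ^ 3)"
      by (rule eventually_happens'[OF sequentially_bot])
    then obtain n where n1: "(\<integral>\<^sup>+x\<in>cbox 0 1. ennreal ((g x - f n x)\<^sup>2) \<partial>lebesgue) \<le> ennreal e1"
      and n2: "(\<integral>\<^sup>+\<omega>. ennreal ((X \<omega> - Y n \<omega>)\<^sup>2) \<partial>M) \<le> ennreal (e ^ 3)"
      using less_imp_le by blast
    have "ennreal (expectation (\<lambda>\<omega>. (Y n \<omega>)\<^sup>2)) = (\<integral>\<^sup>+x\<in>cbox 0 1. ennreal ((f n x)\<^sup>2) \<partial>lebesgue)"
      unfolding f_def Y(3) by (rule nn_integral_step_function[OF S, symmetric])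
    also have "\<dots> \<le> (\<integral>\<^sup>+x. ennreal (1 + e) * (ennreal ((g x)\<^sup>2) * indicator (cbox 0 1) x) + ennreal (1 + 1 / e) * (ennreal ((g x - f n x)\<^sup>2) * indicator (cbox 0 1) x) \<partial>lebesgue)"
    proof (intro nn_integral_mono)
      fix x
      have "(f n x)\<^sup>2 \<le> (1 + e) * (g x)\<^sup>2 + (1 + 1 / e) * (g x - f n x)\<^sup>2"
        using power2_sum_weighted_le[OF e(1), of "g x" "f n x - g x"] by (simp add: power2_commute)
      then show "ennreal ((f n x)\<^sup>2) * indicator (cbox 0 1) x \<le> ennreal (1 + e) * (ennreal ((g x)\<^sup>2) * indicator (cbox 0 1) x) + ennreal (1 + 1 / e) * (ennreal ((g x - f n x)\<^sup>2) * indicator (cbox 0 1) x)"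
        using e by (auto simp: indicator_def ennreal_leI simp flip: ennreal_mult ennreal_plus)
    qed
    also have "\<dots> = ennreal (1 + e) * (\<integral>\<^sup>+x\<in>cbox 0 1. ennreal ((g x)\<^sup>2) \<partial>lebesgue) + ennreal (1 + 1 / e) * (\<integral>\<^sup>+x\<in>cbox 0 1. ennreal ((g x - f n x)\<^sup>2) \<partial>lebesgue)"
      by (subst nn_integral_add) (auto simp: nn_integral_cmult)
    also have "\<dots> \<le> ennreal (1 + e) * ennreal v + ennreal (1 + 1 / e) * ennreal e1"
      by (intro add_mono mult_left_mono var n1) auto
    also have "\<dots> = ennreal ((1 + e) * v + e)"
      using e v e1 by (simp flip: ennreal_mult ennreal_plus)
    finally have EY: "expectation (\<lambda>\<omega>. (Y n \<omega>)\<^sup>2) \<le> (1 + e) * v + e"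
      using e v by (subst (asm) ennreal_le_iff) (auto intro!: add_nonneg_nonneg mult_nonneg_nonneg)
    have 1: "prob {\<omega> \<in> space M. u - e \<le> \<bar>Y n \<omega>\<bar>} \<le> 2 * exp (- (u - e)\<^sup>2 / (2 * ((1 + e) * v + e)))"
      using e v by (intro gaussian_rv_tail Y EY) (auto intro!: add_pos_pos)
    have "emeasure M {\<omega> \<in> space M. e \<le> \<bar>X \<omega> - Y n \<omega>\<bar>} \<le> emeasure M {\<omega> \<in> space M. 1 \<le> ennreal (1 / e\<^sup>2) * ennreal ((X \<omega> - Y n \<omega>)\<^sup>2)}"
    proof (intro emeasure_mono subsetI; clarsimp)
      fix \<omega> assume "e \<le> \<bar>X \<omega> - Y n \<omega>\<bar>"
      then have "e\<^sup>2 \<le> (X \<omega> - Y n \<omega>)\<^sup>2"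
        using e by (metis abs_of_pos power2_abs power_mono less_imp_le)
      then have "1 \<le> (1 / e\<^sup>2) * (X \<omega> - Y n \<omega>)\<^sup>2"
        using e by (simp add: divide_simps)
      then have "ennreal 1 \<le> ennreal ((1 / e\<^sup>2) * (X \<omega> - Y n \<omega>)\<^sup>2)" by (rule ennreal_leI)
      then show "1 \<le> ennreal (1 / e\<^sup>2) * ennreal ((X \<omega> - Y n \<omega>)\<^sup>2)"
        by (simp add: ennreal_mult[symmetric] del: times_divide_eq_left)
    qed
    also have "\<dots> \<le> ennreal (1 / e\<^sup>2) * (\<integral>\<^sup>+\<omega>. ennreal ((X \<omega> - Y n \<omega>)\<^sup>2) * indicator (space M) \<omega> \<partial>M)"
      by (rule order_trans[OF _ nn_integral_Markov_inequality]) auto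
    also have "(\<integral>\<^sup>+\<omega>. ennreal ((X \<omega> - Y n \<omega>)\<^sup>2) * indicator (space M) \<omega> \<partial>M) = (\<integral>\<^sup>+\<omega>. ennreal ((X \<omega> - Y n \<omega>)\<^sup>2) \<partial>M)"
      by (intro nn_integral_cong) simp
    also have "ennreal (1 / e\<^sup>2) * \<dots> \<le> ennreal (1 / e\<^sup>2) * ennreal (e ^ 3)"
      by (intro mult_left_mono n2) auto
    also have "\<dots> = ennreal e"
      using e by (simp add: power2_eq_square power3_eq_cube flip: ennreal_mult)
    finally have 2: "prob {\<omega> \<in> space M. e \<le> \<bar>X \<omega> - Y n \<omega>\<bar>} \<le> e"
      using e by (simp add: emeasure_eq_measure)
    have "prob {\<omega> \<in> space M. u \<le> \<bar>X \<omega>\<bar>} \<le> prob ({\<omega> \<in> space M. u - e \<le> \<bar>Y n \<omega>\<bar>} \<union> {\<omega> \<in> space M. e \<le> \<bar>X \<omega> - Y n \<omega>\<bar>})"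
      by (intro finite_measure_mono) auto
    also have "\<dots> \<le> prob {\<omega> \<in> space M. u - e \<le> \<bar>Y n \<omega>\<bar>} + prob {\<omega> \<in> space M. e \<le> \<bar>X \<omega> - Y n \<omega>\<bar>}"
      by (intro measure_Un_le) auto
    finally show ?thesis using 1 2 by simp
  qed
  have "((\<lambda>e. 2 * exp (- (u - e)\<^sup>2 / (2 * ((1 + e) * v + e))) + e) \<longlongrightarrow> 2 * exp (- (u - 0)\<^sup>2 / (2 * ((1 + 0) * v + 0))) + 0) (at_right 0)"
    using v by (intro tendsto_intros) auto
  moreover have "eventually (\<lambda>e. prob {\<omega> \<in> space M. u \<le> \<bar>X \<omega>\<bar>} \<le> 2 * exp (- (u - e)\<^sup>2 / (2 * ((1 + e) * v + e))) + e) (at_right 0)"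
    using bound eventually_at_right_real[OF u] by (auto elim: eventually_mono)
  ultimately have "prob {\<omega> \<in> space M. u \<le> \<bar>X \<omega>\<bar>} \<le> 2 * exp (- (u - 0)\<^sup>2 / (2 * ((1 + 0) * v + 0))) + 0"
    by (intro tendsto_lowerbound) auto
  then show ?thesis by simp
qed

text \<open>Makes the tail bound applicable to increments between two boxes. Both approximations are
  written over the union of their index sets, with coefficients extended by 0.\<close>

lemma (in prob_space) has_wiener_integral_diff:
  fixes W :: "real ^ 'd::finite \<Rightarrow> 'a \<Rightarrow> real"
  assumes W: "brownian_sheet M W" and X: "has_wiener_integral M W g X" and X': "has_wiener_integral M W g' X'"
  shows "has_wiener_integral M W (\<lambda>x. g x - g' x) (\<lambda>\<omega>. X \<omega> - X' \<omega>)"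
proof -
  have [measurable]: "g \<in> borel_measurable lebesgue" "X \<in> borel_measurable M"
    "g' \<in> borel_measurable lebesgue" "X' \<in> borel_measurable M"
    using X X' by (auto simp: has_wiener_integral_def)
  obtain S :: "nat \<Rightarrow> (real ^ 'd) set" and c :: "nat \<Rightarrow> real ^ 'd \<Rightarrow> real"
    where S: "\<And>n. finite (S n)" "\<And>n. S n \<subseteq> cbox 0 1"
      and lim_g: "(\<lambda>n. \<integral>\<^sup>+x\<in>cbox 0 1. ennreal ((g x - (\<Sum>s\<in>S n. c n s * indicator (cbox 0 s) x))\<^sup>2) \<partial>lebesgue) \<longlonglongrightarrow> 0"
      and lim_X: "(\<lambda>n. \<integral>\<^sup>+\<omega>. ennreal ((X \<omega> - (\<Sum>s\<in>S n. c n s * W s \<omega>))\<^sup>2) \<partial>M) \<longlonglongrightarrow> 0"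
    using X unfolding has_wiener_integral_def by blast
  obtain S' :: "nat \<Rightarrow> (real ^ 'd) set" and c' :: "nat \<Rightarrow> real ^ 'd \<Rightarrow> real"
    where S': "\<And>n. finite (S' n)" "\<And>n. S' n \<subseteq> cbox 0 1"
      and lim_g': "(\<lambda>n. \<integral>\<^sup>+x\<in>cbox 0 1. ennreal ((g' x - (\<Sum>s\<in>S' n. c' n s * indicator (cbox 0 s) x))\<^sup>2) \<partial>lebesgue) \<longlonglongrightarrow> 0"
      and lim_X': "(\<lambda>n. \<integral>\<^sup>+\<omega>. ennreal ((X' \<omega> - (\<Sum>s\<in>S' n. c' n s * W s \<omega>))\<^sup>2) \<partial>M) \<longlonglongrightarrow> 0"
    using X' unfolding has_wiener_integral_def by blast
  define e where "e n s = (if s \<in> S n then c n s else 0) - (if s \<in> S' n then c' n s else 0)" for n s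
  have sums: "(\<Sum>s\<in>S n \<union> S' n. e n s * F s) = (\<Sum>s\<in>S n. c n s * F s) - (\<Sum>s\<in>S' n. c' n s * F s)"
    for n and F :: "real ^ 'd \<Rightarrow> real"
  proof -
    have "(\<Sum>s\<in>S n \<union> S' n. e n s * F s) = (\<Sum>s\<in>S n \<union> S' n. if s \<in> S n then c n s * F s else 0) - (\<Sum>s\<in>S n \<union> S' n. if s \<in> S' n then c' n s * F s else 0)"
      by (subst sum_subtractf[symmetric], intro sum.cong) (auto simp: e_def algebra_simps)
    moreover have "(S n \<union> S' n) \<inter> S n = S n" "(S n \<union> S' n) \<inter> S' n = S' n" by auto
    ultimately show ?thesis
      using S(1) S'(1) by (simp add: sum.inter_restrict[symmetric])
  qed
  have sq: "ennreal ((a - a' - (b - b'))\<^sup>2) \<le> 2 * ennreal ((a - b)\<^sup>2) + 2 * ennreal ((a' - b')\<^sup>2)" for a a' b b' :: real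
  proof -
    have "(a - a' - (b - b'))\<^sup>2 \<le> 2 * (a - b)\<^sup>2 + 2 * (a' - b')\<^sup>2"
      using power2_sum_weighted_le[of 1 "a - b" "b' - a'"] by (simp add: power2_commute algebra_simps)
    then have "ennreal ((a - a' - (b - b'))\<^sup>2) \<le> ennreal (2 * (a - b)\<^sup>2 + 2 * (a' - b')\<^sup>2)" by (rule ennreal_leI)
    then show ?thesis by (simp add: ennreal_mult)
  qed
  have cube[measurable]: "cbox 0 1 \<in> sets (lebesgue :: (real ^ 'd) measure)" by simp
  have Wm: "W s \<in> borel_measurable M" if "s \<in> cbox 0 1" for s
    using gaussian_rv_square_integrable(1)[OF brownian_sheet_combination(1)[OF W, of "{s}" "\<lambda>_. 1"]] that by simp
  have lim_zero: "f \<longlonglongrightarrow> 0" if "\<And>n. f n \<le> 2 * p n + 2 * q n" "p \<longlonglongrightarrow> 0" "q \<longlonglongrightarrow> 0" for f p q :: "nat \<Rightarrow> ennreal"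
  proof (rule tendsto_sandwich[OF _ _ tendsto_const])
    have "(\<lambda>n. 2 * p n + 2 * q n) \<longlonglongrightarrow> 2 * 0 + 2 * 0"
      by (intro tendsto_add ennreal_tendsto_cmult that) auto
    then show "(\<lambda>n. 2 * p n + 2 * q n) \<longlonglongrightarrow> 0" by simp
  qed (use that in auto)
  show ?thesis
    unfolding has_wiener_integral_def
  proof (intro conjI exI[of _ "\<lambda>n. S n \<union> S' n"] exI[of _ e])
    show "(\<lambda>n. \<integral>\<^sup>+x\<in>cbox 0 1. ennreal ((g x - g' x - (\<Sum>s\<in>S n \<union> S' n. e n s * indicator (cbox 0 s) x))\<^sup>2) \<partial>lebesgue) \<longlonglongrightarrow> 0"
    proof (rule lim_zero[OF _ lim_g lim_g'])
      fix n
      define f f' where "f = (\<lambda>x. \<Sum>s\<in>S n. c n s * indicator (cbox 0 s) x)"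
        and "f' = (\<lambda>x. \<Sum>s\<in>S' n. c' n s * indicator (cbox 0 s) x)"
      have [measurable]: "f \<in> borel_measurable lebesgue" "f' \<in> borel_measurable lebesgue"
        unfolding f_def f'_def by (intro borel_measurable_sum borel_measurable_times borel_measurable_const borel_measurable_indicator; simp)+
      have "(\<integral>\<^sup>+x\<in>cbox 0 1. ennreal ((g x - g' x - (f x - f' x))\<^sup>2) \<partial>lebesgue)
        \<le> (\<integral>\<^sup>+x. 2 * (ennreal ((g x - f x)\<^sup>2) * indicator (cbox 0 1) x) + 2 * (ennreal ((g' x - f' x)\<^sup>2) * indicator (cbox 0 1) x) \<partial>lebesgue)"
        using sq by (intro nn_integral_mono) (auto simp: indicator_def)
      also have "\<dots> = 2 * (\<integral>\<^sup>+x\<in>cbox 0 1. ennreal ((g x - f x)\<^sup>2) \<partial>lebesgue) + 2 * (\<integral>\<^sup>+x\<in>cbox 0 1. ennreal ((g' x - f' x)\<^sup>2) \<partial>lebesgue)"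
        by (subst nn_integral_add) (auto simp: nn_integral_cmult)
      finally show "(\<integral>\<^sup>+x\<in>cbox 0 1. ennreal ((g x - g' x - (\<Sum>s\<in>S n \<union> S' n. e n s * indicator (cbox 0 s) x))\<^sup>2) \<partial>lebesgue)
        \<le> 2 * (\<integral>\<^sup>+x\<in>cbox 0 1. ennreal ((g x - (\<Sum>s\<in>S n. c n s * indicator (cbox 0 s) x))\<^sup>2) \<partial>lebesgue) + 2 * (\<integral>\<^sup>+x\<in>cbox 0 1. ennreal ((g' x - (\<Sum>s\<in>S' n. c' n s * indicator (cbox 0 s) x))\<^sup>2) \<partial>lebesgue)"
        by (simp add: sums f_def f'_def)
    qed
    show "(\<lambda>n. \<integral>\<^sup>+\<omega>. ennreal ((X \<omega> - X' \<omega> - (\<Sum>s\<in>S n \<union> S' n. e n s * W s \<omega>))\<^sup>2) \<partial>M) \<longlonglongrightarrow> 0"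
    proof (rule lim_zero[OF _ lim_X lim_X'])
      fix n
      define Y Y' where "Y = (\<lambda>\<omega>. \<Sum>s\<in>S n. c n s * W s \<omega>)" and "Y' = (\<lambda>\<omega>. \<Sum>s\<in>S' n. c' n s * W s \<omega>)"
      have [measurable]: "Y \<in> borel_measurable M" "Y' \<in> borel_measurable M"
        unfolding Y_def Y'_def using S(2) S'(2) Wm
        by (intro borel_measurable_sum borel_measurable_times borel_measurable_const; blast)+
      have "(\<integral>\<^sup>+\<omega>. ennreal ((X \<omega> - X' \<omega> - (Y \<omega> - Y' \<omega>))\<^sup>2) \<partial>M)
        \<le> (\<integral>\<^sup>+\<omega>. 2 * ennreal ((X \<omega> - Y \<omega>)\<^sup>2) + 2 * ennreal ((X' \<omega> - Y' \<omega>)\<^sup>2) \<partial>M)"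
        using sq by (intro nn_integral_mono) auto
      also have "\<dots> = 2 * (\<integral>\<^sup>+\<omega>. ennreal ((X \<omega> - Y \<omega>)\<^sup>2) \<partial>M) + 2 * (\<integral>\<^sup>+\<omega>. ennreal ((X' \<omega> - Y' \<omega>)\<^sup>2) \<partial>M)"
        by (subst nn_integral_add) (auto simp: nn_integral_cmult)
      finally show "(\<integral>\<^sup>+\<omega>. ennreal ((X \<omega> - X' \<omega> - (\<Sum>s\<in>S n \<union> S' n. e n s * W s \<omega>))\<^sup>2) \<partial>M)
        \<le> 2 * (\<integral>\<^sup>+\<omega>. ennreal ((X \<omega> - (\<Sum>s\<in>S n. c n s * W s \<omega>))\<^sup>2) \<partial>M) + 2 * (\<integral>\<^sup>+\<omega>. ennreal ((X' \<omega> - (\<Sum>s\<in>S' n. c' n s * W s \<omega>))\<^sup>2) \<partial>M)"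
        by (simp add: sums Y_def Y'_def)
    qed
  qed (use S S' in auto)
qed

section \<open>Hardy-Krause variation along lines\<close>

definition upd :: "real ^ 'd::finite \<Rightarrow> 'd \<Rightarrow> real \<Rightarrow> real ^ 'd" where
  "upd x i u = (\<chi> k. if k = i then u else x $ k)"

lemma upd_nth [simp]: "upd x i u $ k = (if k = i then u else x $ k)"
  by (simp add: upd_def)

text \<open>The base point \<open>x\<close> ranges over the whole space and \<open>u\<close> is
  unrestricted, so the jumps of a kernel at the boundary of its support are counted as well.\<close>

definition line_variation_le :: "(real ^ 'd::finite \<Rightarrow> real) \<Rightarrow> real \<Rightarrow> bool" where
  "line_variation_le f V \<longleftrightarrow>
     (\<forall>x i n u. mono u \<longrightarrow> (\<Sum>l<n. \<bar>f (upd x i (u (Suc l))) - f (upd x i (u l))\<bar>) \<le> V)"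

text \<open>The corner choices split according to whether they contain \<open>i\<close>. Each choice
  \<open>S\<close> in the other coordinates fixes a line parallel to axis \<open>i\<close>, so the
  increment is an alternating sum of differences along such lines.\<close>

lemma face_increment_insert:
  fixes f :: "real ^ 'd::finite \<Rightarrow> real" and x :: "real ^ 'd"
  assumes i: "i \<notin> J"
  defines "A \<equiv> \<lambda>J u. \<chi> k. if k = i then u else if k \<in> J then x $ k else 1"
  shows "face_increment (insert i J) f (A J u) (A {} v) = (\<Sum>S\<in>Pow J. (-1) ^ card S * (f (A S v) - f (A S u)))"
proof -
  let ?h = "\<lambda>S. (-1) ^ card S * f (\<chi> k. if k \<in> S then A J u $ k else A {} v $ k)"
  have "face_increment (insert i J) f (A J u) (A {} v) = sum ?h (Pow J) + sum ?h (insert i ` Pow J)"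
    unfolding face_increment_def Pow_insert using i by (intro sum.union_disjoint) auto
  also have "sum ?h (insert i ` Pow J) = (\<Sum>S\<in>Pow J. ?h (insert i S))"
    using i by (subst sum.reindex) (auto simp: inj_on_def)
  also have "\<dots> = (\<Sum>S\<in>Pow J. - ((-1) ^ card S * f (A S u)))"
  proof (intro sum.cong refl)
    fix S assume S: "S \<in> Pow J"
    then have "i \<notin> S" using i by auto
    then have c: "card (insert i S) = Suc (card S)" by simp
    have "(\<chi> k. if k \<in> insert i S then A J u $ k else A {} v $ k) = A S u"
      using S i by (auto simp: A_def vec_eq_iff)
    with c show "?h (insert i S) = - ((-1) ^ card S * f (A S u))" by simp
  qed
  also have "sum ?h (Pow J) = (\<Sum>S\<in>Pow J. (-1) ^ card S * f (A S v))"
  proof (intro sum.cong refl)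
    fix S assume S: "S \<in> Pow J"
    then have "(\<chi> k. if k \<in> S then A J u $ k else A {} v $ k) = A S v"
      using i by (auto simp: A_def vec_eq_iff)
    then show "?h S = (-1) ^ card S * f (A S v)" by simp
  qed
  finally show ?thesis
    by (simp add: algebra_simps sum_subtractf sum_negf)
qed

text \<open>Moebius inversion over the subsets of \<open>T\<close> of
  \<open>face_increment_insert\<close>: one difference along an inner line is expressed by
  increments over boxes whose upper corner has the entry 1 in all coordinates but \<open>i\<close>,
  as the faces in \<open>HK_variation\<close> require.\<close>

lemma line_difference_expansion:
  fixes f :: "real ^ 'd::finite \<Rightarrow> real" and x :: "real ^ 'd"
  assumes i: "i \<notin> T" and x: "\<And>k. k \<noteq> i \<Longrightarrow> k \<notin> T \<Longrightarrow> x $ k = 1"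
  defines "A \<equiv> \<lambda>J u. \<chi> k. if k = i then u else if k \<in> J then x $ k else 1"
  shows "f (upd x i v) - f (upd x i u) = (\<Sum>J\<in>Pow T. (-1) ^ card J * face_increment (insert i J) f (A J u) (A {} v))"
proof -
  define G where "G S = f (A S v) - f (A S u)" for S
  define g where "g J = (\<Sum>S\<in>Pow J. (-1) ^ card S * G S)" for J
  have "G T = (\<Sum>J\<in>Pow T. (-1) ^ card J * g J)"
    by (rule inclusion_exclusion_symmetric) (auto simp: g_def)
  moreover have "g J = face_increment (insert i J) f (A J u) (A {} v)" if "J \<in> Pow T" for J
    unfolding g_def G_def A_def using that i by (intro face_increment_insert[symmetric]) auto
  moreover have "A T w = upd x i w" for w
    using x by (auto simp: A_def vec_eq_iff)
  ultimately show ?thesis by (simp add: G_def)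
qed

text \<open>After expanding each difference, the boxes belonging to one \<open>J\<close> are
  distinct cells of a single grid on the face of \<open>insert i J\<close>, so their sum is at most
  one Vitali variation. Different \<open>J\<close> give different faces, hence different summands of
  \<open>HK_variation\<close>.\<close>

lemma line_variation_le_HK:
  fixes f :: "real ^ 'd::finite \<Rightarrow> real"
  assumes u: "mono u" "\<And>l. u l \<in> {-1..1}" and x: "\<And>k. k \<noteq> i \<Longrightarrow> x $ k \<in> {-1..1}"
  shows "ennreal (\<Sum>l<n. \<bar>f (upd x i (u (Suc l))) - f (upd x i (u l))\<bar>) \<le> HK_variation f"
proof -
  \<comment> \<open>Coordinates equal to 1 are left out: there the interval from
    \<open>x $ k\<close> to 1 would be degenerate and no cell.\<close>
  define T where "T = {k. k \<noteq> i \<and> x $ k \<noteq> 1}"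
  define A where "A J u = (\<chi> k. if k = i then u else if k \<in> J then x $ k else 1)" for J and u :: real
  \<comment> \<open>Repeated values of \<open>u\<close> contribute 0. Only strict steps are cells,
    and only for them is the map \<open>e\<close> to the cells injective.\<close>
  define L where "L = {l. l < n \<and> u l < u (Suc l)}"
  define inc where "inc J l = face_increment (insert i J) f (A J (u l)) (A {} (u (Suc l)))" for J l
  have L: "finite L" "L \<subseteq> {..<n}" by (auto simp: L_def)
  have iT: "i \<notin> T" by (simp add: T_def)
  have "(\<Sum>l<n. \<bar>f (upd x i (u (Suc l))) - f (upd x i (u l))\<bar>) = (\<Sum>l\<in>L. \<bar>f (upd x i (u (Suc l))) - f (upd x i (u l))\<bar>)"
  proof (rule sum.mono_neutral_right)
    show "\<forall>l\<in>{..<n} - L. \<bar>f (upd x i (u (Suc l))) - f (upd x i (u l))\<bar> = 0"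
    proof
      fix l assume "l \<in> {..<n} - L"
      then have "u (Suc l) \<le> u l" by (auto simp: L_def)
      moreover have "u l \<le> u (Suc l)" using u(1) by (simp add: monoD)
      ultimately have "u (Suc l) = u l" by simp
      then show "\<bar>f (upd x i (u (Suc l))) - f (upd x i (u l))\<bar> = 0" by simp
    qed
  qed (use L in auto)
  also have "\<dots> \<le> (\<Sum>l\<in>L. \<Sum>J\<in>Pow T. \<bar>inc J l\<bar>)"
  proof (rule sum_mono)
    fix l
    have "f (upd x i (u (Suc l))) - f (upd x i (u l)) = (\<Sum>J\<in>Pow T. (-1) ^ card J * inc J l)"
      unfolding inc_def A_def by (rule line_difference_expansion[OF iT]) (auto simp: T_def)
    then have "\<bar>f (upd x i (u (Suc l))) - f (upd x i (u l))\<bar> \<le> (\<Sum>J\<in>Pow T. \<bar>(-1) ^ card J * inc J l\<bar>)"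
      by (metis sum_abs)
    then show "\<bar>f (upd x i (u (Suc l))) - f (upd x i (u l))\<bar> \<le> (\<Sum>J\<in>Pow T. \<bar>inc J l\<bar>)"
      by (simp add: abs_mult power_abs)
  qed
  also have "\<dots> = (\<Sum>J\<in>Pow T. \<Sum>l\<in>L. \<bar>inc J l\<bar>)" by (rule sum.swap)
  finally have "ennreal (\<Sum>l<n. \<bar>f (upd x i (u (Suc l))) - f (upd x i (u l))\<bar>) \<le> ennreal (\<Sum>J\<in>Pow T. \<Sum>l\<in>L. \<bar>inc J l\<bar>)"
    by (rule ennreal_leI)
  also have "\<dots> = (\<Sum>J\<in>Pow T. \<Sum>l\<in>L. ennreal \<bar>inc J l\<bar>)"
    by (simp add: sum_nonneg flip: sum_ennreal)
  also have "\<dots> \<le> (\<Sum>J\<in>Pow T. vitali_variation (insert i J) f)"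
  proof (rule sum_mono)
    fix J assume J: "J \<in> Pow T"
    then have iJ: "i \<notin> J" using iT by auto
    \<comment> \<open>In the directions of \<open>J\<close> the point \<open>x $ k\<close> cuts off
      the cell from \<open>x $ k\<close> to 1; in direction \<open>i\<close> the values of
      \<open>u\<close> are the division points.\<close>
    define P where "P k = (if k = i then {-1, 1} \<union> u ` {..n} else {-1, x $ k, 1})" for k
    have P: "\<forall>k\<in>insert i J. division_points (P k)"
      using u(2) x iJ by (auto simp: P_def division_points_def)
    define e where "e l = (A J (u l), A {} (u (Suc l)))" for l
    have "inj_on e L"
    proof (rule linorder_inj_onI)
      fix l l' assume ll: "l < l'" "l \<in> L" "l' \<in> L"
      then have "u l < u (Suc l)" "u (Suc l) \<le> u l'"
        using u(1) by (auto simp: L_def intro: monoD)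
      then have "A J (u l) $ i \<noteq> A J (u l') $ i" by (simp add: A_def)
      then show "e l \<noteq> e l'" by (auto simp: e_def)
    qed auto
    have grid: "e ` L \<subseteq> face_grid (insert i J) P"
    proof (rule image_subsetI)
      fix l assume l: "l \<in> L"
      then have ul: "l < n" "u l < u (Suc l)" by (auto simp: L_def)
      have "u m \<notin> {u l<..<u (Suc l)}" for m
      proof (cases "m \<le> l")
        case True
        then show ?thesis using monoD[OF u(1) True] by simp
      next
        case False
        then have "u (Suc l) \<le> u m" by (intro monoD[OF u(1)]) simp
        then show ?thesis by simp
      qed
      moreover have "-1 \<le> u l" "u (Suc l) \<le> 1" using u(2) by auto
      ultimately have "(u l, u (Suc l)) \<in> cells (P i)"
        using ul by (auto simp: cells_def P_def)
      moreover have "(x $ k, 1) \<in> cells (P k)" if "k \<in> J" for k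
      proof -
        have "k \<noteq> i" "x $ k \<noteq> 1" using that J by (auto simp: T_def)
        then have "x $ k < 1" "-1 \<le> x $ k" using x[of k] by auto
        then show ?thesis using \<open>k \<noteq> i\<close> by (auto simp: cells_def P_def)
      qed
      ultimately show "e l \<in> face_grid (insert i J) P"
        using iJ by (auto simp: e_def face_grid_def A_def)
    qed
    have "(\<Sum>l\<in>L. ennreal \<bar>inc J l\<bar>) = (\<Sum>(a, b)\<in>e ` L. ennreal \<bar>face_increment (insert i J) f a b\<bar>)"
      using \<open>inj_on e L\<close> by (subst sum.reindex) (auto simp: e_def inc_def)
    also have "\<dots> \<le> (\<Sum>(a, b)\<in>face_grid (insert i J) P. ennreal \<bar>face_increment (insert i J) f a b\<bar>)"
      using grid finite_face_grid[OF P] by (intro sum_mono2) auto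
    also have "\<dots> \<le> vitali_variation (insert i J) f"
      unfolding vitali_variation_def by (rule SUP_upper) (use P in auto)
    finally show "(\<Sum>l\<in>L. ennreal \<bar>inc J l\<bar>) \<le> vitali_variation (insert i J) f" .
  qed
  also have "\<dots> = (\<Sum>I\<in>insert i ` Pow T. vitali_variation I f)"
    using iT by (subst sum.reindex) (auto simp: inj_on_def)
  also have "\<dots> \<le> HK_variation f"
    unfolding HK_variation_def by (rule sum_mono2) auto
  finally show ?thesis .
qed

text \<open>Walk from the corner 1 to \<open>x\<close>, changing one coordinate at a time; every
  change is a variation sum with a single term.\<close>

lemma bounded_variation_bounded:
  fixes f :: "real ^ 'd::finite \<Rightarrow> real"
  assumes fin: "HK_variation f < \<infinity>" and x: "x \<in> cbox (-1) 1"
  shows "\<bar>f x\<bar> \<le> \<bar>f 1\<bar> + CARD('d) * enn2real (HK_variation f)"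
proof -
  let ?V = "enn2real (HK_variation f)"
  define y where "y S = (\<chi> k. if k \<in> S then x $ k else 1)" for S
  have "\<bar>f (y S)\<bar> \<le> \<bar>f 1\<bar> + card S * ?V" for S
  proof (induction S rule: finite_induct[OF finite])
    case 1
    have "y {} = 1" by (simp add: y_def vec_eq_iff)
    then show ?case by simp
  next
    case (2 k S)
    define u where "u j = (if j = 0 then x $ k else 1)" for j :: nat
    have "ennreal (\<Sum>l<1. \<bar>f (upd (y S) k (u (Suc l))) - f (upd (y S) k (u l))\<bar>) \<le> HK_variation f"
      using x by (intro line_variation_le_HK) (auto simp: u_def mono_def mem_box_cart y_def)
    moreover have "upd (y S) k (u 1) = y S" "upd (y S) k (u 0) = y (insert k S)"
      using 2 by (auto simp: u_def y_def vec_eq_iff)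
    ultimately have "ennreal \<bar>f (y S) - f (y (insert k S))\<bar> \<le> ennreal ?V"
      using fin by simp
    then have "\<bar>f (y S) - f (y (insert k S))\<bar> \<le> ?V"
      by (simp add: ennreal_le_iff)
    with 2 show ?case by (simp add: algebra_simps)
  qed
  from this[of UNIV] show ?thesis by (simp add: y_def)
qed

text \<open>A line that meets the cube enters and leaves it once, and each of the two jumps costs at
  most \<open>B\<close>. All other lines carry only zeros.\<close>

lemma line_variation_le_zero_extension:
  fixes f :: "real ^ 'd::finite \<Rightarrow> real"
  assumes fin: "HK_variation f < \<infinity>" and zero: "\<And>x. x \<notin> cbox (-1) 1 \<Longrightarrow> f x = 0"
    and B: "\<And>x. \<bar>f x\<bar> \<le> B"
  shows "line_variation_le f (enn2real (HK_variation f) + 2 * B)"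
  unfolding line_variation_le_def
proof (intro allI impI)
  fix x :: "real ^ 'd" and i n and u :: "nat \<Rightarrow> real" assume u: "mono u"
  let ?V = "enn2real (HK_variation f)"
  have B0: "0 \<le> B" using B[of 0] by (meson abs_ge_zero order_trans)
  show "(\<Sum>l<n. \<bar>f (upd x i (u (Suc l))) - f (upd x i (u l))\<bar>) \<le> ?V + 2 * B"
  proof (cases "\<forall>k. k \<noteq> i \<longrightarrow> x $ k \<in> {-1..1}")
    case False
    then obtain k where k: "k \<noteq> i" "x $ k \<notin> {-1..1}" by auto
    then have "f (upd x i w) = 0" for w
      by (intro zero) (auto simp: mem_box_cart intro!: exI[of _ k])
    then show ?thesis using B0 by simp
  next
    case True
    define c where "c t = max (-1) (min 1 t)" for t :: real
    \<comment> \<open>Counts the boundary crossings made up to \<open>t\<close>, so the jump terms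
      \<open>B * (p w - p v)\<close> telescope to at most \<open>2 * B\<close>. The clamping
      \<open>c\<close> keeps the remaining variation inside the cube.\<close>
    define p where "p t = (if -1 \<le> t then 1 else 0) + (if 1 < t then 1 else 0 :: real)" for t :: real
    have out: "f (upd x i w) = 0" if "w \<notin> {-1..1}" for w
      using that by (intro zero) (auto simp: mem_box_cart intro!: exI[of _ i])
    have step: "\<bar>f (upd x i w) - f (upd x i v)\<bar> \<le> \<bar>f (upd x i (c w)) - f (upd x i (c v))\<bar> + B * (p w - p v)"
      if "v \<le> w" for v w
    proof -
      consider "v < -1" "w < -1" | "v < -1" "-1 \<le> w" "w \<le> 1" | "v < -1" "1 < w"
        | "-1 \<le> v" "v \<le> 1" "w \<le> 1" | "-1 \<le> v" "v \<le> 1" "1 < w" | "1 < v"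
        by (meson not_le)
      then show ?thesis
      proof cases
        case 2
        then show ?thesis using B[of "upd x i w"] out[of v] by (simp add: p_def c_def)
      next
        case 4
        then show ?thesis using that by (simp add: p_def c_def)
      next
        case 5
        then show ?thesis using B[of "upd x i v"] out[of w] by (simp add: p_def c_def)
      qed (use that B0 out[of v] out[of w] in \<open>auto simp: p_def c_def\<close>)
    qed
    have "(\<Sum>l<n. \<bar>f (upd x i (u (Suc l))) - f (upd x i (u l))\<bar>)
      \<le> (\<Sum>l<n. \<bar>f (upd x i (c (u (Suc l)))) - f (upd x i (c (u l)))\<bar> + B * (p (u (Suc l)) - p (u l)))"
      using u by (intro sum_mono step) (simp add: monoD)
    also have "\<dots> = (\<Sum>l<n. \<bar>f (upd x i (c (u (Suc l)))) - f (upd x i (c (u l)))\<bar>) + B * (p (u n) - p (u 0))"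
      using sum_lessThan_telescope[of "\<lambda>l. p (u l)" n] by (simp add: sum.distrib sum_distrib_left[symmetric])
    also have "(\<Sum>l<n. \<bar>f (upd x i (c (u (Suc l)))) - f (upd x i (c (u l)))\<bar>) \<le> ?V"
    proof -
      have "ennreal (\<Sum>l<n. \<bar>f (upd x i ((c \<circ> u) (Suc l))) - f (upd x i ((c \<circ> u) l))\<bar>) \<le> HK_variation f"
      proof (rule line_variation_le_HK)
        show "mono (c \<circ> u)"
          using u unfolding c_def mono_def o_def by (intro allI impI max.mono min.mono order_refl) auto
        show "(c \<circ> u) l \<in> {-1..1}" for l by (simp add: c_def)
        show "x $ k \<in> {-1..1}" if "k \<noteq> i" for k using True that by blast
      qed
      also have "\<dots> = ennreal ?V" using fin by simp
      finally show ?thesis by (simp add: ennreal_le_iff)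
    qed
    also have "B * (p (u n) - p (u 0)) \<le> B * 2"
      using B0 by (intro mult_left_mono) (auto simp: p_def)
    finally show ?thesis by simp
  qed
qed

section \<open>Distance of rescaled kernels\<close>

definition box_kernel :: "(real ^ 'd::finite \<Rightarrow> real) \<Rightarrow> real ^ 'd \<Rightarrow> real ^ 'd \<Rightarrow> real ^ 'd \<Rightarrow> real" where
  "box_kernel \<psi> a b = rescaled \<psi> ((1/2) *\<^sub>R (a + b)) ((1/2) *\<^sub>R (b - a))"

section \<open>Coordinatewise changes of variables and integration over slabs\<close>

lemma prod_Basis_cart:
  fixes g :: "real ^ 'd::finite \<Rightarrow> 'b::comm_monoid_mult"
  shows "(\<Prod>j\<in>Basis. g j) = (\<Prod>i\<in>UNIV. g (axis i 1))"
proof -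
  have "Basis = range (\<lambda>i. axis i 1 :: real ^ 'd)"
    by (auto simp: Basis_vec_def)
  moreover have "inj (\<lambda>i. axis i 1 :: real ^ 'd)"
    by (auto simp: inj_on_def axis_eq_axis)
  ultimately show ?thesis
    by (metis (no_types, lifting) comp_apply prod.cong prod.reindex)
qed

lemma
  fixes h t :: "real ^ 'd::finite"
  assumes h: "\<And>i. h $ i \<noteq> 0"
  defines "T \<equiv> \<lambda>x. \<chi> i. (x $ i - t $ i) / h $ i"
  shows coordinatewise_affine_measurable: "T \<in> lebesgue \<rightarrow>\<^sub>M lebesgue"
    and nn_integral_coordinatewise_affine:
      "f \<in> borel_measurable lebesgue \<Longrightarrow>
        (\<integral>\<^sup>+x. f (T x) \<partial>lebesgue) = ennreal (\<Prod>i\<in>UNIV. \<bar>h $ i\<bar>) * (\<integral>\<^sup>+x. f x \<partial>lebesgue)"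
proof -
  define c where "c j = 1 / (h \<bullet> j)" for j
  define t' where "t' = (\<chi> i. - t $ i / h $ i)"
  have c: "c j \<noteq> 0" if "j \<in> Basis" for j
    using h that by (auto simp: c_def Basis_vec_def inner_axis)
  have T: "T = (\<lambda>x. t' + (\<Sum>j\<in>Basis. (c j * (x \<bullet> j)) *\<^sub>R j))"
  proof
    fix x
    have "T x $ i = (t' + (\<Sum>j\<in>Basis. (c j * (x \<bullet> j)) *\<^sub>R j)) $ i" for i
    proof -
      have "(\<Sum>j\<in>Basis. (c j * (x \<bullet> j)) *\<^sub>R j) $ i = (\<Sum>j\<in>Basis. (c j * (x \<bullet> j)) *\<^sub>R j) \<bullet> axis i 1"
        by (simp add: inner_axis)
      also have "\<dots> = c (axis i 1) * (x \<bullet> axis i 1)"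
        by (subst inner_sum_left_Basis) auto
      finally show ?thesis
        by (simp add: T_def t'_def c_def inner_axis diff_divide_distrib)
    qed
    then show "T x = t' + (\<Sum>j\<in>Basis. (c j * (x \<bullet> j)) *\<^sub>R j)" by (simp add: vec_eq_iff)
  qed
  have eq: "lebesgue = density (distr lebesgue lebesgue T) (\<lambda>_. ennreal (\<Prod>j\<in>Basis. \<bar>c j\<bar>))"
    unfolding T using c by (rule lebesgue_affine_euclidean)
  show meas: "T \<in> lebesgue \<rightarrow>\<^sub>M lebesgue"
    unfolding T using c by (rule lebesgue_affine_measurable)
  assume f: "f \<in> borel_measurable lebesgue"
  define p where "p = (\<Prod>i\<in>UNIV. \<bar>h $ i\<bar>)"
  have p: "0 < p" using h by (simp add: p_def prod_pos)
  have cp: "(\<Prod>j\<in>Basis. \<bar>c j\<bar>) = 1 / p"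
    by (simp add: prod_Basis_cart c_def p_def inner_axis prod_dividef)
  have "(\<integral>\<^sup>+x. f x \<partial>lebesgue) = (\<integral>\<^sup>+x. f x \<partial>density (distr lebesgue lebesgue T) (\<lambda>_. ennreal (1 / p)))"
    using eq cp by simp
  also have "\<dots> = (\<integral>\<^sup>+x. ennreal (1 / p) * f x \<partial>distr lebesgue lebesgue T)"
    using f by (subst nn_integral_density) auto
  also have "\<dots> = (\<integral>\<^sup>+x. ennreal (1 / p) * f (T x) \<partial>lebesgue)"
    using f meas by (subst nn_integral_distr) auto
  also have "\<dots> = ennreal (1 / p) * (\<integral>\<^sup>+x. f (T x) \<partial>lebesgue)"
    using f meas by (intro nn_integral_cmult) auto
  finally have "ennreal p * (\<integral>\<^sup>+x. f x \<partial>lebesgue) = (ennreal p * ennreal (1 / p)) * (\<integral>\<^sup>+x. f (T x) \<partial>lebesgue)"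
    by (simp add: mult.assoc)
  also have "ennreal p * ennreal (1 / p) = 1" using p by (simp flip: ennreal_mult)
  finally show "(\<integral>\<^sup>+x. f (T x) \<partial>lebesgue) = ennreal (\<Prod>i\<in>UNIV. \<bar>h $ i\<bar>) * (\<integral>\<^sup>+x. f x \<partial>lebesgue)"
    by (simp add: p_def)
qed

lemma rescaled_measurable:
  fixes h t :: "real ^ 'd::finite"
  assumes "\<psi> \<in> borel_measurable lebesgue" "\<And>i. h $ i \<noteq> 0"
  shows "rescaled \<psi> t h \<in> borel_measurable lebesgue"
  using measurable_comp[OF coordinatewise_affine_measurable[of h t] assms(1)] assms(2)
  by (simp add: rescaled_def[abs_def] comp_def)

lemma box_kernel_measurable:
  fixes a b :: "real ^ 'd::finite"
  assumes "\<psi> \<in> borel_measurable lebesgue" "\<And>i. a $ i < b $ i"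
  shows "box_kernel \<psi> a b \<in> borel_measurable lebesgue"
proof -
  have "((1/2) *\<^sub>R (b - a)) $ i \<noteq> 0" for i using assms(2)[of i] by simp
  then show ?thesis unfolding box_kernel_def by (rule rescaled_measurable[OF assms(1)])
qed

lemma box_kernel_apply:
  fixes a b :: "real ^ 'd::finite"
  assumes "\<And>i. a $ i < b $ i"
  shows "box_kernel \<psi> a b x = \<psi> (\<chi> i. (2 * x $ i - a $ i - b $ i) / (b $ i - a $ i))"
proof -
  have "(x $ i - (a $ i + b $ i) / 2) / ((b $ i - a $ i) / 2) = (2 * x $ i - a $ i - b $ i) / (b $ i - a $ i)" for i
    using assms[of i] by (simp add: field_simps)
  then have "(\<chi> i. (x $ i - ((1/2) *\<^sub>R (a + b)) $ i) / ((1/2) *\<^sub>R (b - a)) $ i) = (\<chi> i. (2 * x $ i - a $ i - b $ i) / (b $ i - a $ i))"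
    unfolding vec_eq_iff by simp
  then show ?thesis by (simp only: box_kernel_def rescaled_def)
qed

lemma box_kernel_outside:
  fixes a b :: "real ^ 'd::finite"
  assumes ab: "\<And>i. a $ i < b $ i" and zero: "\<And>x. x \<notin> cbox (-1) 1 \<Longrightarrow> \<psi> x = 0"
    and x: "x \<notin> cbox a b"
  shows "box_kernel \<psi> a b x = 0"
proof -
  obtain i where "x $ i < a $ i \<or> b $ i < x $ i"
    using x by (auto simp: mem_box_cart not_le)
  then have "\<not> (-1 \<le> (2 * x $ i - a $ i - b $ i) / (b $ i - a $ i) \<and> (2 * x $ i - a $ i - b $ i) / (b $ i - a $ i) \<le> 1)"
    using ab[of i] by (auto simp: field_simps)
  then show ?thesis
    unfolding box_kernel_apply[OF ab] by (intro zero) (auto simp: mem_box_cart intro!: exI[of _ i])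
qed

lemma nn_integral_translate:
  fixes v :: "real ^ 'd::finite"
  assumes "f \<in> borel_measurable lebesgue"
  shows "(\<integral>\<^sup>+x. f (x + v) \<partial>lebesgue) = (\<integral>\<^sup>+x. f x \<partial>lebesgue)"
proof -
  have "(\<chi> i. (x $ i - (- v) $ i) / (\<chi> i. 1) $ i) = x + v" for x
    by (simp add: vec_eq_iff)
  then show ?thesis
    using nn_integral_coordinatewise_affine[of "\<chi> i. 1" f "- v"] assms by simp
qed

text \<open>The support is cut into slabs of thickness \<open>s\<close> orthogonal to the \<open>i\<close>-th axis and all of them
  are translated to the first one. This replaces an application of Fubini's theorem.\<close>

lemma nn_integral_slabs:
  fixes f :: "real ^ 'd::finite \<Rightarrow> ennreal"
  assumes f[measurable]: "f \<in> borel_measurable lebesgue"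
    and supp: "\<And>x. x \<notin> cbox a b \<Longrightarrow> f x = 0" and ab: "\<And>j. a $ j < b $ j" and s: "0 < s"
    and sum: "\<And>x n. (\<Sum>l<n. f (x + (real l * s) *\<^sub>R axis i 1)) \<le> C"
  shows "(\<integral>\<^sup>+x. f x \<partial>lebesgue) \<le> C * ennreal (s * (\<Prod>j\<in>UNIV - {i}. b $ j - a $ j))"
proof -
  define b' where "b' = upd b i (a $ i + s)"
  define B where "B = {x. x \<in> cbox a b' \<and> x $ i < a $ i + s}"
  define e :: "real ^ 'd" where "e = axis i 1"
  obtain n where n: "(b $ i - a $ i) / s < real n"
    using reals_Archimedean2 by blast
  have Bm: "B \<in> sets borel"
    unfolding B_def by measurable
  then have [measurable]: "B \<in> sets lebesgue" by simp
  have trm: "(\<lambda>x. g (x + v)) \<in> borel_measurable lebesgue" if g: "g \<in> borel_measurable lebesgue" for g :: "real ^ 'd \<Rightarrow> ennreal" and v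
  proof -
    have "(\<chi> i. (x $ i - (- v) $ i) / (\<chi> i. 1) $ i) = x + v" for x
      by (simp add: vec_eq_iff)
    then show ?thesis
      using measurable_comp[OF coordinatewise_affine_measurable[of "\<chi> i. 1" "- v"] g] by (simp add: comp_def)
  qed
  define F where "F l x = f (x + (real l * s) *\<^sub>R e) * indicator B x" for l x
  have [measurable]: "F l \<in> borel_measurable lebesgue" for l
    unfolding F_def by (intro borel_measurable_times_ennreal trm borel_measurable_indicator) auto
  have "f x \<le> (\<Sum>l<n. F l (x + (- (real l * s)) *\<^sub>R e))" for x
  proof (cases "x \<in> cbox a b")
    case False
    then show ?thesis using supp by simp
  next
    case True
    define l where "l = nat \<lfloor>(x $ i - a $ i) / s\<rfloor>"
    have xi: "a $ i \<le> x $ i" "x $ i \<le> b $ i" using True by (auto simp: mem_box_cart)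
    then have "0 \<le> (x $ i - a $ i) / s" using s by simp
    then have l: "real l \<le> (x $ i - a $ i) / s" "(x $ i - a $ i) / s < real l + 1"
      unfolding l_def by linarith+
    then have l': "real l * s \<le> x $ i - a $ i" "x $ i - a $ i < real l * s + s"
      using s by (auto simp: field_simps)
    have "(x $ i - a $ i) / s \<le> (b $ i - a $ i) / s" using xi s by (intro divide_right_mono) auto
    then have ln: "l < n" using l n by linarith
    have "x + (- (real l * s)) *\<^sub>R e \<in> B"
      using True l' by (auto simp: B_def b'_def mem_box_cart e_def axis_def)
    then have "f x = F l (x + (- (real l * s)) *\<^sub>R e)"
      by (simp add: F_def)
    also have "\<dots> \<le> (\<Sum>l<n. F l (x + (- (real l * s)) *\<^sub>R e))"
      using ln by (intro member_le_sum) auto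
    finally show ?thesis .
  qed
  then have "(\<integral>\<^sup>+x. f x \<partial>lebesgue) \<le> (\<integral>\<^sup>+x. (\<Sum>l<n. F l (x + (- (real l * s)) *\<^sub>R e)) \<partial>lebesgue)"
    by (intro nn_integral_mono)
  also have "\<dots> = (\<Sum>l<n. \<integral>\<^sup>+x. F l (x + (- (real l * s)) *\<^sub>R e) \<partial>lebesgue)"
    by (intro nn_integral_sum trm) simp
  also have "\<dots> = (\<Sum>l<n. \<integral>\<^sup>+x. F l x \<partial>lebesgue)"
    by (intro sum.cong refl nn_integral_translate) simp
  also have "\<dots> = (\<integral>\<^sup>+x. (\<Sum>l<n. F l x) \<partial>lebesgue)"
    by (intro nn_integral_sum[symmetric]) simp
  also have "\<dots> \<le> (\<integral>\<^sup>+x. C * indicator B x \<partial>lebesgue)"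
    using sum by (intro nn_integral_mono) (simp add: F_def e_def flip: sum_distrib_right, rule mult_right_mono, auto)
  also have "\<dots> = C * emeasure lebesgue B"
    by (rule nn_integral_cmult_indicator) simp
  also have "emeasure lebesgue B \<le> emeasure lebesgue (cbox a b')"
    by (intro emeasure_mono) (auto simp: B_def)
  also have "emeasure lebesgue (cbox a b') = ennreal (measure lebesgue (cbox a b'))"
    using emeasure_lborel_cbox_finite[of a b'] by (intro emeasure_eq_ennreal_measure) auto
  also have "measure lebesgue (cbox a b') = (\<Prod>j\<in>UNIV. b' $ j - a $ j)"
  proof -
    have "cbox a b' \<noteq> {}" using ab s by (auto simp: interval_ne_empty_cart b'_def less_imp_le)
    then show ?thesis by (simp add: content_cbox_cart)
  qed
  also have "\<dots> = s * (\<Prod>j\<in>UNIV - {i}. b $ j - a $ j)"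
    by (subst prod.remove[of _ i]) (auto simp: b'_def intro!: prod.cong)
  finally show ?thesis
    by (simp add: mult_left_mono)
qed

lemma sum_lessThan_double:
  fixes g :: "nat \<Rightarrow> 'a::comm_monoid_add"
  shows "(\<Sum>l<2 * n. g l) = (\<Sum>l<n. g (2 * l) + g (2 * l + 1))"
  by (induction n) (auto simp: add_ac)

text \<open>The intervals between a grid point and its displaced image may overlap for neighbours.
  Every second grid point is \<open>2 * s\<close> away from the previous one, so their intervals do
  not overlap and form one monotone sequence. The even and the odd points cost \<open>V\<close>
  each.\<close>

lemma variation_near_grid:
  fixes g :: "real \<Rightarrow> real"
  assumes V: "\<And>n u. mono u \<Longrightarrow> (\<Sum>l<n. \<bar>g (u (Suc l)) - g (u l)\<bar>) \<le> V"
    and y: "\<And>r. \<bar>y r - r\<bar> \<le> s"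
  shows "(\<Sum>l<n. \<bar>g (r + real l * s) - g (y (r + real l * s))\<bar>) \<le> 2 * V"
proof -
  define G where "G l = \<bar>g (r + real l * s) - g (y (r + real l * s))\<bar>" for l
  have half: "(\<Sum>j<n. G (2 * j + p)) \<le> V" for p
  proof -
    define q where "q j = r + real (2 * j + p) * s" for j
    \<comment> \<open>Lists the two end points of each interval in increasing order, whichever of
      them is the grid point.\<close>
    define z where "z m = (if even m then min (q (m div 2)) (y (q (m div 2))) else max (q (m div 2)) (y (q (m div 2))))" for m
    have "mono z"
    proof (rule mono_iff_le_Suc[THEN iffD2], rule allI)
      fix m
      show "z m \<le> z (Suc m)"
      proof (cases "even m")
        case True
        then show ?thesis by (simp add: z_def)
      next
        case False
        then have m: "Suc m div 2 = Suc (m div 2)" by (auto elim: oddE)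
        have q: "q (Suc (m div 2)) = q (m div 2) + 2 * s" by (simp add: q_def algebra_simps)
        have "max (q (m div 2)) (y (q (m div 2))) \<le> min (q (Suc (m div 2))) (y (q (Suc (m div 2))))"
          using y[of "q (m div 2)"] y[of "q (Suc (m div 2))"] unfolding q by linarith
        then show ?thesis using False m by (simp add: z_def)
      qed
    qed
    have "(\<Sum>j<n. G (2 * j + p)) \<le> (\<Sum>l<2 * n. \<bar>g (z (Suc l)) - g (z l)\<bar>)"
      unfolding sum_lessThan_double
    proof (rule sum_mono)
      fix j
      have "G (2 * j + p) = \<bar>g (z (Suc (2 * j))) - g (z (2 * j))\<bar>"
        unfolding G_def z_def q_def by (auto simp: min_def max_def)
      then show "G (2 * j + p) \<le> \<bar>g (z (Suc (2 * j))) - g (z (2 * j))\<bar> + \<bar>g (z (Suc (2 * j + 1))) - g (z (2 * j + 1))\<bar>"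
        by simp
    qed
    also have "\<dots> \<le> V" by (rule V[OF \<open>mono z\<close>])
    finally show ?thesis .
  qed
  have "(\<Sum>l<n. G l) \<le> (\<Sum>l<2 * n. G l)" by (intro sum_mono2) (auto simp: G_def)
  also have "\<dots> = (\<Sum>j<n. G (2 * j)) + (\<Sum>j<n. G (2 * j + 1))"
    by (simp add: sum_lessThan_double sum.distrib)
  also have "\<dots> \<le> 2 * V" using half[of 0] half[of 1] by simp
  finally show ?thesis by (simp add: G_def)
qed

text \<open>On a line parallel to axis \<open>i\<close>, the kernel of the larger box at
  \<open>r\<close> is the kernel of the smaller box at a point \<open>y r\<close> within distance
  \<open>s\<close>. Along the translates by multiples of \<open>s\<close> the differences therefore
  sum to at most twice the line variation, and the slab estimate applies. The factor
  \<open>4 * B * V\<close> is \<open>2 * B\<close> from squaring times \<open>2 * V\<close>.\<close>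

lemma box_kernel_dist_one_coordinate:
  fixes \<psi> :: "real ^ 'd::finite \<Rightarrow> real"
  assumes meas: "\<psi> \<in> borel_measurable lebesgue" and V: "line_variation_le \<psi> V"
    and B: "\<And>x. \<bar>\<psi> x\<bar> \<le> B" and zero: "\<And>x. x \<notin> cbox (-1) 1 \<Longrightarrow> \<psi> x = 0"
    and ab: "\<And>j. a $ j < b $ j" and s: "0 < s"
    and other: "\<And>j. j \<noteq> i \<Longrightarrow> a' $ j = a $ j \<and> b' $ j = b $ j"
    and le: "a' $ i \<le> a $ i" "b $ i \<le> b' $ i" "a $ i - a' $ i \<le> s" "b' $ i - b $ i \<le> s"
  shows "(\<integral>\<^sup>+x. ennreal ((box_kernel \<psi> a b x - box_kernel \<psi> a' b' x)\<^sup>2) \<partial>lebesgue)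
    \<le> ennreal (4 * B * V) * ennreal (s * (\<Prod>j\<in>UNIV - {i}. b $ j - a $ j))"
proof -
  have ab': "a' $ j < b' $ j" for j
    using ab[of j] le other[of j] by (cases "j = i") auto
  have B0: "0 \<le> B" using B[of 0] by (meson abs_ge_zero order_trans)
  define G where "G x = \<bar>box_kernel \<psi> a b x - box_kernel \<psi> a' b' x\<bar>" for x
  have sub: "x \<in> cbox a' b'" if "x \<in> cbox a b" for x
    unfolding mem_box_cart
  proof
    fix j show "a' $ j \<le> x $ j \<and> x $ j \<le> b' $ j"
      using that le other[of j] unfolding mem_box_cart by (cases "j = i") (auto intro: order_trans)
  qed
  have out: "G x = 0" if "x \<notin> cbox a' b'" for x
    using sub that box_kernel_outside[of a b \<psi> x] box_kernel_outside[of a' b' \<psi> x] ab ab' zero by (auto simp: G_def)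
  have sumG: "(\<Sum>l<n. G (x + (real l * s) *\<^sub>R axis i 1)) \<le> 2 * V" for x n
  proof -
    define \<xi> where "\<xi> = (\<chi> j. (2 * x $ j - a $ j - b $ j) / (b $ j - a $ j))"
    define U where "U r = (2 * r - a $ i - b $ i) / (b $ i - a $ i)" for r
    \<comment> \<open>The affine map from the larger interval onto the smaller one. Outside the
      larger interval both kernels vanish, and the identity only serves to keep \<open>y r\<close>
      near \<open>r\<close>.\<close>
    define y where "y r = (if r \<in> {a' $ i..b' $ i} then a $ i + (b $ i - a $ i) * (r - a' $ i) / (b' $ i - a' $ i) else r)" for r
    have y: "\<bar>y r - r\<bar> \<le> s" for r
    proof (cases "r \<in> {a' $ i..b' $ i}")
      case True
      define \<theta> where "\<theta> = (r - a' $ i) / (b' $ i - a' $ i)"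
      have \<theta>: "0 \<le> \<theta>" "\<theta> \<le> 1" using True ab'[of i] by (auto simp: \<theta>_def)
      have r: "r = a' $ i + (b' $ i - a' $ i) * \<theta>" using ab'[of i] by (simp add: \<theta>_def)
      have yr: "y r = a $ i + (b $ i - a $ i) * \<theta>" using True by (simp add: y_def \<theta>_def)
      have "y r - r = (1 - \<theta>) * (a $ i - a' $ i) - \<theta> * (b' $ i - b $ i)"
        unfolding yr by (subst r) (simp add: algebra_simps)
      moreover have "0 \<le> (1 - \<theta>) * (a $ i - a' $ i)" "(1 - \<theta>) * (a $ i - a' $ i) \<le> a $ i - a' $ i"
        "0 \<le> \<theta> * (b' $ i - b $ i)" "\<theta> * (b' $ i - b $ i) \<le> b' $ i - b $ i"
        using \<theta> le by (auto intro!: mult_nonneg_nonneg mult_left_le_one_le)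
      ultimately show ?thesis using le by linarith
    next
      case False
      then have "y r = r" by (auto simp: y_def)
      then show ?thesis using s by simp
    qed
    have G: "G (x + (real l * s) *\<^sub>R axis i 1) \<le> \<bar>\<psi> (upd \<xi> i (U (x $ i + real l * s))) - \<psi> (upd \<xi> i (U (y (x $ i + real l * s))))\<bar>" for l
    proof -
      define r where "r = x $ i + real l * s"
      define x' where "x' = x + (real l * s) *\<^sub>R axis i 1"
      have x': "x' $ j = (if j = i then r else x $ j)" for j
        by (auto simp: x'_def r_def axis_def)
      show ?thesis
      proof (cases "r \<in> {a' $ i..b' $ i}")
        case False
        then have "x' \<notin> cbox a' b'" using x'[of i] by (auto simp: mem_box_cart intro!: exI[of _ i])
        then show ?thesis using out by (simp add: x'_def)
      next
        case True
        have 1: "(\<chi> j. (2 * x' $ j - a $ j - b $ j) / (b $ j - a $ j)) = upd \<xi> i (U r)"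
          by (auto simp: vec_eq_iff x' \<xi>_def U_def)
        have "U (y r) = (2 * r - a' $ i - b' $ i) / (b' $ i - a' $ i)"
        proof -
          define \<theta> where "\<theta> = (r - a' $ i) / (b' $ i - a' $ i)"
          have "y r = a $ i + (b $ i - a $ i) * \<theta>" using True by (simp add: y_def \<theta>_def)
          then have "U (y r) = 2 * \<theta> - 1"
            using ab[of i] by (simp add: U_def field_simps)
          also have "\<dots> = 2 * (r - a' $ i) / (b' $ i - a' $ i) - 1"
            by (simp add: \<theta>_def)
          also have "\<dots> = (2 * r - a' $ i - b' $ i) / (b' $ i - a' $ i)"
            using ab'[of i] by (simp add: field_simps)
          finally show ?thesis .
        qed
        then have 2: "(\<chi> j. (2 * x' $ j - a' $ j - b' $ j) / (b' $ j - a' $ j)) = upd \<xi> i (U (y r))"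
          using other by (auto simp: vec_eq_iff x' \<xi>_def)
        show ?thesis
          unfolding G_def box_kernel_apply[OF ab] box_kernel_apply[OF ab'] x'_def[symmetric] 1 2 r_def[symmetric] ..
      qed
    qed
    have "(\<Sum>l<n. G (x + (real l * s) *\<^sub>R axis i 1)) \<le> (\<Sum>l<n. \<bar>\<psi> (upd \<xi> i (U (x $ i + real l * s))) - \<psi> (upd \<xi> i (U (y (x $ i + real l * s))))\<bar>)"
      by (intro sum_mono G)
    also have "\<dots> \<le> 2 * V"
    proof (rule variation_near_grid[of "\<lambda>r. \<psi> (upd \<xi> i (U r))", OF _ y])
      fix n and u :: "nat \<Rightarrow> real" assume u: "mono u"
      have "mono (\<lambda>l. U (u l))"
        using u ab[of i] unfolding mono_def U_def by (auto intro!: divide_right_mono)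
      then show "(\<Sum>l<n. \<bar>\<psi> (upd \<xi> i (U (u (Suc l)))) - \<psi> (upd \<xi> i (U (u l)))\<bar>) \<le> V"
        using V unfolding line_variation_le_def by blast
    qed
    finally show ?thesis .
  qed
  \<comment> \<open>Boundedness turns the square into an absolute difference, to which the variation
    bound applies.\<close>
  have sq: "(box_kernel \<psi> a b x - box_kernel \<psi> a' b' x)\<^sup>2 \<le> 2 * B * G x" for x
  proof -
    have "G x \<le> 2 * B"
      using B[of "\<chi> i. (2 * x $ i - a $ i - b $ i) / (b $ i - a $ i)"] B[of "\<chi> i. (2 * x $ i - a' $ i - b' $ i) / (b' $ i - a' $ i)"]
      unfolding G_def box_kernel_apply[OF ab] box_kernel_apply[OF ab'] by linarith
    then have "G x * G x \<le> 2 * B * G x" by (intro mult_right_mono) (auto simp: G_def)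
    then show ?thesis by (simp add: G_def power2_eq_square)
  qed
  have "(\<integral>\<^sup>+x. ennreal ((box_kernel \<psi> a b x - box_kernel \<psi> a' b' x)\<^sup>2) \<partial>lebesgue)
    \<le> ennreal (4 * B * V) * ennreal (s * (\<Prod>j\<in>UNIV - {i}. b' $ j - a' $ j))"
  proof (rule nn_integral_slabs)
    show "(\<lambda>x. ennreal ((box_kernel \<psi> a b x - box_kernel \<psi> a' b' x)\<^sup>2)) \<in> borel_measurable lebesgue"
      using box_kernel_measurable[OF meas ab] box_kernel_measurable[OF meas ab'] by measurable
    show "ennreal ((box_kernel \<psi> a b x - box_kernel \<psi> a' b' x)\<^sup>2) = 0" if "x \<notin> cbox a' b'" for x
      using out[OF that] by (simp add: G_def)
    fix x :: "real ^ 'd" and n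
    have "(\<Sum>l<n. (box_kernel \<psi> a b (x + (real l * s) *\<^sub>R axis i 1) - box_kernel \<psi> a' b' (x + (real l * s) *\<^sub>R axis i 1))\<^sup>2)
      \<le> (\<Sum>l<n. 2 * B * G (x + (real l * s) *\<^sub>R axis i 1))"
      by (intro sum_mono sq)
    also have "\<dots> \<le> 2 * B * (2 * V)"
      unfolding sum_distrib_left[symmetric] using B0 by (intro mult_left_mono sumG) auto
    finally show "(\<Sum>l<n. ennreal ((box_kernel \<psi> a b (x + (real l * s) *\<^sub>R axis i 1) - box_kernel \<psi> a' b' (x + (real l * s) *\<^sub>R axis i 1))\<^sup>2)) \<le> ennreal (4 * B * V)"
      by (simp add: ennreal_leI)
  qed (use ab' s in auto)
  also have "(\<Prod>j\<in>UNIV - {i}. b' $ j - a' $ j) = (\<Prod>j\<in>UNIV - {i}. b $ j - a $ j)"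
    using other by (intro prod.cong) auto
  finally show ?thesis .
qed

text \<open>The corners are moved one coordinate at a time through the hybrids \<open>h S\<close>.
  Each move uses that the square of a sum is at most twice the sum of the squares, which leads to
  the crude factor \<open>4 ^ CARD('d)\<close>. The number \<open>Q\<close> dominates the slab
  volumes in all directions.\<close>

lemma box_kernel_dist:
  fixes \<psi> :: "real ^ 'd::finite \<Rightarrow> real"
  assumes meas: "\<psi> \<in> borel_measurable lebesgue" and V: "line_variation_le \<psi> V"
    and B: "\<And>x. \<bar>\<psi> x\<bar> \<le> B" and zero: "\<And>x. x \<notin> cbox (-1) 1 \<Longrightarrow> \<psi> x = 0"
    and ab: "\<And>j. a $ j < b $ j" and s: "\<And>j. 0 < s j"
    and le: "\<And>j. a' $ j \<le> a $ j" "\<And>j. b $ j \<le> b' $ j"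
      "\<And>j. a $ j - a' $ j \<le> s j" "\<And>j. b' $ j - b $ j \<le> s j"
    and Q: "\<And>i. s i * (\<Prod>j\<in>UNIV - {i}. b' $ j - a' $ j) \<le> Q"
  shows "(\<integral>\<^sup>+x. ennreal ((box_kernel \<psi> a b x - box_kernel \<psi> a' b' x)\<^sup>2) \<partial>lebesgue)
    \<le> ennreal (4 ^ CARD('d) * (4 * B * V * Q))"
proof -
  define h where "h S v v' = (\<chi> j. if j \<in> S then v' $ j else v $ j)" for S and v v' :: "real ^ 'd"
  have B0: "0 \<le> B" using B[of 0] by (meson abs_ge_zero order_trans)
  have V0: "0 \<le> V" using V[unfolded line_variation_le_def, rule_format, of "\<lambda>_. 0" 0] by (simp add: mono_def)
  have hab: "h S a a' $ j < h S b b' $ j" for S j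
    using ab[of j] le(1)[of j] le(2)[of j] by (auto simp: h_def)
  have Q0: "0 \<le> Q"
  proof (rule order_trans[OF mult_nonneg_nonneg Q])
    show "0 \<le> s undefined" using s by (simp add: less_imp_le)
    have "a' $ j \<le> b' $ j" for j using ab[of j] le(1)[of j] le(2)[of j] by linarith
    then show "0 \<le> (\<Prod>j\<in>UNIV - {undefined}. b' $ j - a' $ j)" by (intro prod_nonneg) simp
  qed
  define K where "K S = box_kernel \<psi> (h S a a') (h S b b')" for S
  have [measurable]: "K S \<in> borel_measurable lebesgue" for S
    unfolding K_def by (intro box_kernel_measurable meas hab)
  define q where "q = 4 * B * V * Q"
  have q0: "0 \<le> q" using B0 V0 Q0 by (simp add: q_def)
  have step: "(\<integral>\<^sup>+x. ennreal ((K S x - K (insert i S) x)\<^sup>2) \<partial>lebesgue) \<le> ennreal q" if i: "i \<notin> S" for i S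
  proof -
    have "(\<integral>\<^sup>+x. ennreal ((K S x - K (insert i S) x)\<^sup>2) \<partial>lebesgue)
      \<le> ennreal (4 * B * V) * ennreal (s i * (\<Prod>j\<in>UNIV - {i}. h S b b' $ j - h S a a' $ j))"
      unfolding K_def
      by (rule box_kernel_dist_one_coordinate[OF meas V B zero hab s]) (use i le in \<open>auto simp: h_def\<close>)
    also have "\<dots> \<le> ennreal (4 * B * V) * ennreal Q"
    proof (intro mult_left_mono ennreal_leI order_trans[OF _ Q[of i]])
      show "(\<Prod>j\<in>UNIV - {i}. h S b b' $ j - h S a a' $ j) \<le> (\<Prod>j\<in>UNIV - {i}. b' $ j - a' $ j)"
        using hab le by (intro prod_mono) (auto simp: h_def less_imp_le intro!: diff_mono)
    qed (use s in \<open>auto simp: less_imp_le\<close>)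
    finally show ?thesis
      using B0 V0 Q0 by (simp add: q_def ennreal_mult)
  qed
  have "(\<integral>\<^sup>+x. ennreal ((K {} x - K S x)\<^sup>2) \<partial>lebesgue) \<le> ennreal (4 ^ card S * q)" for S
  proof (induction S rule: finite_induct[OF finite])
    case 1
    show ?case by simp
  next
    case (2 i S)
    have "(\<integral>\<^sup>+x. ennreal ((K {} x - K (insert i S) x)\<^sup>2) \<partial>lebesgue)
      \<le> (\<integral>\<^sup>+x. 2 * ennreal ((K {} x - K S x)\<^sup>2) + 2 * ennreal ((K S x - K (insert i S) x)\<^sup>2) \<partial>lebesgue)"
    proof (intro nn_integral_mono)
      fix x
      have "0 \<le> ((K {} x - K S x) - (K S x - K (insert i S) x))\<^sup>2" by simp
      then have "(K {} x - K (insert i S) x)\<^sup>2 \<le> 2 * (K {} x - K S x)\<^sup>2 + 2 * (K S x - K (insert i S) x)\<^sup>2"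
        by (simp add: power2_eq_square algebra_simps)
      then have "ennreal ((K {} x - K (insert i S) x)\<^sup>2) \<le> ennreal (2 * (K {} x - K S x)\<^sup>2 + 2 * (K S x - K (insert i S) x)\<^sup>2)"
        by (rule ennreal_leI)
      then show "ennreal ((K {} x - K (insert i S) x)\<^sup>2) \<le> 2 * ennreal ((K {} x - K S x)\<^sup>2) + 2 * ennreal ((K S x - K (insert i S) x)\<^sup>2)"
        by (simp add: ennreal_mult)
    qed
    also have "\<dots> = 2 * (\<integral>\<^sup>+x. ennreal ((K {} x - K S x)\<^sup>2) \<partial>lebesgue) + 2 * (\<integral>\<^sup>+x. ennreal ((K S x - K (insert i S) x)\<^sup>2) \<partial>lebesgue)"
      by (subst nn_integral_add) (auto simp: nn_integral_cmult)
    also have "\<dots> \<le> 2 * ennreal (4 ^ card S * q) + 2 * ennreal q"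
      using 2 step[of i S] by (intro add_mono mult_left_mono) auto
    also have "\<dots> = ennreal (2 * (4 ^ card S * q) + 2 * q)"
      using q0 by (simp add: ennreal_mult)
    also have "\<dots> \<le> ennreal (4 ^ card (insert i S) * q)"
    proof (rule ennreal_leI)
      have "1 * q \<le> 4 ^ card S * q" using q0 by (intro mult_right_mono) auto
      then show "2 * (4 ^ card S * q) + 2 * q \<le> 4 ^ card (insert i S) * q" using 2 by (simp add: mult_ac)
    qed
    finally show ?case .
  qed
  from this[of UNIV] show ?thesis
    by (simp add: K_def h_def q_def)
qed

section \<open>Increments on dyadic grids\<close>

text \<open>By Borel-Cantelli only finitely many levels violate the threshold \<open>u\<close>, and
  each level is finite. A random multiple of the positive weight \<open>w\<close> repairs those, so
  the tail estimate is required only from some level \<open>N\<close> on.\<close>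

lemma (in prob_space) finite_families_AE_bounded:
  fixes I :: "nat \<Rightarrow> 'i set" and Y :: "'i \<Rightarrow> 'a \<Rightarrow> real" and u w :: "nat \<Rightarrow> 'i \<Rightarrow> real"
  assumes fin: "\<And>n. finite (I n)" and meas: "\<And>n i. i \<in> I n \<Longrightarrow> Y i \<in> borel_measurable M"
    and tail: "\<And>n i. N \<le> n \<Longrightarrow> i \<in> I n \<Longrightarrow> prob {\<omega> \<in> space M. u n i \<le> \<bar>Y i \<omega>\<bar>} \<le> p n"
    and sum: "summable (\<lambda>n. real (card (I n)) * p n)" and w: "\<And>n i. 0 < w n i"
  shows "AE \<omega> in M. \<exists>B\<ge>0. \<forall>n. \<forall>i\<in>I n. \<bar>Y i \<omega>\<bar> \<le> u n i + B * w n i"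
proof -
  define E where "E n i = {\<omega> \<in> space M. u n i \<le> \<bar>Y i \<omega>\<bar>}" for n i
  have E: "E n i \<in> sets M" if "i \<in> I n" for n i
    unfolding E_def using meas[OF that] by measurable
  define A where "A n = (if N \<le> n then \<Union>i\<in>I n. E n i else {})" for n
  have A: "A n \<in> sets M" for n
    unfolding A_def using fin E by (auto intro!: sets.finite_UN)
  have "summable (\<lambda>n. prob (A n))"
  proof (rule summable_comparison_test'[OF sum, of N])
    fix n assume n: "N \<le> n"
    have "prob (A n) \<le> (\<Sum>i\<in>I n. prob (E n i))"
      unfolding A_def using n fin E by (simp, intro finite_measure_subadditive_finite) auto
    also have "\<dots> \<le> (\<Sum>i\<in>I n. p n)"
      unfolding E_def using n tail by (intro sum_mono) auto
    finally show "norm (prob (A n)) \<le> real (card (I n)) * p n" by simp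
  qed
  then have "AE \<omega> in M. eventually (\<lambda>n. \<omega> \<in> space M - A n) sequentially"
    using A by (intro borel_cantelli_AE1) (auto simp: less_top[symmetric])
  then show ?thesis
  proof (rule AE_mp, intro AE_I2 impI)
    fix \<omega> assume "eventually (\<lambda>n. \<omega> \<in> space M - A n) sequentially"
    then obtain n0 where n0: "\<And>n. n0 \<le> n \<Longrightarrow> \<omega> \<in> space M - A n"
      by (auto simp: eventually_sequentially)
    define R where "R n i = \<bar>(\<bar>Y i \<omega>\<bar> - u n i) / w n i\<bar>" for n i
    \<comment> \<open>Collects the relative excess of all levels before \<open>N\<close> and before
      the random index from which Borel-Cantelli is effective.\<close>
    define B where "B = (\<Sum>n<max N n0. \<Sum>i\<in>I n. R n i)"
    have B0: "0 \<le> B" by (auto simp: B_def R_def intro!: sum_nonneg)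
    have "\<bar>Y i \<omega>\<bar> \<le> u n i + B * w n i" if i: "i \<in> I n" for n i
    proof (cases "n < max N n0")
      case False
      then have "\<omega> \<in> space M - A n" "N \<le> n" using n0 by auto
      then have "\<bar>Y i \<omega>\<bar> < u n i" using i by (auto simp: A_def E_def not_le)
      moreover have "0 \<le> B * w n i" using B0 w by (simp add: less_imp_le)
      ultimately show ?thesis by linarith
    next
      case True
      have "R n i \<le> (\<Sum>i\<in>I n. R n i)"
        using fin i by (intro member_le_sum) (auto simp: R_def)
      also have "\<dots> \<le> B"
        unfolding B_def using True by (intro member_le_sum) (auto simp: R_def intro!: sum_nonneg)
      finally have "(\<bar>Y i \<omega>\<bar> - u n i) / w n i \<le> B" unfolding R_def by (rule order_trans[OF abs_ge_self])
      then show ?thesis using w[of n i] by (simp add: field_simps)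
    qed
    with B0 show "\<exists>B\<ge>0. \<forall>n. \<forall>i\<in>I n. \<bar>Y i \<omega>\<bar> \<le> u n i + B * w n i" by blast
  qed
qed

section \<open>Counting boxes on dyadic grids\<close>

lemma
  fixes A :: "'d::finite \<Rightarrow> ('b \<times> 'b) set"
  assumes A: "\<And>i. finite (A i)"
  shows finite_coordinatewise_pairs: "finite {(a, b :: 'b ^ 'd). \<forall>i. (a $ i, b $ i) \<in> A i}"
    and card_coordinatewise_pairs: "card {(a, b :: 'b ^ 'd). \<forall>i. (a $ i, b $ i) \<in> A i} \<le> (\<Prod>i\<in>UNIV. card (A i))"
proof -
  define v where "v F = ((\<chi> i. fst (F i)), (\<chi> i. snd (F i)))" for F :: "'d \<Rightarrow> 'b \<times> 'b"
  have fin: "finite (PiE UNIV A)" using A by (intro finite_PiE) auto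
  have sub: "{(a, b :: 'b ^ 'd). \<forall>i. (a $ i, b $ i) \<in> A i} \<subseteq> v ` PiE UNIV A"
  proof clarify
    fix a b :: "'b ^ 'd" assume "\<forall>i. (a $ i, b $ i) \<in> A i"
    then have "(\<lambda>i. (a $ i, b $ i)) \<in> PiE UNIV A" by auto
    then have "v (\<lambda>i. (a $ i, b $ i)) \<in> v ` PiE UNIV A" by (rule imageI)
    then show "(a, b) \<in> v ` PiE UNIV A" by (simp add: v_def)
  qed
  then show "finite {(a, b :: 'b ^ 'd). \<forall>i. (a $ i, b $ i) \<in> A i}"
    using fin by (meson finite_imageI finite_subset)
  have "card {(a, b :: 'b ^ 'd). \<forall>i. (a $ i, b $ i) \<in> A i} \<le> card (PiE UNIV A)"
    using sub fin by (meson surj_card_le)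
  then show "card {(a, b :: 'b ^ 'd). \<forall>i. (a $ i, b $ i) \<in> A i} \<le> (\<Prod>i\<in>UNIV. card (A i))"
    by (simp add: card_PiE)
qed

definition unit_boxes :: "((real ^ 'd::finite) \<times> (real ^ 'd)) set" where
  "unit_boxes = {(a, b). \<forall>i. 0 \<le> a $ i \<and> a $ i < b $ i \<and> b $ i \<le> 1}"

definition dyadic_unit :: "nat \<Rightarrow> real set" where
  "dyadic_unit n = (\<lambda>j. real j / 2 ^ n) ` {..2 ^ n}"

definition dyadic_boxes :: "nat \<Rightarrow> ((real ^ 'd::finite) \<times> (real ^ 'd)) set" where
  "dyadic_boxes n = {(a, b) \<in> unit_boxes. \<forall>i. a $ i \<in> dyadic_unit n \<and> b $ i \<in> dyadic_unit n}"

lemma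
  shows finite_dyadic_boxes: "finite (dyadic_boxes n :: ((real ^ 'd::finite) \<times> (real ^ 'd)) set)"
    and card_dyadic_boxes: "card (dyadic_boxes n :: ((real ^ 'd::finite) \<times> (real ^ 'd)) set) \<le> 2 ^ (2 * (n + 1) * CARD('d))"
proof -
  have fin: "finite (dyadic_unit n)" by (simp add: dyadic_unit_def)
  have "card (dyadic_unit n) \<le> 2 ^ n + 1"
    unfolding dyadic_unit_def by (rule order_trans[OF card_image_le]) auto
  also have "\<dots> \<le> 2 ^ (n + 1)" by simp
  finally have c: "card (dyadic_unit n) \<le> 2 ^ (n + 1)" .
  define P where "P = {(a, b :: real ^ 'd). \<forall>i. (a $ i, b $ i) \<in> (\<lambda>_. dyadic_unit n \<times> dyadic_unit n) i}"
  have sub: "dyadic_boxes n \<subseteq> P" by (auto simp: dyadic_boxes_def P_def)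
  have P: "finite P" unfolding P_def by (rule finite_coordinatewise_pairs) (simp add: fin)
  then show "finite (dyadic_boxes n :: ((real ^ 'd) \<times> (real ^ 'd)) set)" using sub finite_subset by blast
  have "card (dyadic_boxes n :: ((real ^ 'd) \<times> (real ^ 'd)) set) \<le> card P" using sub P by (rule card_mono[rotated])
  also have "\<dots> \<le> (\<Prod>i\<in>(UNIV :: 'd set). card (dyadic_unit n \<times> dyadic_unit n))"
    unfolding P_def by (rule card_coordinatewise_pairs) (simp add: fin)
  also have "\<dots> = (card (dyadic_unit n) * card (dyadic_unit n)) ^ CARD('d)"
    by (simp add: card_cartesian_product)
  also have "\<dots> \<le> (2 ^ (n + 1) * 2 ^ (n + 1)) ^ CARD('d)"
    by (intro power_mono mult_mono c) auto
  also have "\<dots> = 2 ^ (2 * (n + 1) * CARD('d))"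
    by (simp only: power_mult mult_2 power_add)
  finally show "card (dyadic_boxes n :: ((real ^ 'd) \<times> (real ^ 'd)) set) \<le> 2 ^ (2 * (n + 1) * CARD('d))" .
qed

text \<open>A threshold of \<open>n + 1\<close> standard deviations makes the Gaussian tail beat any
  fixed power of \<open>2 ^ (n + 1)\<close>. This is why crude counts suffice for the increments, at
  the price of a factor \<open>n + 1\<close> in their size.\<close>

lemma summable_power_times_gaussian: "summable (\<lambda>n. 2 ^ (c * (n + 1)) * (2 * exp (- (real n + 1)\<^sup>2 / 2)))"
\<comment> \<open>From this index on \<open>(n + 1)^2 / 2\<close> is at least
  \<open>(c + 1) * (n + 1)\<close>. As \<open>exp 1\<close> is at least 2, one factor
  \<open>2 ^ (n + 1)\<close> is left to spare.\<close>
proof (rule summable_comparison_test'[of "\<lambda>n. (1/2) ^ n" "2 * (c + 1)"])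
  show "summable (\<lambda>n. (1 / 2 :: real) ^ n)" by (intro summable_geometric) simp
  fix n assume n: "2 * (c + 1) \<le> n"
  have "real (2 * (c + 1)) \<le> real n" using n by (simp only: of_nat_le_iff)
  then have "(real n + 1) * (2 * (real c + 1)) \<le> (real n + 1) * (real n + 1)"
    by (intro mult_left_mono) auto
  moreover have "(real n + 1) * (2 * (real c + 1)) = 2 * real ((c + 1) * (n + 1))" by (simp add: algebra_simps)
  ultimately have "- (real n + 1)\<^sup>2 / 2 \<le> - real ((c + 1) * (n + 1))"
    unfolding power2_eq_square by linarith
  then have "exp (- (real n + 1)\<^sup>2 / 2) \<le> exp (- real ((c + 1) * (n + 1)))"
    by (simp only: exp_le_cancel_iff)
  also have "\<dots> = (1 / exp 1) ^ ((c + 1) * (n + 1))"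
    by (metis exp_minus exp_of_nat_mult inverse_eq_divide mult.right_neutral mult_minus_right)
  also have "\<dots> \<le> (1 / 2) ^ ((c + 1) * (n + 1))"
    using exp_ge_add_one_self[of 1] by (intro power_mono) (auto simp: field_simps)
  finally have "2 ^ (c * (n + 1)) * (2 * exp (- (real n + 1)\<^sup>2 / 2)) \<le> 2 ^ (c * (n + 1)) * (2 * (1 / 2) ^ ((c + 1) * (n + 1)))"
    by simp
  also have "\<dots> = (1/2) ^ n"
    by (simp add: power_add power_one_over field_simps)
  finally show "norm (2 ^ (c * (n + 1)) * (2 * exp (- (real n + 1)\<^sup>2 / 2))) \<le> (1/2) ^ n" by simp
qed

section \<open>Tail bounds and the dyadic modulus for a fixed kernel\<close>

locale kernel_integrals = prob_space M
  for M :: "'w measure" +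
  fixes W :: "real ^ 'd::finite \<Rightarrow> 'w \<Rightarrow> real" and \<psi> :: "real ^ 'd \<Rightarrow> real"
    and Z :: "real ^ 'd \<Rightarrow> real ^ 'd \<Rightarrow> 'w \<Rightarrow> real"
  assumes sheet: "brownian_sheet M W" and kernel: "is_kernel \<psi>"
    and integrals: "continuous_kernel_integrals M W \<psi> Z"
begin

definition X :: "real ^ 'd \<Rightarrow> real ^ 'd \<Rightarrow> 'w \<Rightarrow> real" where
  "X a b = Z ((1/2) *\<^sub>R (a + b)) ((1/2) *\<^sub>R (b - a))"

lemma kernel_measurable [measurable]: "\<psi> \<in> borel_measurable lebesgue"
  using kernel by (simp add: is_kernel_def)

lemma kernel_zero: "x \<notin> cbox (-1) 1 \<Longrightarrow> \<psi> x = 0"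
  using kernel by (simp add: is_kernel_def)

text \<open>A kernel of norm 0 would vanish almost everywhere, against its positive integral. The
  normalisation in \<open>Psi_hat\<close> is thus a genuine division.\<close>

lemma L2norm_pos: "0 < L2norm \<psi>"
proof -
  have "(LINT x|lebesgue. (\<psi> x)\<^sup>2) \<noteq> 0"
  proof
    assume "(LINT x|lebesgue. (\<psi> x)\<^sup>2) = 0"
    then have "AE x in lebesgue. (\<psi> x)\<^sup>2 = 0"
      using kernel by (subst (asm) integral_nonneg_eq_0_iff_AE) (auto simp: is_kernel_def)
    then have "AE x in lebesgue. \<psi> x = 0" by simp
    then have "(LINT x|lebesgue. \<psi> x) = 0" by (rule integral_eq_zero_AE)
    then show False using kernel by (simp add: is_kernel_def)
  qed
  moreover have "0 \<le> (LINT x|lebesgue. (\<psi> x)\<^sup>2)" by simp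
  ultimately show ?thesis unfolding L2norm_def by (simp add: less_le)
qed

lemma unit_box_param:
  assumes "(a, b) \<in> unit_boxes"
  shows "(1/2) *\<^sub>R (b - a) \<in> scales" "(1/2) *\<^sub>R (a + b) \<in> centers ((1/2) *\<^sub>R (b - a))"
proof -
  have *: "0 \<le> a $ i" "a $ i < b $ i" "b $ i \<le> 1" for i
    using assms by (auto simp: unit_boxes_def)
  show "(1/2) *\<^sub>R (b - a) \<in> scales"
    unfolding scales_def
  proof (clarify)
    fix i show "0 < ((1/2) *\<^sub>R (b - a)) $ i \<and> ((1/2) *\<^sub>R (b - a)) $ i \<le> 1 / 2"
      using *[of i] by simp
  qed
  show "(1/2) *\<^sub>R (a + b) \<in> centers ((1/2) *\<^sub>R (b - a))"
    unfolding centers_def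
  proof (clarify)
    fix i show "((1/2) *\<^sub>R (b - a)) $ i \<le> ((1/2) *\<^sub>R (a + b)) $ i \<and> ((1/2) *\<^sub>R (a + b)) $ i \<le> 1 - ((1/2) *\<^sub>R (b - a)) $ i"
      using *[of i] by (simp add: field_simps)
  qed
qed

lemma X_wiener: "(a, b) \<in> unit_boxes \<Longrightarrow> has_wiener_integral M W (box_kernel \<psi> a b) (X a b)"
  using integrals unit_box_param[of a b] by (auto simp: continuous_kernel_integrals_def X_def box_kernel_def)

lemma X_measurable: "(a, b) \<in> unit_boxes \<Longrightarrow> X a b \<in> borel_measurable M"
  using X_wiener by (auto simp: has_wiener_integral_def)

text \<open>Hides the sup norm and the line variation of the kernel in one constant that is uniform
  over all boxes.\<close>

lemma box_kernel_dist_bound: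
  "\<exists>C>0. \<forall>a b a' b' Q. \<forall>s :: 'd \<Rightarrow> real.
     (\<forall>j. a $ j < b $ j \<and> 0 < s j \<and> a' $ j \<le> a $ j \<and> b $ j \<le> b' $ j \<and> a $ j - a' $ j \<le> s j \<and> b' $ j - b $ j \<le> s j
        \<and> s j * (\<Prod>k\<in>UNIV - {j}. b' $ k - a' $ k) \<le> Q) \<longrightarrow>
     (\<integral>\<^sup>+x. ennreal ((box_kernel \<psi> a b x - box_kernel \<psi> a' b' x)\<^sup>2) \<partial>lebesgue) \<le> ennreal (C * Q)"
proof -
  define V where "V = enn2real (HK_variation \<psi>)"
  define B where "B = \<bar>\<psi> 1\<bar> + CARD('d) * V"
  have fin: "HK_variation \<psi> < \<infinity>" using kernel by (simp add: is_kernel_def)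
  have V0: "0 \<le> V" by (simp add: V_def)
  have B0: "0 \<le> B" using V0 by (simp add: B_def)
  have B: "\<bar>\<psi> x\<bar> \<le> B" for x
  proof (cases "x \<in> cbox (-1) 1")
    case True
    then show ?thesis using bounded_variation_bounded[OF fin] by (simp add: B_def V_def)
  qed (use kernel_zero B0 in auto)
  have lv: "line_variation_le \<psi> (V + 2 * B)"
    unfolding V_def by (rule line_variation_le_zero_extension[OF fin kernel_zero B])
  define C where "C = 4 ^ CARD('d) * (4 * B * (V + 2 * B)) + 1"
  have C: "0 < C" using V0 B0 unfolding C_def by (intro add_nonneg_pos mult_nonneg_nonneg) auto
  show ?thesis
  proof (intro exI[of _ C] conjI allI impI C)
    fix a b a' b' :: "real ^ 'd" and Q and s :: "'d \<Rightarrow> real"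
    assume *: "\<forall>j. a $ j < b $ j \<and> 0 < s j \<and> a' $ j \<le> a $ j \<and> b $ j \<le> b' $ j \<and> a $ j - a' $ j \<le> s j \<and> b' $ j - b $ j \<le> s j
        \<and> s j * (\<Prod>k\<in>UNIV - {j}. b' $ k - a' $ k) \<le> Q"
    have Q0: "0 \<le> Q"
    proof (rule order_trans[OF mult_nonneg_nonneg])
      show "s undefined * (\<Prod>k\<in>UNIV - {undefined}. b' $ k - a' $ k) \<le> Q" using * by blast
      show "0 \<le> s undefined" using * by (simp add: less_imp_le)
      have "a' $ j \<le> b' $ j" for j using *[rule_format, of j] by linarith
      then show "0 \<le> (\<Prod>k\<in>UNIV - {undefined}. b' $ k - a' $ k)" by (intro prod_nonneg) simp
    qed
    have "(\<integral>\<^sup>+x. ennreal ((box_kernel \<psi> a b x - box_kernel \<psi> a' b' x)\<^sup>2) \<partial>lebesgue)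
      \<le> ennreal (4 ^ CARD('d) * (4 * B * (V + 2 * B) * Q))"
      using * by (intro box_kernel_dist[OF kernel_measurable lv B kernel_zero, where s = s]) blast+
    also have "\<dots> \<le> ennreal (C * Q)"
      using Q0 by (intro ennreal_leI) (simp add: C_def algebra_simps)
    finally show "(\<integral>\<^sup>+x. ennreal ((box_kernel \<psi> a b x - box_kernel \<psi> a' b' x)\<^sup>2) \<partial>lebesgue) \<le> ennreal (C * Q)" .
  qed
qed

lemma box_kernel_norm:
  assumes "(a, b) \<in> unit_boxes"
  shows "(\<integral>\<^sup>+x\<in>cbox 0 1. ennreal ((box_kernel \<psi> a b x)\<^sup>2) \<partial>lebesgue)
    \<le> ennreal ((\<Prod>i\<in>UNIV. (b $ i - a $ i) / 2) * (L2norm \<psi>)\<^sup>2)"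
proof -
  define h where "h = (1/2) *\<^sub>R (b - a)"
  have h: "0 < h $ i" for i using assms by (simp add: h_def unit_boxes_def)
  have "(\<integral>\<^sup>+x\<in>cbox 0 1. ennreal ((box_kernel \<psi> a b x)\<^sup>2) \<partial>lebesgue) \<le> (\<integral>\<^sup>+x. ennreal ((box_kernel \<psi> a b x)\<^sup>2) \<partial>lebesgue)"
    by (intro nn_integral_mono) (simp add: indicator_def)
  also have "\<dots> = ennreal (\<Prod>i\<in>UNIV. \<bar>h $ i\<bar>) * (\<integral>\<^sup>+x. ennreal ((\<psi> x)\<^sup>2) \<partial>lebesgue)"
    unfolding box_kernel_def h_def[symmetric] rescaled_def
    using h by (intro nn_integral_coordinatewise_affine[where f = "\<lambda>x. ennreal ((\<psi> x)\<^sup>2)"]) (auto simp: less_imp_neq[symmetric])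
  also have "(\<integral>\<^sup>+x. ennreal ((\<psi> x)\<^sup>2) \<partial>lebesgue) = ennreal ((L2norm \<psi>)\<^sup>2)"
    using kernel by (subst nn_integral_eq_integral) (auto simp: is_kernel_def L2norm_def)
  also have "(\<Prod>i\<in>UNIV. \<bar>h $ i\<bar>) = (\<Prod>i\<in>UNIV. (b $ i - a $ i) / 2)"
    using h by (intro prod.cong) (auto simp: h_def abs_of_pos)
  finally show ?thesis
    using h by (simp add: ennreal_mult h_def prod_nonneg less_imp_le)
qed

lemma X_tail:
  assumes ab: "(a, b) \<in> unit_boxes" and u: "0 < u"
  shows "prob {\<omega> \<in> space M. u \<le> \<bar>X a b \<omega> / (sqrt (\<Prod>i\<in>UNIV. (b $ i - a $ i) / 2) * L2norm \<psi>)\<bar>} \<le> 2 * exp (- u\<^sup>2 / 2)"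
proof -
  define v where "v = (\<Prod>i\<in>UNIV. (b $ i - a $ i) / 2) * (L2norm \<psi>)\<^sup>2"
  have p: "0 < (\<Prod>i\<in>UNIV. (b $ i - a $ i) / 2)" using ab by (intro prod_pos) (simp add: unit_boxes_def)
  then have v: "0 < v" using L2norm_pos by (simp add: v_def)
  have sv: "sqrt (\<Prod>i\<in>UNIV. (b $ i - a $ i) / 2) * L2norm \<psi> = sqrt v"
    using L2norm_pos by (simp add: v_def real_sqrt_mult)
  have "u \<le> \<bar>x / sqrt v\<bar> \<longleftrightarrow> sqrt v * u \<le> \<bar>x\<bar>" for x
    using v by (simp add: abs_divide field_simps)
  then have "prob {\<omega> \<in> space M. u \<le> \<bar>X a b \<omega> / sqrt v\<bar>} = prob {\<omega> \<in> space M. sqrt v * u \<le> \<bar>X a b \<omega>\<bar>}"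
    by simp
  also have "\<dots> \<le> 2 * exp (- (sqrt v * u)\<^sup>2 / (2 * v))"
    using v u box_kernel_norm[OF ab] by (intro wiener_integral_tail[OF sheet X_wiener[OF ab]]) (auto simp: v_def)
  also have "(sqrt v * u)\<^sup>2 / (2 * v) = u\<^sup>2 / 2" using v by (simp add: power_mult_distrib)
  then have "- (sqrt v * u)\<^sup>2 / (2 * v) = - u\<^sup>2 / 2" by simp
  finally show ?thesis unfolding sv .
qed

lemma X_diff_tail:
  assumes "(a, b) \<in> unit_boxes" "(a', b') \<in> unit_boxes"
    and le: "(\<integral>\<^sup>+x. ennreal ((box_kernel \<psi> a b x - box_kernel \<psi> a' b' x)\<^sup>2) \<partial>lebesgue) \<le> ennreal v"
    and v: "0 < v" and u: "0 < u"
  shows "prob {\<omega> \<in> space M. sqrt v * u \<le> \<bar>X a b \<omega> - X a' b' \<omega>\<bar>} \<le> 2 * exp (- u\<^sup>2 / 2)"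
proof -
  have "(\<integral>\<^sup>+x\<in>cbox 0 1. ennreal ((box_kernel \<psi> a b x - box_kernel \<psi> a' b' x)\<^sup>2) \<partial>lebesgue)
    \<le> (\<integral>\<^sup>+x. ennreal ((box_kernel \<psi> a b x - box_kernel \<psi> a' b' x)\<^sup>2) \<partial>lebesgue)"
    by (intro nn_integral_mono) (simp add: indicator_def)
  then have "prob {\<omega> \<in> space M. sqrt v * u \<le> \<bar>X a b \<omega> - X a' b' \<omega>\<bar>} \<le> 2 * exp (- (sqrt v * u)\<^sup>2 / (2 * v))"
    using v u le order_trans
    by (intro wiener_integral_tail[OF sheet has_wiener_integral_diff[OF sheet X_wiener[OF assms(1)] X_wiener[OF assms(2)]]]) auto
  moreover have "- (sqrt v * u)\<^sup>2 / (2 * v) = - u\<^sup>2 / 2" using v by (simp add: power_mult_distrib)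
  ultimately show ?thesis by (simp only:)
qed

text \<open>Only the \<open>L\<^sub>2\<close> distance enters, not the position of the boxes: the
  union bound runs over all pairs at level \<open>n\<close>, of which there are at most
  \<open>2 ^ (4 * CARD('d) * (n + 1))\<close>. The standard deviation times \<open>n + 1\<close>
  serves both as threshold and as weight.\<close>

lemma AE_dyadic_modulus:
  assumes c: "0 < c"
  shows "AE \<omega> in M. \<exists>B\<ge>0. \<forall>n a b a' b'. (a, b) \<in> dyadic_boxes n \<longrightarrow> (a', b') \<in> dyadic_boxes n \<longrightarrow>
     (\<integral>\<^sup>+x. ennreal ((box_kernel \<psi> a b x - box_kernel \<psi> a' b' x)\<^sup>2) \<partial>lebesgue) \<le> ennreal (c * (1/2) ^ n) \<longrightarrow>
     \<bar>X a b \<omega> - X a' b' \<omega>\<bar> \<le> B * sqrt ((1/2) ^ n) * (real n + 1)"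
proof -
  define I where "I n = {((a, b), (a', b')). (a, b) \<in> dyadic_boxes n \<and> (a', b') \<in> dyadic_boxes n \<and>
     (\<integral>\<^sup>+x. ennreal ((box_kernel \<psi> a b x - box_kernel \<psi> a' b' x)\<^sup>2) \<partial>lebesgue) \<le> ennreal (c * (1/2) ^ n)}" for n
  define Y where "Y = (\<lambda>((a, b), (a', b')) \<omega>. X a b \<omega> - X a' b' \<omega>)"
  define u where "u n = sqrt (c * (1/2) ^ n) * (real n + 1)" for n
  have u: "0 < u n" for n using c by (simp add: u_def add_nonneg_pos)
  have sub: "I n \<subseteq> dyadic_boxes n \<times> dyadic_boxes n" for n by (auto simp: I_def)
  have ub: "(a, b) \<in> unit_boxes" if "(a, b) \<in> dyadic_boxes n" for a b :: "real ^ 'd" and n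
    using that by (simp add: dyadic_boxes_def)
  have "AE \<omega> in M. \<exists>B\<ge>0. \<forall>n. \<forall>i\<in>I n. \<bar>Y i \<omega>\<bar> \<le> u n + B * u n"
  proof (rule finite_families_AE_bounded[where N = 0])
    show "finite (I n)" for n
      using sub finite_dyadic_boxes by (meson finite_SigmaI finite_subset)
    show "Y i \<in> borel_measurable M" if "i \<in> I n" for n i
      using that X_measurable ub by (auto simp: I_def Y_def)
    show "prob {\<omega> \<in> space M. u n \<le> \<bar>Y i \<omega>\<bar>} \<le> 2 * exp (- (real n + 1)\<^sup>2 / 2)" if "i \<in> I n" for n i
    proof -
      obtain a b a' b' where i: "i = ((a, b), (a', b'))" by (metis prod.exhaust)
      show ?thesis
        unfolding i Y_def u_def prod.case using that c
        by (intro X_diff_tail) (auto simp: I_def i intro: ub)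
    qed
    show "summable (\<lambda>n. real (card (I n)) * (2 * exp (- (real n + 1)\<^sup>2 / 2)))"
    proof (rule summable_comparison_test'[OF summable_power_times_gaussian[of "4 * CARD('d)"], of 0])
      fix n
      have "card (I n) \<le> card (dyadic_boxes n \<times> dyadic_boxes n :: (((real ^ 'd) \<times> (real ^ 'd)) \<times> ((real ^ 'd) \<times> (real ^ 'd))) set)"
        using sub by (intro card_mono finite_cartesian_product finite_dyadic_boxes)
      also have "\<dots> \<le> 2 ^ (2 * (n + 1) * CARD('d)) * 2 ^ (2 * (n + 1) * CARD('d))"
        unfolding card_cartesian_product by (intro mult_mono card_dyadic_boxes) auto
      also have "\<dots> = 2 ^ (4 * CARD('d) * (n + 1))"
        by (simp flip: power_add add: algebra_simps)
      finally have "real (card (I n)) \<le> 2 ^ (4 * CARD('d) * (n + 1))"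
        by (metis of_nat_le_iff of_nat_numeral of_nat_power)
      then show "norm (real (card (I n)) * (2 * exp (- (real n + 1)\<^sup>2 / 2))) \<le> 2 ^ (4 * CARD('d) * (n + 1)) * (2 * exp (- (real n + 1)\<^sup>2 / 2))"
        by (simp add: mult_right_mono)
    qed
  qed (rule u)
  then show ?thesis
  proof (rule AE_mp, intro AE_I2 impI)
    fix \<omega> assume "\<exists>B\<ge>0. \<forall>n. \<forall>i\<in>I n. \<bar>Y i \<omega>\<bar> \<le> u n + B * u n"
    then obtain B where B: "0 \<le> B" "\<And>n i. i \<in> I n \<Longrightarrow> \<bar>Y i \<omega>\<bar> \<le> u n + B * u n" by blast
    show "\<exists>B\<ge>0. \<forall>n a b a' b'. (a, b) \<in> dyadic_boxes n \<longrightarrow> (a', b') \<in> dyadic_boxes n \<longrightarrow>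
     (\<integral>\<^sup>+x. ennreal ((box_kernel \<psi> a b x - box_kernel \<psi> a' b' x)\<^sup>2) \<partial>lebesgue) \<le> ennreal (c * (1/2) ^ n) \<longrightarrow>
     \<bar>X a b \<omega> - X a' b' \<omega>\<bar> \<le> B * sqrt ((1/2) ^ n) * (real n + 1)"
    proof (intro exI[of _ "(1 + B) * sqrt c"] conjI allI impI)
      show "0 \<le> (1 + B) * sqrt c" using B(1) c by simp
      fix n a b a' b'
      assume "(a, b) \<in> dyadic_boxes n" "(a', b') \<in> dyadic_boxes n"
        "(\<integral>\<^sup>+x. ennreal ((box_kernel \<psi> a b x - box_kernel \<psi> a' b' x)\<^sup>2) \<partial>lebesgue) \<le> ennreal (c * (1/2) ^ n)"
      then have "((a, b), (a', b')) \<in> I n" by (simp add: I_def)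
      from B(2)[OF this] show "\<bar>X a b \<omega> - X a' b' \<omega>\<bar> \<le> (1 + B) * sqrt c * sqrt ((1/2) ^ n) * (real n + 1)"
        by (simp add: Y_def u_def real_sqrt_mult algebra_simps)
    qed
  qed
qed

end

section \<open>The anisotropic net\<close>

text \<open>Eight times the rounded-up binary logarithm of \<open>k + 1\<close>. Then
  \<open>2 ^ net_depth k\<close> lies between \<open>(k + 1) ^ 8\<close> and
  \<open>(2 * (k + 1)) ^ 8\<close>; the exponent 8 is a generous choice that brings every rounding
  error below the order \<open>1 / (k + 1)\<close>.\<close>

definition net_depth :: "nat \<Rightarrow> nat" where
  "net_depth k = 8 * (LEAST e. k + 1 \<le> 2 ^ e)"

lemma net_depth_bounds:
  obtains e where "net_depth k = 8 * e" "k + 1 \<le> 2 ^ e" "2 ^ e \<le> 2 * (k + 1)"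
proof -
  define e where "e = (LEAST e. k + 1 \<le> (2 :: nat) ^ e)"
  have ex: "k + 1 \<le> 2 ^ (k + 1)" by (meson less_exp less_imp_le)
  have 1: "k + 1 \<le> 2 ^ e"
    unfolding e_def by (rule LeastI[where P = "\<lambda>e. k + 1 \<le> 2 ^ e", OF ex])
  have 2: "2 ^ e \<le> 2 * (k + 1)"
  proof (cases e)
    case (Suc e')
    then have "\<not> k + 1 \<le> 2 ^ e'"
      unfolding e_def by (metis lessI not_less_Least)
    then show ?thesis using Suc by simp
  qed simp
  from 1 2 that[of e] show ?thesis by (simp add: net_depth_def e_def)
qed

text \<open>Here \<open>\<alpha>\<close> is the position of the left end and \<open>\<beta>\<close>
  the length in units of the mesh. A width of at most \<open>2 ^ (- j)\<close> is
  \<open>2 ^ m\<close> units, and outward rounding adds at most one unit at either end.\<close>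

definition interval_net :: "nat \<Rightarrow> nat \<Rightarrow> (real \<times> real) set" where
  "interval_net j m = (\<lambda>(\<alpha>, \<beta>). (real \<alpha> / 2 ^ (j + m), real (\<alpha> + \<beta>) / 2 ^ (j + m))) ` ({..2 ^ (j + m)} \<times> {1..2 ^ m + 2})"

lemma finite_interval_net: "finite (interval_net j m)"
  by (simp add: interval_net_def)

lemma card_interval_net: "card (interval_net j m) \<le> 6 * 2 ^ j * (2 ^ m)\<^sup>2"
proof -
  have "card (interval_net j m) \<le> (2 ^ (j + m) + 1) * (2 ^ m + 2)"
    unfolding interval_net_def by (rule order_trans[OF card_image_le]) auto
  also have "\<dots> \<le> (2 * 2 ^ (j + m)) * (3 * 2 ^ m)"
    by (intro mult_mono) auto
  also have "\<dots> = 6 * 2 ^ j * (2 ^ m)\<^sup>2"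
    by (simp add: power_add power2_eq_square)
  finally show ?thesis .
qed

text \<open>Only this net has to have the right cardinality \<open>2 ^ k\<close> up to logarithmic factors. The
  mesh in a direction is therefore proportional to the width of the boxes in that direction.\<close>

definition box_net :: "nat \<Rightarrow> ((real ^ 'd::finite) \<times> (real ^ 'd)) set" where
  "box_net k = {(a, b) \<in> unit_boxes. \<exists>\<kappa>. sum \<kappa> UNIV = k \<and> (\<forall>i. (a $ i, b $ i) \<in> interval_net (\<kappa> i) (net_depth k))}"

text \<open>The positions contribute \<open>2 ^ \<kappa> i\<close> in direction \<open>i\<close>,
  and their product is \<open>2 ^ k\<close> for every shape of level \<open>k\<close>. The number of
  shapes is at most \<open>(k + 1) ^ CARD('d)\<close>; the refinement of positions and the lengths
  cost a factor of order \<open>2 ^ net_depth k\<close> each per direction.\<close>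

lemma
  shows finite_box_net: "finite (box_net k :: ((real ^ 'd::finite) \<times> (real ^ 'd)) set)"
    and card_box_net: "card (box_net k :: ((real ^ 'd::finite) \<times> (real ^ 'd)) set)
      \<le> (k + 1) ^ CARD('d) * (6 ^ CARD('d) * 2 ^ k * (2 ^ net_depth k) ^ (2 * CARD('d)))"
proof -
  let ?m = "net_depth k"
  define \<K> where "\<K> = {\<kappa> :: 'd \<Rightarrow> nat. sum \<kappa> UNIV = k}"
  define P where "P \<kappa> = {(a, b :: real ^ 'd). \<forall>i. (a $ i, b $ i) \<in> (\<lambda>i. interval_net (\<kappa> i) ?m) i}" for \<kappa>
  have "\<K> \<subseteq> PiE UNIV (\<lambda>_. {..k})"
    by (auto simp: \<K>_def intro: member_le_sum)
  moreover have fP: "finite (PiE (UNIV :: 'd set) (\<lambda>_. {..k}))" by (intro finite_PiE) auto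
  ultimately have \<K>: "finite \<K>" "card \<K> \<le> (k + 1) ^ CARD('d)"
    using card_mono[of "PiE (UNIV :: 'd set) (\<lambda>_. {..k})" \<K>] by (auto simp: card_PiE finite_subset)
  have P: "finite (P \<kappa>)" for \<kappa>
    unfolding P_def by (rule finite_coordinatewise_pairs) (simp add: finite_interval_net)
  have cP: "card (P \<kappa>) \<le> 6 ^ CARD('d) * 2 ^ k * (2 ^ ?m) ^ (2 * CARD('d))" if "\<kappa> \<in> \<K>" for \<kappa>
  proof -
    have "card (P \<kappa>) \<le> (\<Prod>i\<in>UNIV. card (interval_net (\<kappa> i) ?m))"
      unfolding P_def by (rule card_coordinatewise_pairs) (simp add: finite_interval_net)
    also have "\<dots> \<le> (\<Prod>i\<in>UNIV. 6 * 2 ^ \<kappa> i * (2 ^ ?m)\<^sup>2)"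
      by (intro prod_mono conjI card_interval_net) auto
    also have "\<dots> = 6 ^ CARD('d) * 2 ^ sum \<kappa> UNIV * (2 ^ ?m) ^ (2 * CARD('d))"
      by (simp add: prod.distrib power_sum flip: power_mult)
    finally show ?thesis using that by (simp add: \<K>_def)
  qed
  have sub: "box_net k \<subseteq> (\<Union>\<kappa>\<in>\<K>. P \<kappa>)"
    by (auto simp: box_net_def \<K>_def P_def)
  have fU: "finite (\<Union>\<kappa>\<in>\<K>. P \<kappa>)" using \<K> P by auto
  with sub show "finite (box_net k :: ((real ^ 'd) \<times> (real ^ 'd)) set)" by (rule finite_subset)
  have "card (box_net k :: ((real ^ 'd) \<times> (real ^ 'd)) set) \<le> card (\<Union>\<kappa>\<in>\<K>. P \<kappa>)"
    using sub fU by (rule card_mono[rotated])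
  also have "\<dots> \<le> (\<Sum>\<kappa>\<in>\<K>. card (P \<kappa>))" by (rule card_UN_le[OF \<K>(1)])
  also have "\<dots> \<le> (\<Sum>\<kappa>\<in>\<K>. 6 ^ CARD('d) * 2 ^ k * (2 ^ ?m) ^ (2 * CARD('d)))"
    by (intro sum_mono cP)
  also have "\<dots> = card \<K> * (6 ^ CARD('d) * 2 ^ k * (2 ^ ?m) ^ (2 * CARD('d)))" by simp
  also have "\<dots> \<le> (k + 1) ^ CARD('d) * (6 ^ CARD('d) * 2 ^ k * (2 ^ ?m) ^ (2 * CARD('d)))"
    by (intro mult_right_mono \<K>) simp
  finally show "card (box_net k :: ((real ^ 'd) \<times> (real ^ 'd)) set)
      \<le> (k + 1) ^ CARD('d) * (6 ^ CARD('d) * 2 ^ k * (2 ^ net_depth k) ^ (2 * CARD('d)))" .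
qed

text \<open>The exponent 17 is 1 for the shapes plus 2 times 8 for the square of
  \<open>2 ^ net_depth k\<close> in each direction.\<close>

lemma card_box_net_real:
  "real (card (box_net k :: ((real ^ 'd::finite) \<times> (real ^ 'd)) set))
    \<le> 6 ^ CARD('d) * 2 ^ (16 * CARD('d)) * 2 ^ k * (real k + 2) ^ (17 * CARD('d))"
proof -
  obtain e where e: "net_depth k = 8 * e" "2 ^ e \<le> 2 * (k + 1)"
    using net_depth_bounds by metis
  have "real (2 ^ e) \<le> real (2 * (k + 1))" using e(2) by (simp only: of_nat_le_iff)
  then have "2 ^ e \<le> 2 * (real k + 2)" by simp
  then have "(2 ^ e :: real) ^ 8 \<le> (2 * (real k + 2)) ^ 8" by (intro power_mono) auto
  then have m: "(2 :: real) ^ net_depth k \<le> (2 * (real k + 2)) ^ 8"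
    by (simp add: e(1) mult.commute flip: power_mult)
  have "real (card (box_net k :: ((real ^ 'd) \<times> (real ^ 'd)) set))
    \<le> real ((k + 1) ^ CARD('d) * (6 ^ CARD('d) * 2 ^ k * (2 ^ net_depth k) ^ (2 * CARD('d))))"
    by (simp only: of_nat_le_iff card_box_net)
  also have "\<dots> = (real k + 1) ^ CARD('d) * (6 ^ CARD('d) * 2 ^ k * (2 ^ net_depth k) ^ (2 * CARD('d)))"
    by (simp add: add.commute)
  also have "\<dots> \<le> (real k + 2) ^ CARD('d) * (6 ^ CARD('d) * 2 ^ k * ((2 * (real k + 2)) ^ 8) ^ (2 * CARD('d)))"
    by (intro mult_mono power_mono m) auto
  also have "\<dots> = 6 ^ CARD('d) * 2 ^ (16 * CARD('d)) * 2 ^ k * (real k + 2) ^ (17 * CARD('d))"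
  proof -
    have "((2 * (real k + 2)) ^ 8) ^ (2 * CARD('d)) = 2 ^ (16 * CARD('d)) * (real k + 2) ^ (16 * CARD('d))"
      by (simp only: power_mult_distrib flip: power_mult) simp
    moreover have "(real k + 2) ^ (17 * CARD('d)) = (real k + 2) ^ CARD('d) * (real k + 2) ^ (16 * CARD('d))"
      by (simp flip: power_add)
    ultimately show ?thesis by simp
  qed
  finally show ?thesis .
qed

text \<open>The order of \<open>D_scale\<close> at volume \<open>2 ^ (- k)\<close>, in terms of the
  level.\<close>

definition level_scale :: "nat \<Rightarrow> real" where
  "level_scale k = ln (real k + 2) / sqrt (real k + 1)"

text \<open>Lets errors of order \<open>1 / (k + 1)\<close> be absorbed by the scale.\<close>

lemma level_scale_ge: "1 / (2 * (real k + 1)) \<le> level_scale k"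
proof -
  have "1 / 2 \<le> ln (2 :: real)" using ln2_ge_two_thirds by simp
  also have "\<dots> \<le> ln (real k + 2)" by simp
  finally have 1: "1 / 2 \<le> ln (real k + 2)" .
  have "1 * sqrt (real k + 1) \<le> sqrt (real k + 1) * sqrt (real k + 1)" by (intro mult_right_mono) auto
  then have 2: "sqrt (real k + 1) \<le> real k + 1" by simp
  have "1 / (2 * (real k + 1)) = (1 / 2) / (real k + 1)" by simp
  also have "\<dots> \<le> ln (real k + 2) / sqrt (real k + 1)"
    using 1 2 by (intro frac_le) auto
  finally show ?thesis by (simp add: level_scale_def)
qed

lemma level_scale_pos: "0 < level_scale k"
  by (rule less_le_trans[OF _ level_scale_ge]) simp

text \<open>Outward rounding may make a net box larger than its level suggests, but by no more than
  a factor 3 in each direction, as \<open>2 ^ m + 2\<close> is at most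
  \<open>3 * 2 ^ m\<close>.\<close>

lemma box_net_volume:
  assumes "(a, b :: real ^ 'd::finite) \<in> box_net k"
  shows "(\<Prod>i\<in>UNIV. b $ i - a $ i) \<le> 3 ^ CARD('d) / 2 ^ k"
proof -
  obtain \<kappa> where \<kappa>: "sum \<kappa> UNIV = k" "\<And>i. (a $ i, b $ i) \<in> interval_net (\<kappa> i) (net_depth k)"
    and ub: "(a, b) \<in> unit_boxes"
    using assms by (auto simp: box_net_def)
  have "(\<Prod>i\<in>UNIV. b $ i - a $ i) \<le> (\<Prod>i\<in>UNIV. 3 / 2 ^ \<kappa> i)"
  proof (intro prod_mono conjI)
    fix i :: 'd
    show "0 \<le> b $ i - a $ i" using ub by (simp add: unit_boxes_def less_imp_le)
    obtain \<alpha> \<beta> where *: "a $ i = real \<alpha> / 2 ^ (\<kappa> i + net_depth k)" "b $ i = real (\<alpha> + \<beta>) / 2 ^ (\<kappa> i + net_depth k)" "\<beta> \<le> 2 ^ net_depth k + 2"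
      using \<kappa>(2)[of i] by (auto simp: interval_net_def)
    have "b $ i - a $ i = real \<beta> / 2 ^ (\<kappa> i + net_depth k)"
      unfolding * by (simp add: diff_divide_distrib[symmetric])
    also have "\<dots> \<le> (3 * 2 ^ net_depth k) / 2 ^ (\<kappa> i + net_depth k)"
    proof (intro divide_right_mono)
      have "real \<beta> \<le> real (2 ^ net_depth k + 2)" using *(3) by (simp only: of_nat_le_iff)
      also have "\<dots> \<le> 3 * 2 ^ net_depth k" by simp
      finally show "real \<beta> \<le> 3 * 2 ^ net_depth k" .
    qed simp
    also have "\<dots> = 3 / 2 ^ \<kappa> i" by (simp add: power_add)
    finally show "b $ i - a $ i \<le> 3 / 2 ^ \<kappa> i" .
  qed
  also have "\<dots> = 3 ^ CARD('d) / 2 ^ k"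
    by (simp add: prod_dividef power_sum[symmetric] \<kappa>(1))
  finally show ?thesis .
qed

lemma unit_box_volume:
  assumes "(a, b :: real ^ 'd::finite) \<in> unit_boxes"
  shows "0 < (\<Prod>i\<in>UNIV. b $ i - a $ i)" "(\<Prod>i\<in>UNIV. b $ i - a $ i) \<le> 1"
proof -
  have *: "0 \<le> a $ i" "a $ i < b $ i" "b $ i \<le> 1" for i using assms by (auto simp: unit_boxes_def)
  then show "0 < (\<Prod>i\<in>UNIV. b $ i - a $ i)" by (intro prod_pos) simp
  show "(\<Prod>i\<in>UNIV. b $ i - a $ i) \<le> 1"
  proof (intro prod_le_1 conjI)
    fix i show "0 \<le> b $ i - a $ i" "b $ i - a $ i \<le> 1" using *[of i] by auto
  qed
qed

text \<open>Since \<open>ln 3\<close> is at most \<open>2 * ln 2\<close>, the factor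
  \<open>3 ^ d\<close> costs at most \<open>2 * d\<close> levels, which is half of \<open>k\<close>
  once \<open>4 * d\<close> is at most \<open>k\<close>. The lower bound converts a surplus of order
  \<open>level_scale k\<close> into a power of \<open>k + 2\<close> in the tail.\<close>

lemma Gamma_scale_lower:
  assumes v: "0 < v" "v \<le> 3 ^ d / 2 ^ k" and k: "4 * d \<le> k" "1 \<le> k"
  shows "sqrt (real k + 1) / 2 \<le> Gamma_scale v"
proof -
  have "real k * ln 2 - real d * (2 * ln 2) \<le> real k * ln 2 - real d * ln 3"
  proof -
    have "ln (3 :: real) \<le> ln (2 ^ 2)" by (subst ln_le_cancel_iff) auto
    also have "\<dots> = 2 * ln 2" by (subst ln_realpow) simp_all
    finally show ?thesis by (simp add: mult_left_mono)
  qed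
  also have "\<dots> = ln (2 ^ k / 3 ^ d)" by (simp add: ln_div ln_realpow)
  also have "\<dots> \<le> ln (1 / v)"
    using v by (subst ln_le_cancel_iff) (auto simp: field_simps)
  finally have 1: "(real k - 2 * real d) * ln 2 \<le> ln (1 / v)" by (simp add: algebra_simps)
  have dk: "4 * real d \<le> real k" "1 \<le> real k" using k by linarith+
  have "(real k / 2) * (2 / 3) \<le> (real k - 2 * real d) * ln 2"
    using dk ln2_ge_two_thirds by (intro mult_mono) auto
  then have "(real k / 2) * (2 / 3) \<le> ln (1 / v)" using 1 by (rule order_trans)
  moreover have "(real k + 1) / 4 \<le> 2 * L" if "(real k / 2) * (2 / 3) \<le> L" for L
    using that dk(2) by (simp add: field_simps)
  ultimately have "(real k + 1) / 4 \<le> 2 * ln (1 / v)" by blast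
  then have "sqrt ((real k + 1) / 4) \<le> Gamma_scale v"
    unfolding Gamma_scale_def by (rule real_sqrt_le_mono)
  then show ?thesis by (simp add: real_sqrt_divide)
qed

text \<open>\<open>Gamma_scale\<close> is designed so that
  \<open>exp (- (Gamma_scale v)^2 / 2)\<close> equals \<open>v\<close>. The mixed term of the square
  gives the additional decay, and the square of \<open>\<gamma>\<close> is dropped.\<close>

lemma gaussian_tail_Gamma_scale:
  assumes v: "0 < v" "v \<le> 1" and \<gamma>: "0 \<le> \<gamma>"
  shows "exp (- (Gamma_scale v + \<gamma>)\<^sup>2 / 2) \<le> v * exp (- (Gamma_scale v * \<gamma>))"
proof -
  have G2: "(Gamma_scale v)\<^sup>2 = 2 * ln (1 / v)"
    using v by (simp add: Gamma_scale_def)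
  have "(Gamma_scale v)\<^sup>2 + 2 * (Gamma_scale v * \<gamma>) \<le> (Gamma_scale v + \<gamma>)\<^sup>2"
    by (simp add: power2_sum)
  then have "- (Gamma_scale v + \<gamma>)\<^sup>2 / 2 \<le> ln v - Gamma_scale v * \<gamma>"
    using v unfolding G2 by (simp add: ln_div)
  then have "exp (- (Gamma_scale v + \<gamma>)\<^sup>2 / 2) \<le> exp (ln v - Gamma_scale v * \<gamma>)" by simp
  also have "\<dots> = v * exp (- (Gamma_scale v * \<gamma>))"
    using v by (simp add: exp_diff exp_minus field_simps)
  finally show ?thesis .
qed

context kernel_integrals
begin

lemma AE_box_net_bound:
  "AE \<omega> in M. \<exists>B\<ge>0. \<forall>k. \<forall>(a, b)\<in>box_net k.
     \<bar>X a b \<omega> / (sqrt (\<Prod>i\<in>UNIV. (b $ i - a $ i) / 2) * L2norm \<psi>)\<bar>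
       \<le> Gamma_scale (\<Prod>i\<in>UNIV. b $ i - a $ i) + B * level_scale k"
proof -
  \<comment> \<open>The part \<open>17 * CARD('d)\<close> cancels the polynomial factor in the size
    of the net, and 2 more powers make the series converge.\<close>
  define q where "q = 17 * CARD('d) + 2"
  define Y where "Y = (\<lambda>(a, b) \<omega>. X a b \<omega> / (sqrt (\<Prod>i\<in>UNIV. (b $ i - a $ i) / 2) * L2norm \<psi>))"
  define G where "G = (\<lambda>(a, b :: real ^ 'd). Gamma_scale (\<Prod>i\<in>UNIV. b $ i - a $ i))"
  define p where "p k = 2 * (3 ^ CARD('d) / 2 ^ k * (1 / (real k + 2) ^ q))" for k
  have ub: "(a, b) \<in> unit_boxes" if "(a, b) \<in> box_net k" for a b :: "real ^ 'd" and k
    using that by (simp add: box_net_def)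
  have "AE \<omega> in M. \<exists>B\<ge>0. \<forall>k. \<forall>i\<in>box_net k. \<bar>Y i \<omega>\<bar> \<le> (G i + 2 * real q * level_scale k) + B * level_scale k"
  proof (rule finite_families_AE_bounded[where N = "4 * CARD('d)" and p = p])
    show "finite (box_net k :: ((real ^ 'd) \<times> (real ^ 'd)) set)" for k by (rule finite_box_net)
    show "Y i \<in> borel_measurable M" if "i \<in> box_net k" for k i
      using X_measurable[OF ub] that by (cases i) (auto simp: Y_def)
    show "prob {\<omega> \<in> space M. G i + 2 * real q * level_scale k \<le> \<bar>Y i \<omega>\<bar>} \<le> p k"
      if k: "4 * CARD('d) \<le> k" and i: "i \<in> box_net k" for k i
    proof -
      obtain a b where ab: "i = (a, b)" by fastforce
      define v where "v = (\<Prod>i\<in>UNIV. b $ i - a $ i)"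
      have net: "(a, b) \<in> box_net k" using i ab by simp
      have v: "0 < v" "v \<le> 1" "v \<le> 3 ^ CARD('d) / 2 ^ k"
        using unit_box_volume[OF ub[OF net]] box_net_volume[OF net] by (auto simp: v_def)
      \<comment> \<open>Multiplied by the lower bound \<open>sqrt (real k + 1) / 2\<close> of
        \<open>Gamma_scale v\<close>, this is exactly \<open>q * ln (real k + 2)\<close>.\<close>
      define \<gamma> where "\<gamma> = 2 * real q * level_scale k"
      have \<gamma>: "0 < \<gamma>" using level_scale_pos[of k] by (simp add: \<gamma>_def q_def)
      have "1 \<le> CARD('d)" by (simp add: Suc_leI)
      then have k1: "1 \<le> k" using k by linarith
      have Gl: "sqrt (real k + 1) / 2 \<le> Gamma_scale v" by (rule Gamma_scale_lower[OF v(1,3) k k1])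
      have "real q * ln (real k + 2) = (sqrt (real k + 1) / 2) * \<gamma>"
        by (simp add: \<gamma>_def level_scale_def)
      also have "\<dots> \<le> Gamma_scale v * \<gamma>" using Gl \<gamma> by (intro mult_right_mono) auto
      finally have "exp (- (Gamma_scale v * \<gamma>)) \<le> exp (- (real q * ln (real k + 2)))" by simp
      also have "\<dots> = 1 / (real k + 2) ^ q"
        by (simp add: exp_minus exp_of_nat_mult inverse_eq_divide)
      finally have ex: "exp (- (Gamma_scale v * \<gamma>)) \<le> 1 / (real k + 2) ^ q" .
      have G0: "0 \<le> Gamma_scale v" using Gl by (rule order_trans[rotated]) simp
      have "prob {\<omega> \<in> space M. Gamma_scale v + \<gamma> \<le> \<bar>Y i \<omega>\<bar>} \<le> 2 * exp (- (Gamma_scale v + \<gamma>)\<^sup>2 / 2)"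
        unfolding Y_def ab prod.case using G0 \<gamma> by (intro X_tail[OF ub[OF net]]) simp
      also have "\<dots> \<le> 2 * (v * exp (- (Gamma_scale v * \<gamma>)))"
        using v \<gamma> by (intro mult_left_mono gaussian_tail_Gamma_scale) auto
      also have "\<dots> \<le> p k"
        unfolding p_def using v ex by (intro mult_left_mono mult_mono) auto
      finally show ?thesis by (simp add: G_def ab v_def \<gamma>_def)
    qed
    show "summable (\<lambda>k. real (card (box_net k :: ((real ^ 'd) \<times> (real ^ 'd)) set)) * p k)"
    proof (rule summable_comparison_test')
      define C where "C = 6 ^ CARD('d) * 2 ^ (16 * CARD('d)) * (2 * 3 ^ CARD('d) :: real)"
      have "summable (\<lambda>k. 1 / real (k + 2) ^ 2)"
      proof -
        have "summable (\<lambda>k. inverse (real k ^ 2))" by (rule inverse_power_summable) simp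
        from summable_ignore_initial_segment[OF this, of 2] show ?thesis by (simp add: inverse_eq_divide)
      qed
      then show "summable (\<lambda>k. C * (1 / real (k + 2) ^ 2))" by (rule summable_mult)
      fix k
      have "real (card (box_net k :: ((real ^ 'd) \<times> (real ^ 'd)) set)) * p k
        \<le> (6 ^ CARD('d) * 2 ^ (16 * CARD('d)) * 2 ^ k * (real k + 2) ^ (17 * CARD('d))) * p k"
        by (intro mult_right_mono card_box_net_real) (simp add: p_def)
      also have "\<dots> = C * (1 / real (k + 2) ^ 2)"
        by (simp add: p_def C_def q_def power_add power2_eq_square add.commute[of 2])
      finally show "norm (real (card (box_net k :: ((real ^ 'd) \<times> (real ^ 'd)) set)) * p k) \<le> C * (1 / real (k + 2) ^ 2)"
        by (simp add: p_def)
    qed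
  qed (rule level_scale_pos)
  then show ?thesis
  proof (rule AE_mp, intro AE_I2 impI)
    fix \<omega> assume "\<exists>B\<ge>0. \<forall>k. \<forall>i\<in>box_net k. \<bar>Y i \<omega>\<bar> \<le> (G i + 2 * real q * level_scale k) + B * level_scale k"
    then obtain B where B: "0 \<le> B" "\<And>k i. i \<in> box_net k \<Longrightarrow> \<bar>Y i \<omega>\<bar> \<le> (G i + 2 * real q * level_scale k) + B * level_scale k"
      by blast
    show "\<exists>B\<ge>0. \<forall>k. \<forall>(a, b)\<in>box_net k.
     \<bar>X a b \<omega> / (sqrt (\<Prod>i\<in>UNIV. (b $ i - a $ i) / 2) * L2norm \<psi>)\<bar>
       \<le> Gamma_scale (\<Prod>i\<in>UNIV. b $ i - a $ i) + B * level_scale k"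
    proof (intro exI[of _ "2 * real q + B"] conjI allI ballI)
      fix k and i :: "(real ^ 'd) \<times> (real ^ 'd)" assume i: "i \<in> box_net k"
      obtain a b where ab: "i = (a, b)" by fastforce
      show "case i of (a, b) \<Rightarrow> \<bar>X a b \<omega> / (sqrt (\<Prod>i\<in>UNIV. (b $ i - a $ i) / 2) * L2norm \<psi>)\<bar>
       \<le> Gamma_scale (\<Prod>i\<in>UNIV. b $ i - a $ i) + (2 * real q + B) * level_scale k"
        using B(2)[OF i] by (simp add: ab Y_def G_def algebra_simps)
    qed (use B(1) in simp)
  qed
qed

end

section \<open>Outer dyadic boxes\<close>

definition dyadic_floor :: "nat \<Rightarrow> real \<Rightarrow> real" where
  "dyadic_floor n x = of_int \<lfloor>x * 2 ^ n\<rfloor> / 2 ^ n"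

definition dyadic_ceil :: "nat \<Rightarrow> real \<Rightarrow> real" where
  "dyadic_ceil n x = of_int \<lceil>x * 2 ^ n\<rceil> / 2 ^ n"

lemma dyadic_ceil_eq: "dyadic_ceil n x = - dyadic_floor n (- x)"
  by (simp add: dyadic_ceil_def dyadic_floor_def ceiling_def)

lemma dyadic_floor_bounds: "dyadic_floor n x \<le> x" "x - dyadic_floor n x \<le> (1/2) ^ n"
proof -
  have 1: "of_int \<lfloor>x * 2 ^ n\<rfloor> \<le> x * 2 ^ n" and 2: "x * 2 ^ n - of_int \<lfloor>x * 2 ^ n\<rfloor> \<le> 1" by linarith+
  from 1 show "dyadic_floor n x \<le> x" by (simp add: dyadic_floor_def divide_le_eq)
  have "x - dyadic_floor n x = (x * 2 ^ n - of_int \<lfloor>x * 2 ^ n\<rfloor>) / 2 ^ n"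
    by (simp add: dyadic_floor_def diff_divide_distrib)
  also have "\<dots> \<le> 1 / 2 ^ n" using 2 by (intro divide_right_mono) auto
  finally show "x - dyadic_floor n x \<le> (1/2) ^ n" by (simp add: power_one_over)
qed

lemma dyadic_ceil_bounds: "x \<le> dyadic_ceil n x" "dyadic_ceil n x - x \<le> (1/2) ^ n"
  using dyadic_floor_bounds[where n = n and x = "- x"] by (auto simp: dyadic_ceil_eq)

lemma dyadic_floor_Suc: "dyadic_floor n x \<le> dyadic_floor (Suc n) x"
proof -
  have "2 * \<lfloor>x * 2 ^ n\<rfloor> \<le> \<lfloor>x * 2 ^ Suc n\<rfloor>"
  proof (rule le_floor_iff[THEN iffD2])
    show "real_of_int (2 * \<lfloor>x * 2 ^ n\<rfloor>) \<le> x * 2 ^ Suc n"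
      using of_int_floor_le[of "x * 2 ^ n"] by simp
  qed
  then have "2 * real_of_int \<lfloor>x * 2 ^ n\<rfloor> \<le> of_int \<lfloor>x * 2 ^ Suc n\<rfloor>" by linarith
  then show ?thesis by (simp add: dyadic_floor_def field_simps)
qed

lemma dyadic_ceil_Suc: "dyadic_ceil (Suc n) x \<le> dyadic_ceil n x"
  using dyadic_floor_Suc[of n "- x"] by (simp add: dyadic_ceil_eq)

lemma dyadic_unit_mono:
  assumes "m \<le> n" shows "dyadic_unit m \<subseteq> dyadic_unit n"
proof
  fix x assume "x \<in> dyadic_unit m"
  then obtain j where j: "x = real j / 2 ^ m" "j \<le> 2 ^ m" by (auto simp: dyadic_unit_def)
  have n: "n = m + (n - m)" using assms by simp
  have "x = real (j * 2 ^ (n - m)) / 2 ^ n"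
    unfolding j by (subst (2) n) (simp add: power_add)
  moreover have "j * 2 ^ (n - m) \<le> 2 ^ n"
    using j(2) by (subst n) (simp add: power_add)
  ultimately show "x \<in> dyadic_unit n" unfolding dyadic_unit_def by blast
qed

lemma dyadic_floor_in_unit:
  assumes "0 \<le> x" "x \<le> 1" shows "dyadic_floor n x \<in> dyadic_unit n"
proof -
  have "0 \<le> \<lfloor>x * 2 ^ n\<rfloor>" using assms by simp
  moreover have "\<lfloor>x * 2 ^ n\<rfloor> \<le> 2 ^ n"
    using assms by (simp add: floor_le_iff) (smt (verit) mult_left_le_one_le zero_le_power mult_right_mono mult_1)
  ultimately have "dyadic_floor n x = real (nat \<lfloor>x * 2 ^ n\<rfloor>) / 2 ^ n" "nat \<lfloor>x * 2 ^ n\<rfloor> \<le> 2 ^ n"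
    by (simp_all add: dyadic_floor_def nat_le_iff)
  then show ?thesis unfolding dyadic_unit_def by blast
qed

lemma dyadic_ceil_in_unit:
  assumes "0 \<le> x" "x \<le> 1" shows "dyadic_ceil n x \<in> dyadic_unit n"
proof -
  have "0 \<le> \<lceil>x * 2 ^ n\<rceil>" using assms by (simp add: le_ceiling_iff) (smt (verit) mult_nonneg_nonneg zero_le_power)
  moreover have "\<lceil>x * 2 ^ n\<rceil> \<le> 2 ^ n" using assms by (simp add: ceiling_le_iff)
  ultimately have "dyadic_ceil n x = real (nat \<lceil>x * 2 ^ n\<rceil>) / 2 ^ n" "nat \<lceil>x * 2 ^ n\<rceil> \<le> 2 ^ n"
    by (simp_all add: dyadic_ceil_def nat_le_iff)
  then show ?thesis unfolding dyadic_unit_def by blast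
qed

lemma dyadic_unit_range: "x \<in> dyadic_unit n \<Longrightarrow> 0 \<le> x \<and> x \<le> 1"
proof -
  assume "x \<in> dyadic_unit n"
  then obtain j where j: "x = real j / 2 ^ n" "j \<le> 2 ^ n" by (auto simp: dyadic_unit_def)
  from j(2) have "real j \<le> real (2 ^ n)" by (simp only: of_nat_le_iff)
  then show ?thesis by (simp add: j(1) divide_le_eq)
qed

definition outer_lower :: "('d \<Rightarrow> nat) \<Rightarrow> nat \<Rightarrow> real ^ 'd::finite \<Rightarrow> real ^ 'd" where
  "outer_lower \<kappa> m a = (\<chi> i. dyadic_floor (\<kappa> i + m) (a $ i))"

definition outer_upper :: "('d \<Rightarrow> nat) \<Rightarrow> nat \<Rightarrow> real ^ 'd::finite \<Rightarrow> real ^ 'd" where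
  "outer_upper \<kappa> m b = (\<chi> i. dyadic_ceil (\<kappa> i + m) (b $ i))"

locale dyadic_width =
  fixes \<kappa> :: "'d::finite \<Rightarrow> nat" and a b :: "real ^ 'd" and k :: nat
  assumes box: "(a, b) \<in> unit_boxes"
    and width: "\<And>i. (1/2) ^ (\<kappa> i + 1) < b $ i - a $ i" "\<And>i. b $ i - a $ i \<le> (1/2) ^ \<kappa> i"
    and level: "sum \<kappa> UNIV = k"
begin

abbreviation "l m \<equiv> outer_lower \<kappa> m a"
abbreviation "r m \<equiv> outer_upper \<kappa> m b"

lemma unit: "0 \<le> a $ i" "a $ i < b $ i" "b $ i \<le> 1"
  using box by (auto simp: unit_boxes_def)

lemma outer_bounds: "l m $ i \<le> a $ i" "b $ i \<le> r m $ i"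
  "a $ i - l m $ i \<le> (1/2) ^ (\<kappa> i + m)" "r m $ i - b $ i \<le> (1/2) ^ (\<kappa> i + m)"
  "l m $ i \<le> l (Suc m) $ i" "r (Suc m) $ i \<le> r m $ i"
  using dyadic_floor_bounds[where n = "\<kappa> i + m" and x = "a $ i"] dyadic_ceil_bounds[where n = "\<kappa> i + m" and x = "b $ i"]
    dyadic_floor_Suc[of "\<kappa> i + m" "a $ i"] dyadic_ceil_Suc[of "\<kappa> i + m" "b $ i"]
  by (auto simp: outer_lower_def outer_upper_def)

lemma outer_nonempty: "l m $ i < r m $ i"
  using outer_bounds(1,2)[where m = m and i = i] unit(2)[of i] by linarith

lemma outer_width: "r m $ i - l m $ i \<le> b $ i - a $ i + 2 * (1/2) ^ (\<kappa> i + m)"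
  using outer_bounds(3,4)[where m = m and i = i] by linarith

lemma outer_in_unit: "l m $ i \<in> dyadic_unit (\<kappa> i + m)" "r m $ i \<in> dyadic_unit (\<kappa> i + m)"
  using unit[of i] by (auto simp: outer_lower_def outer_upper_def intro!: dyadic_floor_in_unit dyadic_ceil_in_unit)

text \<open>Rounding outward does not leave the unit cube because 0 and 1 belong to every dyadic
  grid. So the outer boxes are again admissible indices of the process.\<close>

lemma outer_unit_box: "(l m, r m) \<in> unit_boxes"
proof -
  have "0 \<le> l m $ i \<and> l m $ i < r m $ i \<and> r m $ i \<le> 1" for i
    using outer_nonempty[of m i] dyadic_unit_range[OF outer_in_unit(1)[of m i]] dyadic_unit_range[OF outer_in_unit(2)[of m i]] by simp
  then show ?thesis by (simp add: unit_boxes_def)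
qed

text \<open>No \<open>\<kappa> i\<close> exceeds \<open>k\<close>, so the anisotropic grid is
  contained in the isotropic one of level \<open>k + m\<close>.\<close>

lemma outer_dyadic_box:
  assumes "k + m \<le> n" shows "(l m, r m) \<in> dyadic_boxes n"
proof -
  have "\<kappa> i \<le> k" for i unfolding level[symmetric] by (intro member_le_sum) auto
  then have "\<kappa> i + m \<le> n" for i using assms by (meson add_le_mono1 order_trans)
  then have "l m $ i \<in> dyadic_unit n \<and> r m $ i \<in> dyadic_unit n" for i
    using outer_in_unit dyadic_unit_mono by (meson subsetD)
  then show ?thesis
    using outer_unit_box by (simp add: dyadic_boxes_def)
qed

lemma half_power_level: "(\<Prod>i\<in>UNIV. (1/2 :: real) ^ \<kappa> i) = (1/2) ^ k"
  by (simp only: power_sum level[symmetric])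

text \<open>This is the slab volume that \<open>box_kernel_dist_bound\<close> asks for. As the mesh
  is proportional to the width, moving a face costs the same fraction \<open>2 ^ (- m)\<close> of
  the volume in every direction.\<close>

lemma outer_step:
  "(1/2) ^ (\<kappa> i + m) * (\<Prod>j\<in>UNIV - {i}. r m $ j - l m $ j) \<le> 3 ^ CARD('d) * (1/2) ^ (k + m)"
proof -
  \<comment> \<open>The first factor is enlarged by 3 only to complete the product over all
    coordinates.\<close>
  have "(1/2) ^ (\<kappa> i + m) * (\<Prod>j\<in>UNIV - {i}. r m $ j - l m $ j)
    \<le> (3 * (1/2) ^ \<kappa> i * (1/2) ^ m) * (\<Prod>j\<in>UNIV - {i}. 3 * (1/2) ^ \<kappa> j)"
  proof (intro mult_mono prod_mono conjI)
    fix j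
    show "0 \<le> r m $ j - l m $ j" using outer_nonempty[of m j] by simp
    have "(1/2 :: real) ^ (\<kappa> j + m) \<le> (1/2) ^ \<kappa> j" by (intro power_decreasing) auto
    then show "r m $ j - l m $ j \<le> 3 * (1/2) ^ \<kappa> j"
      using outer_width[of m j] width(2)[of j] by linarith
  next
    show "0 \<le> (\<Prod>j\<in>UNIV - {i}. r m $ j - l m $ j)"
      using outer_nonempty[of m] by (intro prod_nonneg) (simp add: less_imp_le)
  qed (auto simp: power_add)
  also have "\<dots> = (\<Prod>j\<in>UNIV. 3 * (1/2) ^ \<kappa> j) * (1/2) ^ m"
    by (subst (2) prod.remove[of _ i]) auto
  also have "\<dots> = 3 ^ CARD('d) * (1/2) ^ (k + m)"
    by (simp only: prod.distrib half_power_level power_add prod_constant mult.assoc)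
  finally show ?thesis .
qed

lemma outer_in_box_net: "(l (net_depth k), r (net_depth k)) \<in> box_net k"
proof -
  let ?m = "net_depth k"
  have "(l ?m $ i, r ?m $ i) \<in> interval_net (\<kappa> i) ?m" for i
  proof -
    let ?N = "2 ^ (\<kappa> i + ?m) :: real"
    obtain \<alpha> where \<alpha>: "l ?m $ i = real \<alpha> / ?N" "\<alpha> \<le> 2 ^ (\<kappa> i + ?m)"
      using outer_in_unit(1)[of ?m i] by (auto simp: dyadic_unit_def)
    obtain \<gamma> where \<gamma>: "r ?m $ i = real \<gamma> / ?N"
      using outer_in_unit(2)[of ?m i] by (auto simp: dyadic_unit_def)
    have lt: "\<alpha> < \<gamma>"
      using outer_nonempty[of ?m i] unfolding \<alpha> \<gamma> by (simp add: divide_less_cancel)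
    have "r ?m $ i - l ?m $ i \<le> (1/2) ^ \<kappa> i + 2 * (1/2) ^ (\<kappa> i + ?m)"
      using outer_width[of ?m i] width(2)[of i] by linarith
    also have "\<dots> = (2 ^ ?m + 2) / ?N"
      by (simp add: power_one_over power_add add_divide_distrib)
    finally have "(real \<gamma> - real \<alpha>) / ?N \<le> (2 ^ ?m + 2) / ?N"
      unfolding \<alpha> \<gamma> by (simp only: diff_divide_distrib)
    then have "real \<gamma> - real \<alpha> \<le> 2 ^ ?m + 2" by (simp add: divide_le_cancel)
    then have "real (\<gamma> - \<alpha>) \<le> real (2 ^ ?m + 2)" using lt by (simp add: of_nat_diff)
    then have "\<gamma> - \<alpha> \<le> 2 ^ ?m + 2" by (simp only: of_nat_le_iff)
    then have "(\<alpha>, \<gamma> - \<alpha>) \<in> {..2 ^ (\<kappa> i + ?m)} \<times> {1..2 ^ ?m + 2}"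
      using \<alpha>(2) lt by auto
    moreover have "(l ?m $ i, r ?m $ i) = (\<lambda>(\<alpha>, \<beta>). (real \<alpha> / ?N, real (\<alpha> + \<beta>) / ?N)) (\<alpha>, \<gamma> - \<alpha>)"
      using lt by (simp add: \<alpha> \<gamma>)
    ultimately show ?thesis unfolding interval_net_def by (rule rev_image_eqI)
  qed
  then show ?thesis
    using outer_unit_box level by (auto simp: box_net_def)
qed

lemma outer_tendsto: "(\<lambda>m. l m) \<longlonglongrightarrow> a" "(\<lambda>m. r m) \<longlonglongrightarrow> b"
proof -
  have lim: "(\<lambda>m. (1/2 :: real) ^ (\<kappa> i + m)) \<longlonglongrightarrow> 0" for i
    using tendsto_mult_left[OF LIMSEQ_realpow_zero[of "1/2 :: real"], of "(1/2) ^ \<kappa> i"] by (simp add: power_add)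
  show "(\<lambda>m. l m) \<longlonglongrightarrow> a"
  proof (rule vec_tendstoI)
    fix i
    have "norm (l m $ i - a $ i) \<le> (1/2) ^ (\<kappa> i + m)" for m
      using outer_bounds(1,3)[where m = m and i = i] by simp
    then have "(\<lambda>m. l m $ i - a $ i) \<longlonglongrightarrow> 0"
      by (intro Lim_null_comparison[OF _ lim[of i]] always_eventually allI)
    then show "(\<lambda>m. l m $ i) \<longlonglongrightarrow> a $ i" by (simp add: LIM_zero_iff)
  qed
  show "(\<lambda>m. r m) \<longlonglongrightarrow> b"
  proof (rule vec_tendstoI)
    fix i
    have "norm (r m $ i - b $ i) \<le> (1/2) ^ (\<kappa> i + m)" for m
      using outer_bounds(2,4)[where m = m and i = i] by simp
    then have "(\<lambda>m. r m $ i - b $ i) \<longlonglongrightarrow> 0"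
      by (intro Lim_null_comparison[OF _ lim[of i]] always_eventually allI)
    then show "(\<lambda>m. r m $ i) \<longlonglongrightarrow> b $ i" by (simp add: LIM_zero_iff)
  qed
qed

text \<open>The lower bound on the widths makes the rounding error relative: each side grows at most
  by the factor \<open>1 + 4 * e\<close>.\<close>

lemma outer_volume_le:
  "(\<Prod>i\<in>UNIV. r m $ i - l m $ i) \<le> (1 + 5 ^ CARD('d) * (1/2) ^ m) * (\<Prod>i\<in>UNIV. b $ i - a $ i)"
proof -
  define e where "e = (1/2 :: real) ^ m"
  have e: "0 \<le> e" "e \<le> 1" by (auto simp: e_def intro: power_le_one)
  \<comment> \<open>The chord bound for a convex function of \<open>e\<close> on the interval from 0
    to 1, where the values at the ends are 1 and \<open>5 ^ n\<close>.\<close>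
  have pow: "(1 + 4 * e) ^ n \<le> 1 + (5 ^ n - 1) * e" for n
  proof (induction n)
    case (Suc n)
    have n5: "0 \<le> (5 :: real) ^ n - 1" by simp
    have "(1 + 4 * e) ^ Suc n \<le> (1 + 4 * e) * (1 + (5 ^ n - 1) * e)"
      using Suc e by (simp add: mult_left_mono)
    also have "\<dots> = 1 + 4 * e + (5 ^ n - 1) * e + 4 * ((5 ^ n - 1) * e) * e" by (simp add: algebra_simps)
    also have "4 * ((5 ^ n - 1) * e) * e \<le> 4 * ((5 ^ n - 1) * e) * 1"
      using e n5 by (intro mult_left_mono) auto
    finally show ?case by (simp add: algebra_simps)
  qed simp
  have "(\<Prod>i\<in>UNIV. r m $ i - l m $ i) \<le> (\<Prod>i\<in>UNIV. (1 + 4 * e) * (b $ i - a $ i))"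
  proof (intro prod_mono conjI)
    fix i
    show "0 \<le> r m $ i - l m $ i" using outer_nonempty[of m i] by simp
    have "2 * (1/2) ^ \<kappa> i * e \<le> 4 * (b $ i - a $ i) * e"
      using width(1)[of i] e by (intro mult_right_mono) auto
    then have "2 * (1/2) ^ (\<kappa> i + m) \<le> 4 * (b $ i - a $ i) * e"
      by (simp add: power_add e_def)
    then show "r m $ i - l m $ i \<le> (1 + 4 * e) * (b $ i - a $ i)"
      using outer_width[of m i] by (simp add: algebra_simps)
  qed
  also have "\<dots> = (1 + 4 * e) ^ CARD('d) * (\<Prod>i\<in>UNIV. b $ i - a $ i)"
    by (simp add: prod.distrib)
  also have "\<dots> \<le> (1 + 5 ^ CARD('d) * e) * (\<Prod>i\<in>UNIV. b $ i - a $ i)"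
  proof (intro mult_right_mono order_trans[OF pow])
    show "1 + (5 ^ CARD('d) - 1) * e \<le> 1 + 5 ^ CARD('d) * e" using e by (simp add: algebra_simps)
    show "0 \<le> (\<Prod>i\<in>UNIV. b $ i - a $ i)" using unit(2) by (intro prod_nonneg) (simp add: less_imp_le)
  qed
  finally show ?thesis by (simp add: e_def)
qed

lemma outer_volume_ge: "(\<Prod>i\<in>UNIV. b $ i - a $ i) \<le> (\<Prod>i\<in>UNIV. r m $ i - l m $ i)"
proof (intro prod_mono conjI)
  fix i show "0 \<le> b $ i - a $ i" "b $ i - a $ i \<le> r m $ i - l m $ i"
    using outer_bounds(1,2)[where m = m and i = i] unit(2)[of i] by linarith+
qed

lemma volume_bounds:
  "(1/2) ^ (k + CARD('d)) \<le> (\<Prod>i\<in>UNIV. b $ i - a $ i)" "(\<Prod>i\<in>UNIV. b $ i - a $ i) \<le> (1/2) ^ k"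
proof -
  have "(\<Prod>i\<in>UNIV. (1/2) ^ \<kappa> i * (1/2)) \<le> (\<Prod>i\<in>UNIV. b $ i - a $ i)"
    using width(1) by (intro prod_mono) (simp add: less_imp_le)
  then show "(1/2) ^ (k + CARD('d)) \<le> (\<Prod>i\<in>UNIV. b $ i - a $ i)"
    by (simp only: prod.distrib half_power_level power_add prod_constant)
  have "(\<Prod>i\<in>UNIV. b $ i - a $ i) \<le> (\<Prod>i\<in>UNIV. (1/2) ^ \<kappa> i)"
    using width(2) unit(2) by (intro prod_mono) (simp add: less_imp_le)
  then show "(\<Prod>i\<in>UNIV. b $ i - a $ i) \<le> (1/2) ^ k" by (simp only: half_power_level)
qed

end

lemma dyadic_width_exists:
  fixes a b :: "real ^ 'd::finite"
  assumes "(a, b) \<in> unit_boxes"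
  obtains \<kappa> where "dyadic_width \<kappa> a b (sum \<kappa> UNIV)"
proof -
  have "\<exists>n. (1/2 :: real) ^ (n + 1) < w \<and> w \<le> (1/2) ^ n" if w: "0 < w" "w \<le> 1" for w :: real
  proof -
    obtain n where n: "(1/2 :: real) ^ n < w" using real_arch_pow_inv[OF w(1), of "1/2"] by auto
    define N where "N = (LEAST n. (1/2 :: real) ^ n < w)"
    have N: "(1/2 :: real) ^ N < w" unfolding N_def using n by (rule LeastI)
    have "N \<noteq> 0" using N w by (intro notI) simp
    then obtain n' where n': "N = Suc n'" by (cases N) auto
    then have "\<not> (1/2 :: real) ^ n' < w" using not_less_Least[of n' "\<lambda>n. (1/2 :: real) ^ n < w"] by (simp add: N_def)
    then show ?thesis using N n' by (intro exI[of _ n']) auto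
  qed
  moreover have "0 < b $ i - a $ i" "b $ i - a $ i \<le> 1" for i
    using assms[unfolded unit_boxes_def, simplified, rule_format, of i] by auto
  ultimately have "\<forall>i. \<exists>n. (1/2 :: real) ^ (n + 1) < b $ i - a $ i \<and> b $ i - a $ i \<le> (1/2) ^ n" by blast
  then obtain \<kappa> where "\<And>i. (1/2 :: real) ^ (\<kappa> i + 1) < b $ i - a $ i \<and> b $ i - a $ i \<le> (1/2) ^ \<kappa> i" by metis
  then have "dyadic_width \<kappa> a b (sum \<kappa> UNIV)"
    using assms by unfold_locales auto
  then show ?thesis by (rule that)
qed

section \<open>Chaining\<close>

text \<open>With \<open>x = ln (1 / V)\<close>, \<open>D_scale V\<close> is
  \<open>ln (exp 1 + x) / sqrt (1 + x)\<close>, and \<open>x\<close> lies between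
  \<open>k / 2\<close> and \<open>k + d\<close>. The numerators differ by a factor of at most 2,
  because \<open>k + 2\<close> is at most the square of \<open>exp 1 + x\<close>; the denominators
  by at most \<open>sqrt (d + 1)\<close>.\<close>

lemma level_scale_le_D_scale:
  assumes V: "(1/2) ^ (k + d) \<le> V" "V \<le> (1/2) ^ k"
  shows "level_scale k \<le> 2 * sqrt (real d + 1) * D_scale V" "0 < D_scale V"
proof -
  have Vpos: "0 < V" using V(1) by (rule less_le_trans[rotated]) simp
  define x where "x = ln (1 / V)"
  have ln_half: "ln ((1/2 :: real) ^ n) = - (real n * ln 2)" for n
    by (simp add: ln_realpow ln_div)
  have "ln ((1/2) ^ (k + d)) \<le> ln V" "ln V \<le> ln ((1/2) ^ k)"
    using V Vpos by (simp_all only: ln_le_cancel_iff zero_less_power zero_less_divide_1_iff zero_less_numeral)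
  then have x1: "real k * ln 2 \<le> x" "x \<le> real (k + d) * ln 2"
    using Vpos unfolding ln_half x_def by (simp_all add: ln_div)
  have x: "real k / 2 \<le> x" "x \<le> real k + real d"
  proof -
    have "real k * (1 / 2) \<le> real k * ln 2" using ln2_ge_two_thirds by (intro mult_left_mono) auto
    then show "real k / 2 \<le> x" using x1(1) by simp
    have "real (k + d) * ln 2 \<le> real (k + d) * 1" using ln_2_less_1 by (intro mult_left_mono) auto
    then show "x \<le> real k + real d" using x1(2) by simp
  qed
  have e2: "2 \<le> exp (1 :: real)" using exp_ge_add_one_self[of "1 :: real"] by simp
  have D: "D_scale V = ln (exp 1 + x) / sqrt (1 + x)"
    using Vpos by (simp add: D_scale_def x_def ln_div)
  have "real k + 2 \<le> (2 + real k / 2)\<^sup>2" by (simp add: power2_eq_square algebra_simps)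
  also have "\<dots> \<le> (exp 1 + x)\<^sup>2" using e2 x by (intro power_mono) auto
  finally have "ln (real k + 2) \<le> ln ((exp 1 + x)\<^sup>2)"
    by (subst ln_le_cancel_iff) (use e2 x in \<open>auto intro!: add_pos_nonneg\<close>)
  also have "\<dots> = 2 * ln (exp 1 + x)" using e2 x by (subst ln_realpow) auto
  finally have num: "ln (real k + 2) / 2 \<le> ln (exp 1 + x)" by simp
  have x0: "0 \<le> x" using x(1) by (rule order_trans[rotated]) simp
  have ln0: "0 < ln (exp 1 + x)" using e2 x0 by (intro ln_gt_zero) auto
  have "0 \<le> real d * real k" by simp
  with x(2) have "1 + x \<le> 1 + real k + real d + real d * real k" by linarith
  also have "\<dots> = (real d + 1) * (real k + 1)" by (simp add: algebra_simps)
  finally have "1 + x \<le> (real d + 1) * (real k + 1)" .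
  then have den: "sqrt (1 + x) \<le> sqrt (real d + 1) * sqrt (real k + 1)"
    by (simp flip: real_sqrt_mult)
  have "(ln (real k + 2) / 2) / (sqrt (real d + 1) * sqrt (real k + 1)) \<le> D_scale V"
    unfolding D using num den x0 ln0 by (intro frac_le) auto
  then show "level_scale k \<le> 2 * sqrt (real d + 1) * D_scale V"
    by (simp add: level_scale_def field_simps)
  show "0 < D_scale V"
    unfolding D using x0 ln0 by (intro divide_pos_pos) auto
qed

lemma D_scale_pos:
  assumes "0 < V" "V \<le> 1" shows "0 < D_scale V"
proof -
  obtain n where n: "(1/2 :: real) ^ n < V" using real_arch_pow_inv[OF assms(1), of "1/2"] by auto
  \<comment> \<open>Level 0 with \<open>n\<close> in place of the dimension turns the two volume
    bounds into \<open>(1/2) ^ n \<le> V \<le> 1\<close>.\<close>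
  show ?thesis
    using level_scale_le_D_scale(2)[of 0 n V] n assms by simp
qed

context kernel_integrals
begin

text \<open>Continuity of every sample path carries bounds from grid boxes to arbitrary boxes
  without a further exceptional null set.\<close>

lemma X_tendsto:
  assumes \<omega>: "\<omega> \<in> space M" and ab: "(a, b) \<in> unit_boxes" and fg: "\<And>m. (f m, g m) \<in> unit_boxes"
    and lim: "f \<longlonglongrightarrow> a" "g \<longlonglongrightarrow> b"
  shows "(\<lambda>m. X (f m) (g m) \<omega>) \<longlonglongrightarrow> X a b \<omega>"
proof -
  let ?S = "{(t, h). h \<in> scales \<and> t \<in> centers h} :: ((real ^ 'd) \<times> (real ^ 'd)) set"
  let ?p = "\<lambda>a b :: real ^ 'd. ((1/2) *\<^sub>R (a + b), (1/2) *\<^sub>R (b - a))"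
  have cont: "continuous_on ?S (\<lambda>(t, h). Z t h \<omega>)"
    using integrals \<omega> by (simp add: continuous_kernel_integrals_def)
  have "(\<lambda>m. ?p (f m) (g m)) \<longlonglongrightarrow> ?p a b"
    by (intro tendsto_intros lim)
  then have "(\<lambda>m. (\<lambda>(t, h). Z t h \<omega>) (?p (f m) (g m))) \<longlonglongrightarrow> (\<lambda>(t, h). Z t h \<omega>) (?p a b)"
    by (rule continuous_on_tendsto_compose[OF cont]) (use unit_box_param[OF ab] unit_box_param[OF fg] in \<open>auto intro!: always_eventually\<close>)
  then show ?thesis by (simp add: X_def)
qed

text \<open>Telescopes over the outer boxes of depth \<open>m\<close>, \<open>m + 1\<close> and so
  on, which converge to the box itself. The increments decay geometrically up to a linear factor,
  and \<open>S\<close> is the resulting convergent series.\<close>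

lemma chaining_bound:
  fixes a b :: "real ^ 'd"
  assumes width: "dyadic_width \<kappa> a b k" and \<omega>: "\<omega> \<in> space M" and B: "0 \<le> B"
    and C: "\<And>(a :: real ^ 'd) b a' b' Q (s :: 'd \<Rightarrow> real).
     (\<And>j. a $ j < b $ j \<and> 0 < s j \<and> a' $ j \<le> a $ j \<and> b $ j \<le> b' $ j \<and> a $ j - a' $ j \<le> s j \<and> b' $ j - b $ j \<le> s j
        \<and> s j * (\<Prod>k\<in>UNIV - {j}. b' $ k - a' $ k) \<le> Q) \<Longrightarrow>
     (\<integral>\<^sup>+x. ennreal ((box_kernel \<psi> a b x - box_kernel \<psi> a' b' x)\<^sup>2) \<partial>lebesgue) \<le> ennreal (C * Q)"
    and modulus: "\<And>n a b a' b'. (a, b) \<in> dyadic_boxes n \<Longrightarrow> (a', b') \<in> dyadic_boxes n \<Longrightarrow>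
     (\<integral>\<^sup>+x. ennreal ((box_kernel \<psi> a b x - box_kernel \<psi> a' b' x)\<^sup>2) \<partial>lebesgue) \<le> ennreal (2 * C * 3 ^ CARD('d) * (1/2) ^ n) \<Longrightarrow>
     \<bar>X a b \<omega> - X a' b' \<omega>\<bar> \<le> B * sqrt ((1/2) ^ n) * (real n + 1)"
  defines "S \<equiv> \<Sum>j. real (Suc j) * sqrt (1/2) ^ j"
  shows "\<bar>X a b \<omega> - X (outer_lower \<kappa> m a) (outer_upper \<kappa> m b) \<omega>\<bar> \<le> B * S * sqrt (1/2) ^ (k + m) * (real (k + m) + 2)"
proof -
  interpret dyadic_width \<kappa> a b k by (rule width)
  define \<rho> where "\<rho> = sqrt (1/2)"
  have \<rho>: "0 < \<rho>" "\<rho> < 1" by (auto simp: \<rho>_def)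
  define x where "x j = X (l (m + j)) (r (m + j)) \<omega>" for j
  have sm: "summable (\<lambda>j. real (Suc j) * \<rho> ^ j)"
    using geometric_deriv_sums[of \<rho>] \<rho> by (auto simp: sums_iff)
  define A where "A = B * \<rho> ^ (k + m) * (real (k + m) + 2)"
  have A: "0 \<le> A" using B \<rho> by (simp add: A_def)
  have step: "\<bar>x (Suc j) - x j\<bar> \<le> A * (real (Suc j) * \<rho> ^ j)" for j
  proof -
    \<comment> \<open>Both boxes lie on the isotropic grid of the finer depth, hence the additional
      1 in \<open>?n\<close>. It is compensated by the factor 2 in the constant of
      \<open>modulus\<close>.\<close>
    let ?m = "m + j" and ?n = "k + m + j + 1"
    have "(\<integral>\<^sup>+x. ennreal ((box_kernel \<psi> (l (Suc ?m)) (r (Suc ?m)) x - box_kernel \<psi> (l ?m) (r ?m) x)\<^sup>2) \<partial>lebesgue)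
      \<le> ennreal (C * (3 ^ CARD('d) * (1/2) ^ (k + ?m)))"
    proof (rule C)
      fix i
      show "l (Suc ?m) $ i < r (Suc ?m) $ i \<and> 0 < (1/2 :: real) ^ (\<kappa> i + ?m) \<and> l ?m $ i \<le> l (Suc ?m) $ i
        \<and> r (Suc ?m) $ i \<le> r ?m $ i \<and> l (Suc ?m) $ i - l ?m $ i \<le> (1/2) ^ (\<kappa> i + ?m)
        \<and> r ?m $ i - r (Suc ?m) $ i \<le> (1/2) ^ (\<kappa> i + ?m)
        \<and> (1/2) ^ (\<kappa> i + ?m) * (\<Prod>k\<in>UNIV - {i}. r ?m $ k - l ?m $ k) \<le> 3 ^ CARD('d) * (1/2) ^ (k + ?m)"
        using outer_nonempty[of "Suc ?m" i] outer_bounds[where m = ?m and i = i] outer_bounds(1,2)[where m = "Suc ?m" and i = i] outer_step[of i ?m]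
        by (intro conjI) (auto simp del: power_Suc)
    qed
    also have "C * (3 ^ CARD('d) * (1/2) ^ (k + ?m)) = 2 * C * 3 ^ CARD('d) * (1/2) ^ ?n"
      by (simp add: add.assoc)
    finally have "\<bar>X (l (Suc ?m)) (r (Suc ?m)) \<omega> - X (l ?m) (r ?m) \<omega>\<bar> \<le> B * sqrt ((1/2) ^ ?n) * (real ?n + 1)"
      by (intro modulus outer_dyadic_box) auto
    also have "sqrt ((1/2) ^ ?n) = \<rho> ^ ?n" by (simp only: \<rho>_def real_sqrt_power)
    \<comment> \<open>Separates the starting level \<open>k + m\<close> from the running index
      \<open>j\<close>, so that the series no longer depends on the box.\<close>
    also have "B * \<rho> ^ ?n * (real ?n + 1) \<le> B * (\<rho> ^ (k + m) * \<rho> ^ j) * ((real (k + m) + 2) * real (Suc j))"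
    proof (intro mult_mono mult_left_mono)
      have "\<rho> ^ ?n \<le> \<rho> ^ (k + m + j)" using \<rho> by (intro power_decreasing) auto
      then show "\<rho> ^ ?n \<le> \<rho> ^ (k + m) * \<rho> ^ j" by (simp only: power_add)
      have "real ?n + 1 = (real (k + m) + 2) + real j" by simp
      also have "\<dots> \<le> (real (k + m) + 2) + (real (k + m) + 2) * real j"
        using mult_right_mono[of 1 "real (k + m) + 2" "real j"] by simp
      finally show "real ?n + 1 \<le> (real (k + m) + 2) * real (Suc j)" by (simp add: algebra_simps)
    qed (use B \<rho> in auto)
    also have "\<dots> = A * (real (Suc j) * \<rho> ^ j)" by (simp add: A_def mult_ac)
    finally show ?thesis by (simp add: x_def)
  qed
  have partial: "\<bar>x j - x 0\<bar> \<le> A * (\<Sum>i<j. real (Suc i) * \<rho> ^ i)" for j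
  proof (induction j)
    case (Suc j)
    have "\<bar>x (Suc j) - x 0\<bar> \<le> \<bar>x (Suc j) - x j\<bar> + \<bar>x j - x 0\<bar>" by linarith
    also have "\<dots> \<le> A * (real (Suc j) * \<rho> ^ j) + A * (\<Sum>i<j. real (Suc i) * \<rho> ^ i)"
      by (intro add_mono step Suc)
    finally show ?case by (simp only: sum.lessThan_Suc distrib_left add.commute)
  qed simp
  have "\<bar>x j - x 0\<bar> \<le> A * S" for j
  proof -
    have "(\<Sum>i<j. real (Suc i) * \<rho> ^ i) \<le> S"
      unfolding S_def \<rho>_def[symmetric] using sm \<rho> by (intro sum_le_suminf) auto
    then show ?thesis using partial[of j] A mult_left_mono by (meson order_trans)
  qed
  moreover have "(\<lambda>j. x j) \<longlonglongrightarrow> X a b \<omega>"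
    unfolding x_def
  proof (rule X_tendsto[OF \<omega> box])
    show "(\<lambda>j. l (m + j)) \<longlonglongrightarrow> a" "(\<lambda>j. r (m + j)) \<longlonglongrightarrow> b"
      using LIMSEQ_ignore_initial_segment[OF outer_tendsto(1), of m] LIMSEQ_ignore_initial_segment[OF outer_tendsto(2), of m]
      by (simp_all add: add.commute)
  qed (rule outer_unit_box)
  then have "(\<lambda>j. \<bar>x j - x 0\<bar>) \<longlonglongrightarrow> \<bar>X a b \<omega> - x 0\<bar>" by (intro tendsto_intros)
  ultimately have "\<bar>X a b \<omega> - x 0\<bar> \<le> A * S" by (intro LIMSEQ_le_const2) auto
  then show ?thesis by (simp add: A_def x_def \<rho>_def mult_ac)
qed

text \<open>Passing from the net box to the box itself costs three terms: the change of the
  normalising volume acting on \<open>Gamma_scale\<close>, the same change acting on the net error,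
  and the chaining remainder. At depth \<open>net_depth k\<close> each is at most a constant times
  \<open>level_scale k\<close>.\<close>

lemma normalized_bound:
  fixes a b :: "real ^ 'd"
  assumes width: "dyadic_width \<kappa> a b k" and B1: "0 \<le> B1" and B2: "0 \<le> B2"
    and chain: "\<And>m. \<bar>X a b \<omega> - X (outer_lower \<kappa> m a) (outer_upper \<kappa> m b) \<omega>\<bar> \<le> B1 * sqrt (1/2) ^ (k + m) * (real (k + m) + 2)"
    and net: "\<And>a b. (a, b) \<in> box_net k \<Longrightarrow> \<bar>X a b \<omega> / (sqrt (\<Prod>i\<in>UNIV. (b $ i - a $ i) / 2) * L2norm \<psi>)\<bar>
       \<le> Gamma_scale (\<Prod>i\<in>UNIV. b $ i - a $ i) + B2 * level_scale k"
  shows "\<bar>X a b \<omega> / (sqrt (\<Prod>i\<in>UNIV. (b $ i - a $ i) / 2) * L2norm \<psi>)\<bar>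
    \<le> Gamma_scale (\<Prod>i\<in>UNIV. b $ i - a $ i)
      + ((1 + 5 ^ CARD('d)) * B2 + 5 ^ CARD('d) * (4 * (real CARD('d) + 1)) + 20 * 2 ^ CARD('d) * B1 / L2norm \<psi>) * level_scale k"
proof -
  interpret dyadic_width \<kappa> a b k by (rule width)
  obtain e where e: "net_depth k = 8 * e" "k + 1 \<le> 2 ^ e"
    using net_depth_bounds by metis
  define m where "m = net_depth k"
  define E where "E = (2 :: real) ^ e"
  define d where "d = CARD('d)"
  define L where "L = L2norm \<psi>"
  define \<delta> where "\<delta> = level_scale k"
  define V V0 where "V = (\<Prod>i\<in>UNIV. b $ i - a $ i)" and "V0 = (\<Prod>i\<in>UNIV. r m $ i - l m $ i)"
  have L: "0 < L" using L2norm_pos by (simp add: L_def)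
  have "real (k + 1) \<le> real (2 ^ e)" using e(2) by (simp only: of_nat_le_iff)
  then have E: "real k + 1 \<le> E" by (simp add: E_def)
  then have E1: "1 \<le> E" by linarith
  have \<delta>: "1 / (real k + 1) \<le> 2 * \<delta>" "0 < \<delta>"
    using level_scale_ge[of k] level_scale_pos[of k] unfolding \<delta>_def by (simp_all add: field_simps)
  have V: "0 < V" "V \<le> 1" "0 < V0" "V0 \<le> 1"
    using unit_box_volume[OF box] unit_box_volume[OF outer_unit_box[of m]] by (auto simp: V_def V0_def)
  have VV0: "V \<le> V0" "V0 \<le> (1 + 5 ^ d * (1/2) ^ m) * V"
    using outer_volume_ge[of m] outer_volume_le[of m] by (auto simp: V_def V0_def d_def)
  have half: "(\<Prod>i\<in>UNIV. (v $ i - u $ i) / 2) = (\<Prod>i\<in>UNIV. v $ i - u $ i) / 2 ^ d" for u v :: "real ^ 'd"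
    by (simp add: prod_dividef d_def)
  define y y0 where "y = \<bar>X a b \<omega>\<bar> / (sqrt (V / 2 ^ d) * L)" and "y0 = \<bar>X (l m) (r m) \<omega>\<bar> / (sqrt (V0 / 2 ^ d) * L)"
  have y: "\<bar>X a b \<omega> / (sqrt (\<Prod>i\<in>UNIV. (b $ i - a $ i) / 2) * L2norm \<psi>)\<bar> = y"
    using L V by (simp add: half y_def V_def[symmetric] L_def[symmetric] abs_divide abs_mult)
  have y0: "y0 \<le> Gamma_scale V0 + B2 * \<delta>"
    using net[OF outer_in_box_net] L V
    by (simp add: half y0_def m_def[symmetric] V0_def[symmetric] L_def[symmetric] abs_divide abs_mult \<delta>_def)
  have y0nn: "0 \<le> y0" using L V by (simp add: y0_def)
  define R where "R = B1 * sqrt (1/2) ^ (k + m) * (real (k + m) + 2)"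
  have R0: "0 \<le> R" using B1 by (simp add: R_def)
  have tri: "\<bar>X a b \<omega>\<bar> \<le> \<bar>X (l m) (r m) \<omega>\<bar> + R" using chain[of m] unfolding R_def by linarith
  \<comment> \<open>Relative excess of the outer volume. It is of order
    \<open>(k + 1) ^ (- 8)\<close>, of which only two powers are used.\<close>
  define \<eta> where "\<eta> = 5 ^ d * (1/2 :: real) ^ m"
  have \<eta>0: "0 \<le> \<eta>" by (simp add: \<eta>_def)
  have m8: "(1/2 :: real) ^ m = 1 / E ^ 8"
    by (simp add: m_def e(1) E_def power_one_over mult.commute flip: power_mult)
  have \<eta>1: "\<eta> \<le> 5 ^ d * (1 / (real k + 1) ^ 2)"
  proof -
    have "(real k + 1) ^ 2 \<le> E ^ 2" using E by (intro power_mono) auto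
    also have "\<dots> \<le> E ^ 8" using E1 by (intro power_increasing) auto
    finally have "1 / E ^ 8 \<le> 1 / (real k + 1) ^ 2" using E1 by (intro divide_left_mono) auto
    then show ?thesis unfolding \<eta>_def m8 by (intro mult_left_mono) auto
  qed
  have \<eta>2: "\<eta> \<le> 5 ^ d" unfolding \<eta>_def using power_le_one[of "1/2 :: real" m] by (simp add: mult_left_le)
  have main: "y \<le> (1 + \<eta>) * y0 + R / (sqrt (V / 2 ^ d) * L)"
  proof -
    have "\<bar>X (l m) (r m) \<omega>\<bar> / (sqrt (V / 2 ^ d) * L) = sqrt (V0 / V) * y0"
      using V L by (simp add: y0_def real_sqrt_divide)
    also have "\<dots> \<le> (1 + \<eta>) * y0"
    proof (rule mult_right_mono[OF _ y0nn])
      have q: "1 \<le> V0 / V" "V0 / V \<le> 1 + \<eta>" using VV0 V by (auto simp: \<eta>_def divide_le_eq le_divide_eq)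
      have "sqrt (V0 / V) \<le> sqrt ((V0 / V)\<^sup>2)"
        using q(1) self_le_power[of "V0 / V" 2] by (intro real_sqrt_le_mono) simp
      also have "\<dots> = V0 / V" using V by (simp only: real_sqrt_abs) simp
      finally show "sqrt (V0 / V) \<le> 1 + \<eta>" using q(2) by simp
    qed
    finally have 1: "\<bar>X (l m) (r m) \<omega>\<bar> / (sqrt (V / 2 ^ d) * L) \<le> (1 + \<eta>) * y0" .
    have "y \<le> (\<bar>X (l m) (r m) \<omega>\<bar> + R) / (sqrt (V / 2 ^ d) * L)"
      unfolding y_def using tri V L by (intro divide_right_mono) auto
    then show ?thesis using 1 by (simp add: add_divide_distrib)
  qed
  have G: "Gamma_scale V0 \<le> Gamma_scale V"
    unfolding Gamma_scale_def using V VV0 by (simp add: ln_div)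
  have G0: "0 \<le> Gamma_scale V" unfolding Gamma_scale_def using V by simp
  \<comment> \<open>The true order is the square root of \<open>k\<close>. A linear bound suffices,
    since \<open>\<eta>\<close> brings two powers of \<open>1 / (k + 1)\<close>.\<close>
  have G1: "Gamma_scale V \<le> 2 * (real d + 1) * (real k + 1)"
  proof -
    have "(1/2) ^ (k + d) \<le> V" using volume_bounds(1) by (simp add: V_def d_def)
    then have "1 / V \<le> 2 ^ (k + d)" using V by (simp add: power_one_over field_simps)
    then have "ln (1 / V) \<le> ln (2 ^ (k + d))" using V by (subst ln_le_cancel_iff) auto
    also have "\<dots> = real (k + d) * ln 2" by (simp add: ln_realpow)
    also have "\<dots> \<le> real (k + d) * 1" using ln_2_less_1 by (intro mult_left_mono) auto
    finally have "2 * ln (1 / V) \<le> 2 * (real k + real d)" by simp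
    also have "\<dots> \<le> 2 * (real d + 1) * (real k + 1)" by (simp add: algebra_simps)
    also have "\<dots> \<le> (2 * (real d + 1) * (real k + 1))\<^sup>2"
    proof (rule self_le_power)
      have "1 * 1 \<le> (2 * (real d + 1)) * (real k + 1)" by (intro mult_mono) auto
      then show "1 \<le> 2 * (real d + 1) * (real k + 1)" by simp
    qed simp
    finally have "Gamma_scale V \<le> sqrt ((2 * (real d + 1) * (real k + 1))\<^sup>2)"
      unfolding Gamma_scale_def by (rule real_sqrt_le_mono)
    then show ?thesis by simp
  qed
  have \<eta>G: "\<eta> * Gamma_scale V \<le> 5 ^ d * (4 * (real d + 1)) * \<delta>"
  proof -
    have "\<eta> * Gamma_scale V \<le> (5 ^ d * (1 / (real k + 1) ^ 2)) * (2 * (real d + 1) * (real k + 1))"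
      using \<eta>1 G1 G0 \<eta>0 by (intro mult_mono) auto
    also have "\<dots> = 5 ^ d * (2 * (real d + 1)) * (1 / (real k + 1))"
      by (simp add: power2_eq_square)
    also have "\<dots> \<le> 5 ^ d * (2 * (real d + 1)) * (2 * \<delta>)"
      using \<delta> by (intro mult_left_mono) auto
    also have "\<dots> = 5 ^ d * (4 * (real d + 1)) * \<delta>" by (simp add: algebra_simps)
    finally show ?thesis .
  qed
  have RR: "R / (sqrt (V / 2 ^ d) * L) \<le> (20 * 2 ^ d * B1 / L) * \<delta>"
  proof -
    define \<rho> where "\<rho> = sqrt (1/2 :: real)"
    have \<rho>: "0 < \<rho>" "\<rho>\<^sup>2 = 1/2" by (auto simp: \<rho>_def)
    have "(1/2 :: real) ^ (k + 2 * d) = (1/2) ^ (k + d) / 2 ^ d" by (simp add: power_add power_one_over mult_2)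
    also have "\<dots> \<le> V / 2 ^ d" using volume_bounds(1) by (intro divide_right_mono) (auto simp: V_def d_def)
    finally have "sqrt ((1/2) ^ (k + 2 * d)) \<le> sqrt (V / 2 ^ d)" by (rule real_sqrt_le_mono)
    then have s: "\<rho> ^ (k + 2 * d) \<le> sqrt (V / 2 ^ d)" by (simp only: \<rho>_def real_sqrt_power)
    have "R / (sqrt (V / 2 ^ d) * L) \<le> R / (\<rho> ^ (k + 2 * d) * L)"
      using R0 s L V \<rho> by (intro divide_left_mono mult_right_mono mult_pos_pos) auto
    also have "\<dots> = (B1 / L) * (\<rho> ^ m * (real (k + m) + 2)) / \<rho> ^ (2 * d)"
      using \<rho> by (simp add: R_def \<rho>_def[symmetric] power_add)
    also have "\<rho> ^ (2 * d) = 1 / 2 ^ d" by (simp add: power_mult \<rho> power_one_over)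
    also have "\<rho> ^ m = 1 / E ^ 4"
    proof -
      have "\<rho> ^ m = (\<rho>\<^sup>2) ^ (4 * e)" by (simp add: m_def e(1) flip: power_mult)
      then show ?thesis by (simp add: \<rho> E_def power_one_over mult.commute flip: power_mult)
    qed
    also have "1 / E ^ 4 * (real (k + m) + 2) \<le> 20 * \<delta>"
    proof -
      \<comment> \<open>The sum \<open>k + m + 2\<close> is \<open>(k + 1) + 8 * e + 1\<close>, and
        \<open>k + 1\<close>, \<open>e\<close> and \<open>1\<close> are all at most
        \<open>E\<close>; hence the factor 10.\<close>
      have "real e \<le> E" using less_exp[of e] by (simp add: E_def less_imp_le)
      then have "real (k + m) + 2 \<le> 10 * E" using E E1 by (simp add: m_def e(1))
      then have "1 / E ^ 4 * (real (k + m) + 2) \<le> 1 / E ^ 4 * (10 * E)" using E1 by (intro mult_left_mono) auto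
      also have "\<dots> = 10 / E ^ 3" using E1 by (simp add: eval_nat_numeral)
      also have "\<dots> \<le> 10 / (real k + 1)"
      proof (intro divide_left_mono)
        have "E ^ 1 \<le> E ^ 3" using E1 by (intro power_increasing) auto
        then show "real k + 1 \<le> E ^ 3" using E by simp
      qed (use E1 in auto)
      also have "\<dots> \<le> 20 * \<delta>" using \<delta>(1) by simp
      finally show ?thesis .
    qed
    then have "(B1 / L) * (1 / E ^ 4 * (real (k + m) + 2)) / (1 / 2 ^ d) \<le> (B1 / L) * (20 * \<delta>) / (1 / 2 ^ d)"
      using B1 L by (intro divide_right_mono mult_left_mono) auto
    finally show ?thesis by (simp add: mult_ac)
  qed
  have "y \<le> (1 + \<eta>) * (Gamma_scale V + B2 * \<delta>) + R / (sqrt (V / 2 ^ d) * L)"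
    using main y0 G \<eta>0 mult_left_mono[of y0 "Gamma_scale V + B2 * \<delta>" "1 + \<eta>"] by linarith
  also have "(1 + \<eta>) * (Gamma_scale V + B2 * \<delta>) = Gamma_scale V + \<eta> * Gamma_scale V + (1 + \<eta>) * (B2 * \<delta>)"
    by (simp add: algebra_simps)
  also have "(1 + \<eta>) * (B2 * \<delta>) \<le> (1 + 5 ^ d) * (B2 * \<delta>)"
    using \<eta>2 B2 \<delta> by (intro mult_right_mono) auto
  finally have "y \<le> Gamma_scale V + 5 ^ d * (4 * (real d + 1)) * \<delta> + (1 + 5 ^ d) * (B2 * \<delta>) + (20 * 2 ^ d * B1 / L) * \<delta>"
    using \<eta>G RR by linarith
  then show ?thesis
    unfolding y by (simp add: V_def[symmetric] d_def[symmetric] L_def[symmetric] \<delta>_def[symmetric] algebra_simps)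
qed

end

section \<open>Finiteness, measurability and tightness\<close>

lemma SUP_dense_subset:
  fixes f :: "'a::metric_space \<Rightarrow> real"
  assumes cont: "continuous_on S f" and D: "D \<subseteq> S" "S \<subseteq> closure D"
  shows "(SUP x\<in>S. ereal (f x)) = (SUP x\<in>D. ereal (f x))"
proof (rule antisym)
  show "(SUP x\<in>D. ereal (f x)) \<le> (SUP x\<in>S. ereal (f x))" using D(1) by (rule SUP_subset_mono) simp
  show "(SUP x\<in>S. ereal (f x)) \<le> (SUP x\<in>D. ereal (f x))"
  proof (rule SUP_least)
    fix x assume x: "x \<in> S"
    then obtain s where s: "\<And>n. s n \<in> D" "s \<longlonglongrightarrow> x"
      using D(2) by (meson closure_sequential subsetD)
    have "(\<lambda>n. f (s n)) \<longlonglongrightarrow> f x"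
      using s D(1) x by (intro continuous_on_tendsto_compose[OF cont]) (auto intro!: always_eventually)
    then have lim: "(\<lambda>n. ereal (f (s n))) \<longlonglongrightarrow> ereal (f x)" by simp
    have "ereal (f (s n)) \<le> (SUP x\<in>D. ereal (f x))" for n using s(1) by (intro SUP_upper)
    then show "ereal (f x) \<le> (SUP x\<in>D. ereal (f x))" by (intro LIMSEQ_le_const2[OF lim]) blast
  qed
qed

text \<open>The events that the modulus exceeds \<open>n\<close> decrease to a null set, so
  continuity from above gives tightness.\<close>

lemma (in prob_space) tight_rv_if_AE_finite:
  assumes [measurable]: "T \<in> borel_measurable M" and fin: "AE \<omega> in M. \<bar>T \<omega>\<bar> \<noteq> (\<infinity> :: ereal)"
  shows "tight_rv M T"
  unfolding tight_rv_def
proof (intro conjI allI impI)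
  fix \<epsilon> :: real assume \<epsilon>: "0 < \<epsilon>"
  define A where "A n = {\<omega> \<in> space M. \<bar>T \<omega>\<bar> > ereal (real n)}" for n
  have [measurable]: "A n \<in> sets M" for n unfolding A_def by measurable
  have "decseq A"
    unfolding decseq_def A_def by (auto intro: le_less_trans[rotated])
  then have "(\<lambda>n. prob (A n)) \<longlonglongrightarrow> prob (\<Inter>n. A n)"
    by (intro finite_Lim_measure_decseq) auto
  also have "prob (\<Inter>n. A n) = 0"
  proof -
    have "AE \<omega> in M. \<omega> \<notin> (\<Inter>n. A n)"
      using fin
    proof eventually_elim
      case (elim \<omega>)
      then obtain n :: nat where "\<bar>T \<omega>\<bar> < ereal (real n)"
        using less_PInf_Ex_of_nat by auto
      then show ?case by (auto simp: A_def intro!: exI[of _ n])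
    qed
    then show ?thesis by (subst prob_eq_0) auto
  qed
  finally have "eventually (\<lambda>n. prob (A n) < \<epsilon>) sequentially"
    using \<epsilon> by (rule order_tendstoD(2))
  then obtain n where "prob (A n) < \<epsilon>" by (auto simp: eventually_sequentially)
  then show "\<exists>K::real. prob {\<omega> \<in> space M. \<bar>T \<omega>\<bar> > ereal K} < \<epsilon>" by (auto simp: A_def)
qed fact

lemma continuous_on_Gamma_scale: "continuous_on {0<..1} Gamma_scale"
  unfolding Gamma_scale_def[abs_def] by (intro continuous_intros) auto

lemma continuous_on_D_scale: "continuous_on {0<..1} D_scale"
proof -
  have "1 < exp (exp 1) / r \<and> 1 < exp 1 / r" if "r \<in> {0<..1}" for r :: real
  proof -
    have "1 < exp (1 :: real)" "1 < exp (exp 1 :: real)" by simp_all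
    then show ?thesis using that by (auto simp: less_divide_eq intro: le_less_trans)
  qed
  then have "0 < ln (exp (exp 1) / r) \<and> 0 < ln (exp 1 / r)" if "r \<in> {0<..1}" for r :: real
    using that by (simp add: ln_gt_zero)
  then show ?thesis
    unfolding D_scale_def[abs_def] by (intro continuous_intros) force+
qed

context kernel_integrals
begin

lemma scale_center_param:
  assumes "h \<in> scales" "t \<in> centers h"
  shows "(t - h, t + h) \<in> unit_boxes" "X (t - h) (t + h) = Z t h"
    and "(\<Prod>i\<in>UNIV. ((t + h) $ i - (t - h) $ i) / 2) = (\<Prod>i\<in>UNIV. h $ i)"
    and "(\<Prod>i\<in>UNIV. (t + h) $ i - (t - h) $ i) = 2 ^ CARD('d) * (\<Prod>i\<in>UNIV. h $ i)"
proof -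
  have *: "0 < h $ i \<and> h $ i \<le> t $ i \<and> t $ i \<le> 1 - h $ i" for i
    using assms by (auto simp: scales_def centers_def)
  show "(t - h, t + h) \<in> unit_boxes"
    unfolding unit_boxes_def
  proof clarify
    fix i show "0 \<le> (t - h) $ i \<and> (t - h) $ i < (t + h) $ i \<and> (t + h) $ i \<le> 1"
      using *[of i] by simp
  qed
  have "(1/2) *\<^sub>R ((t - h) + (t + h)) = t" "(1/2) *\<^sub>R ((t + h) - (t - h)) = h"
    by (simp_all add: vec_eq_iff)
  then show "X (t - h) (t + h) = Z t h" by (simp only: X_def)
  have w: "(t + h) $ i - (t - h) $ i = 2 * h $ i" for i by simp
  show "(\<Prod>i\<in>UNIV. ((t + h) $ i - (t - h) $ i) / 2) = (\<Prod>i\<in>UNIV. h $ i)"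
    unfolding w by simp
  show "(\<Prod>i\<in>UNIV. (t + h) $ i - (t - h) $ i) = 2 ^ CARD('d) * (\<Prod>i\<in>UNIV. h $ i)"
    unfolding w by (simp add: prod.distrib)
qed

text \<open>Only the dyadic modulus and the net bound exclude null sets. For every other
  \<open>\<omega>\<close> the argument is deterministic, with a bound depending on
  \<open>\<omega>\<close> but not on \<open>t\<close> and \<open>h\<close>.\<close>

lemma T_stat_AE_bounded: "AE \<omega> in M. T_stat \<psi> Z \<omega> < \<infinity>"
proof -
  from box_kernel_dist_bound obtain C where C0: "0 < C"
    and C': "\<forall>a b a' b' Q. \<forall>s :: 'd \<Rightarrow> real.
     (\<forall>j. a $ j < b $ j \<and> 0 < s j \<and> a' $ j \<le> a $ j \<and> b $ j \<le> b' $ j \<and> a $ j - a' $ j \<le> s j \<and> b' $ j - b $ j \<le> s j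
        \<and> s j * (\<Prod>k\<in>UNIV - {j}. b' $ k - a' $ k) \<le> Q) \<longrightarrow>
     (\<integral>\<^sup>+x. ennreal ((box_kernel \<psi> a b x - box_kernel \<psi> a' b' x)\<^sup>2) \<partial>lebesgue) \<le> ennreal (C * Q)"
    by (elim exE conjE)
  have C: "\<And>(a :: real ^ 'd) b a' b' Q (s :: 'd \<Rightarrow> real).
     (\<And>j. a $ j < b $ j \<and> 0 < s j \<and> a' $ j \<le> a $ j \<and> b $ j \<le> b' $ j \<and> a $ j - a' $ j \<le> s j \<and> b' $ j - b $ j \<le> s j
        \<and> s j * (\<Prod>k\<in>UNIV - {j}. b' $ k - a' $ k) \<le> Q) \<Longrightarrow>
     (\<integral>\<^sup>+x. ennreal ((box_kernel \<psi> a b x - box_kernel \<psi> a' b' x)\<^sup>2) \<partial>lebesgue) \<le> ennreal (C * Q)"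
    using C' by blast
  define L where "L = L2norm \<psi>"
  define S where "S = (\<Sum>j. real (Suc j) * sqrt (1/2) ^ j)"
  have "(\<lambda>j. real (Suc j) * sqrt (1/2) ^ j) sums (1 / (1 - sqrt (1/2))\<^sup>2)"
    using geometric_deriv_sums[of "sqrt (1/2) :: real"] by simp
  then have S0: "0 \<le> S" unfolding S_def by (simp add: sums_unique[symmetric])
  \<comment> \<open>The modulus is taken with precisely the constant that
    \<open>chaining_bound\<close> requires.\<close>
  have c: "0 < 2 * C * 3 ^ CARD('d)" using C0 by simp
  from AE_dyadic_modulus[OF c] AE_box_net_bound show ?thesis
  proof (rule AE_mp[OF AE_conjI], intro AE_I2 impI, elim conjE exE)
    fix \<omega> B1 B2
    assume \<omega>: "\<omega> \<in> space M" and B1: "0 \<le> B1" and B2: "0 \<le> B2"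
      and modulus: "\<forall>n a b a' b'. (a, b) \<in> dyadic_boxes n \<longrightarrow> (a', b') \<in> dyadic_boxes n \<longrightarrow>
     (\<integral>\<^sup>+x. ennreal ((box_kernel \<psi> a b x - box_kernel \<psi> a' b' x)\<^sup>2) \<partial>lebesgue) \<le> ennreal (2 * C * 3 ^ CARD('d) * (1/2) ^ n) \<longrightarrow>
     \<bar>X a b \<omega> - X a' b' \<omega>\<bar> \<le> B1 * sqrt ((1/2) ^ n) * (real n + 1)"
      and net: "\<forall>k. \<forall>(a, b)\<in>box_net k.
     \<bar>X a b \<omega> / (sqrt (\<Prod>i\<in>UNIV. (b $ i - a $ i) / 2) * L2norm \<psi>)\<bar>
       \<le> Gamma_scale (\<Prod>i\<in>UNIV. b $ i - a $ i) + B2 * level_scale k"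
    define K where "K = (1 + 5 ^ CARD('d)) * B2 + 5 ^ CARD('d) * (4 * (real CARD('d) + 1)) + 20 * 2 ^ CARD('d) * (B1 * S) / L"
    have K: "0 \<le> K" using B1 B2 S0 L2norm_pos by (auto simp: K_def L_def intro!: add_nonneg_nonneg)
    have "ereal ((\<bar>Psi_hat \<psi> Z t h \<omega>\<bar> - Gamma_scale (2 ^ CARD('d) * (\<Prod>i\<in>UNIV. h $ i)))
               / D_scale (2 ^ CARD('d) * (\<Prod>i\<in>UNIV. h $ i))) \<le> ereal (K * (2 * sqrt (real CARD('d) + 1)))"
      if ht: "h \<in> scales" "t \<in> centers h" for h t
    proof -
      define a b where "a = t - h" and "b = t + h"
      note par = scale_center_param[OF ht, folded a_def b_def]
      define V where "V = (\<Prod>i\<in>UNIV. b $ i - a $ i)"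
      obtain \<kappa> where width: "dyadic_width \<kappa> a b (sum \<kappa> UNIV)"
        using dyadic_width_exists[OF par(1)] .
      define k where "k = sum \<kappa> UNIV"
      note width = width[folded k_def]
      have "\<bar>X a b \<omega> - X (outer_lower \<kappa> m a) (outer_upper \<kappa> m b) \<omega>\<bar> \<le> (B1 * S) * sqrt (1/2) ^ (k + m) * (real (k + m) + 2)" for m
        unfolding S_def
      proof (rule chaining_bound[OF width \<omega> B1, where C = C])
        fix n a b a' b'
        assume "(a, b) \<in> dyadic_boxes n" "(a', b') \<in> dyadic_boxes n"
          "(\<integral>\<^sup>+x. ennreal ((box_kernel \<psi> a b x - box_kernel \<psi> a' b' x)\<^sup>2) \<partial>lebesgue) \<le> ennreal (2 * C * 3 ^ CARD('d) * (1/2) ^ n)"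
        then show "\<bar>X a b \<omega> - X a' b' \<omega>\<bar> \<le> B1 * sqrt ((1/2) ^ n) * (real n + 1)"
          using modulus by blast
      qed (rule C)
      then have "\<bar>X a b \<omega> / (sqrt (\<Prod>i\<in>UNIV. (b $ i - a $ i) / 2) * L2norm \<psi>)\<bar> \<le> Gamma_scale V + K * level_scale k"
        unfolding V_def K_def L_def using B1 B2 S0 net by (intro normalized_bound[OF width]) auto
      then have "\<bar>Psi_hat \<psi> Z t h \<omega>\<bar> \<le> Gamma_scale V + K * level_scale k"
        by (simp only: Psi_hat_def par)
      also have "K * level_scale k \<le> K * (2 * sqrt (real CARD('d) + 1) * D_scale V)"
        using K dyadic_width.volume_bounds[OF width] level_scale_le_D_scale(1)[of k "CARD('d)" V]
        by (intro mult_left_mono) (auto simp: V_def)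
      finally have le: "\<bar>Psi_hat \<psi> Z t h \<omega>\<bar> - Gamma_scale V \<le> K * (2 * sqrt (real CARD('d) + 1)) * D_scale V"
        by (simp add: mult.assoc)
      have "0 < D_scale V" using unit_box_volume[OF par(1)] D_scale_pos by (auto simp: V_def)
      with le have "(\<bar>Psi_hat \<psi> Z t h \<omega>\<bar> - Gamma_scale V) / D_scale V \<le> K * (2 * sqrt (real CARD('d) + 1))"
        by (simp add: divide_le_eq)
      then show ?thesis by (simp only: V_def par ereal_less_eq)
    qed
    then have "T_stat \<psi> Z \<omega> \<le> ereal (K * (2 * sqrt (real CARD('d) + 1)))"
      unfolding T_stat_def by (intro SUP_least)
    then show "T_stat \<psi> Z \<omega> < \<infinity>" by (rule le_less_trans) simp
  qed
qed

definition normalized_excess :: "'w \<Rightarrow> (real ^ 'd) \<times> (real ^ 'd) \<Rightarrow> real" where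
  "normalized_excess \<omega> = (\<lambda>(t, h). (\<bar>Psi_hat \<psi> Z t h \<omega>\<bar> - Gamma_scale (2 ^ CARD('d) * (\<Prod>i\<in>UNIV. h $ i)))
               / D_scale (2 ^ CARD('d) * (\<Prod>i\<in>UNIV. h $ i)))"

abbreviation index_set :: "((real ^ 'd) \<times> (real ^ 'd)) set" where
  "index_set \<equiv> {(t, h). h \<in> scales \<and> t \<in> centers h}"

lemma T_stat_eq: "T_stat \<psi> Z \<omega> = (SUP p\<in>index_set. ereal (normalized_excess \<omega> p))"
proof (rule antisym)
  show "T_stat \<psi> Z \<omega> \<le> (SUP p\<in>index_set. ereal (normalized_excess \<omega> p))"
    unfolding T_stat_def
  proof (intro SUP_least)
    fix h t :: "real ^ 'd" assume "h \<in> scales" "t \<in> centers h"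
    then have "ereal (normalized_excess \<omega> (t, h)) \<le> (SUP p\<in>index_set. ereal (normalized_excess \<omega> p))"
      by (intro SUP_upper) auto
    then show "ereal ((\<bar>Psi_hat \<psi> Z t h \<omega>\<bar> - Gamma_scale (2 ^ CARD('d) * (\<Prod>i\<in>UNIV. h $ i)))
               / D_scale (2 ^ CARD('d) * (\<Prod>i\<in>UNIV. h $ i))) \<le> (SUP p\<in>index_set. ereal (normalized_excess \<omega> p))"
      by (simp add: normalized_excess_def)
  qed
  show "(SUP p\<in>index_set. ereal (normalized_excess \<omega> p)) \<le> T_stat \<psi> Z \<omega>"
  proof (rule SUP_least, clarify)
    fix t h :: "real ^ 'd" assume "h \<in> scales" "t \<in> centers h"
    then show "ereal (normalized_excess \<omega> (t, h)) \<le> T_stat \<psi> Z \<omega>"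
      unfolding T_stat_def normalized_excess_def prod.case by (intro SUP_upper2[where i = h] SUP_upper2[where i = t]) auto
  qed
qed

lemma index_set_volume:
  fixes t h :: "real ^ 'd"
  assumes "(t, h) \<in> index_set"
  shows "0 < (\<Prod>i\<in>UNIV. h $ i)" "2 ^ CARD('d) * (\<Prod>i\<in>UNIV. h $ i) \<in> {0<..1}"
proof -
  show "0 < (\<Prod>i\<in>UNIV. h $ i)" using assms by (intro prod_pos) (auto simp: scales_def)
  have "h \<in> scales" "t \<in> centers h" using assms by auto
  note par = scale_center_param[OF this]
  show "2 ^ CARD('d) * (\<Prod>i\<in>UNIV. h $ i) \<in> {0<..1}"
    using unit_box_volume[OF par(1)] unfolding par(4) by simp
qed

lemma continuous_normalized_excess:
  assumes \<omega>: "\<omega> \<in> space M"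
  shows "continuous_on index_set (normalized_excess \<omega>)"
proof -
  have Z: "continuous_on index_set (\<lambda>p. Z (fst p) (snd p) \<omega>)"
    using integrals \<omega> by (simp add: continuous_kernel_integrals_def case_prod_beta)
  have vol: "continuous_on index_set (\<lambda>p :: (real ^ 'd) \<times> (real ^ 'd). \<Prod>i\<in>UNIV. snd p $ i)"
    by (intro continuous_intros)
  have vol2: "continuous_on index_set (\<lambda>p :: (real ^ 'd) \<times> (real ^ 'd). 2 ^ CARD('d) * (\<Prod>i\<in>UNIV. snd p $ i))"
    by (intro continuous_intros)
  have range: "(\<lambda>p :: (real ^ 'd) \<times> (real ^ 'd). 2 ^ CARD('d) * (\<Prod>i\<in>UNIV. snd p $ i)) ` index_set \<subseteq> {0<..1}"
    using index_set_volume(2) by fastforce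
  note G = continuous_on_compose2[OF continuous_on_Gamma_scale vol2 range]
  note D = continuous_on_compose2[OF continuous_on_D_scale vol2 range]
  have D0: "D_scale (2 ^ CARD('d) * (\<Prod>i\<in>UNIV. snd p $ i)) \<noteq> 0" if "p \<in> index_set" for p :: "(real ^ 'd) \<times> (real ^ 'd)"
    using D_scale_pos[of "2 ^ CARD('d) * (\<Prod>i\<in>UNIV. snd p $ i)"] range that by fastforce
  have N0: "sqrt (\<Prod>i\<in>UNIV. snd p $ i) * L2norm \<psi> \<noteq> 0" if "p \<in> index_set" for p :: "(real ^ 'd) \<times> (real ^ 'd)"
  proof -
    have "0 < (\<Prod>i\<in>UNIV. snd p $ i)" using index_set_volume(1)[of "fst p" "snd p"] that by simp
    then have "0 < sqrt (\<Prod>i\<in>UNIV. snd p $ i) * L2norm \<psi>"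
      by (intro mult_pos_pos real_sqrt_gt_zero L2norm_pos)
    then show ?thesis by (rule less_imp_neq[symmetric])
  qed
  have eq: "normalized_excess \<omega> = (\<lambda>p. (\<bar>Z (fst p) (snd p) \<omega> / (sqrt (\<Prod>i\<in>UNIV. snd p $ i) * L2norm \<psi>)\<bar>
      - Gamma_scale (2 ^ CARD('d) * (\<Prod>i\<in>UNIV. snd p $ i))) / D_scale (2 ^ CARD('d) * (\<Prod>i\<in>UNIV. snd p $ i)))"
    by (auto simp: fun_eq_iff normalized_excess_def Psi_hat_def)
  show ?thesis
    unfolding eq using D0 N0 by (intro continuous_on_divide continuous_on_diff continuous_on_rabs continuous_on_mult continuous_on_real_sqrt continuous_on_const Z vol G D) auto
qed

text \<open>The supremum runs over an uncountable set; continuity of the paths replaces that set by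
  a countable dense subset.\<close>

lemma T_stat_measurable: "T_stat \<psi> Z \<in> borel_measurable M"
proof -
  obtain D where D: "countable D" "D \<subseteq> index_set" "index_set \<subseteq> closure D"
    using separable by blast
  have "T_stat \<psi> Z \<omega> = (SUP p\<in>D. ereal (normalized_excess \<omega> p))" if "\<omega> \<in> space M" for \<omega>
    unfolding T_stat_eq using continuous_normalized_excess[OF that] D(2,3) by (rule SUP_dense_subset)
  moreover have "(\<lambda>\<omega>. SUP p\<in>D. ereal (normalized_excess \<omega> p)) \<in> borel_measurable M"
  proof (intro borel_measurable_SUP D(1) borel_measurable_ereal)
    fix p assume "p \<in> D"
    then obtain t h where p: "p = (t, h)" "h \<in> scales" "t \<in> centers h" using D(2) by auto
    then have "Z t h \<in> borel_measurable M"
      using integrals by (auto simp: continuous_kernel_integrals_def has_wiener_integral_def)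
    then show "(\<lambda>\<omega>. normalized_excess \<omega> p) \<in> borel_measurable M"
      unfolding p normalized_excess_def prod.case Psi_hat_def by measurable
  qed
  ultimately show ?thesis by (simp cong: measurable_cong)
qed

text \<open>\<open>tight_rv\<close> involves the absolute value, so the value
  \<open>- \<infinity>\<close> has to be excluded as well. One index is enough for that.\<close>

lemma T_stat_lower: "T_stat \<psi> Z \<omega> \<noteq> - \<infinity>"
proof -
  define c :: "real ^ 'd" where "c = (\<chi> i. 1 / 2)"
  have "(c, c) \<in> index_set" by (simp add: c_def scales_def centers_def)
  then have "ereal (normalized_excess \<omega> (c, c)) \<le> T_stat \<psi> Z \<omega>"
    unfolding T_stat_eq by (rule SUP_upper)
  then show ?thesis by auto
qed

end

theorem theorem2p1:
  fixes M :: "'w measure"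
    and W :: "real ^ 'd::finite \<Rightarrow> 'w \<Rightarrow> real"
    and \<psi> :: "real ^ 'd \<Rightarrow> real"
    and Z :: "real ^ 'd \<Rightarrow> real ^ 'd \<Rightarrow> 'w \<Rightarrow> real"
  assumes "prob_space M"
    and "brownian_sheet M W"
    and "is_kernel \<psi>"
    and "continuous_kernel_integrals M W \<psi> Z"
  shows "(AE \<omega> in M. T_stat \<psi> Z \<omega> < \<infinity>) \<and> tight_rv M (T_stat \<psi> Z)"
proof -
  interpret kernel_integrals M W \<psi> Z
    using assms by (simp add: kernel_integrals_def kernel_integrals_axioms_def)
  have "AE \<omega> in M. \<bar>T_stat \<psi> Z \<omega>\<bar> \<noteq> \<infinity>"
    using T_stat_AE_bounded
  proof eventually_elim
    case (elim \<omega>)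
    then show ?case using T_stat_lower[of \<omega>] by (cases "T_stat \<psi> Z \<omega>") auto
  qed
  then show ?thesis
    using T_stat_AE_bounded T_stat_measurable tight_rv_if_AE_finite by blast
qed

end
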